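(* Let $G$ be a locally compact group. If the reduced spine $\mathrm{A}_0^*(G)$ is unital (has a multiplicative identity), then $G$ is maximally almost periodic.
   Context: $G$ is a locally compact Hausdorff group. $\mathcal{T}_0(G)$ is the set of all Hausdorff topologies on $G$ of the form $\eta^{-1}(\tau_H)=\{\eta^{-1}(U):U\in\tau_H\}$, where $H$ is a locally compact group with topology $\tau_H$ and $\eta:G\to H$ is a continuous homomorphism (so $\eta$ is injective). For $\tau\in\mathcal{T}_0(G)$, $(\eta_\tau,G_\tau)$ denotes the pair, unique up to isomorphism, where $G_\tau$ is a locally compact group, $\eta_\tau:G\to G_\tau$ is a continuous homomorphism with dense range, and $\tau=\eta_\tau^{-1}(\tau_{G_\tau})$. $\mathrm{A}(\cdot)$ and $\mathrm{B}(\cdot)$ are the Fourier and Fourier-Stieltjes algebras (Eymard), $\mathrm{A}_\tau(G)=\{u\circ\eta_\tau:u\in\mathrm{A}(G_\tau)\}\subseteq\mathrm{B}(G)$, and $\mathrm{A}_0^*(G)=\overline{\sum_{\tau\in\mathcal{T}_0(G)}\mathrm{A}_\tau(G)}$ (norm closure in $\mathrm{B}(G)$), which is a Banach algebra under pointwise operations. $G$ is maximally almost periodic if its canonical homomorphism into its almost periodic (Bohr) compactification is injective. *)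

theory Defs
  imports "HOL-Analysis.Analysis" "HOL-Algebra.Module" "HOL-Algebra.Product_Groups"
begin

no_notation Congruence.eq_closure_of (\<open>closure'_of\<index>\<close>)

section \<open>Topological groups\<close>

locale topological_group = Group.group G for G :: "('a, 'b) monoid_scheme" (structure) +
  fixes T :: "'a topology"
  assumes topspace_eq: "topspace T = carrier G"
    and continuous_mult: "continuous_map (prod_topology T T) T (\<lambda>(x, y). x \<otimes> y)"
    and continuous_inv: "continuous_map T T (\<lambda>x. inv x)"

definition locally_compact_group :: "('a, 'b) monoid_scheme \<Rightarrow> 'a topology \<Rightarrow> bool" where
  "locally_compact_group G T \<longleftrightarrow>
     topological_group G T \<and> Hausdorff_space T \<and> locally_compact_space T"

definition compact_group :: "('a, 'b) monoid_scheme \<Rightarrow> 'a topology \<Rightarrow> bool" where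
  "compact_group G T \<longleftrightarrow> topological_group G T \<and> Hausdorff_space T \<and> compact_space T"

definition continuous_hom ::
  "('a, 'b) monoid_scheme \<Rightarrow> 'a topology \<Rightarrow> ('h, 'c) monoid_scheme \<Rightarrow> 'h topology \<Rightarrow> ('a \<Rightarrow> 'h) set"
  where "continuous_hom G T H S = {\<phi> \<in> hom G H. continuous_map T S \<phi>}"

section \<open>Unitary representations\<close>

text \<open>Complex Hilbert spaces are modules over the field of complex numbers in the sense of
  HOL-Algebra, with an inner product that is linear in the first argument. As for all module
  records, the multiplicative fields inherited from the type of rings are irrelevant.\<close>

definition complex_ring :: "complex ring" where
  "complex_ring = \<lparr>carrier = UNIV, monoid.mult = (*), one = 1, ring.zero = 0, add = (+)\<rparr>"

record 'v inner_module = "(complex, 'v) module" +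
  inner_prod :: "'v \<Rightarrow> 'v \<Rightarrow> complex"

definition vec_norm :: "'v inner_module \<Rightarrow> 'v \<Rightarrow> real" where
  "vec_norm V \<xi> = sqrt (Re (inner_prod V \<xi> \<xi>))"

text \<open>The locale \<open>Metric_space\<close> requires nonnegativity and symmetry also outside the carrier.\<close>

definition vec_dist :: "'v inner_module \<Rightarrow> 'v \<Rightarrow> 'v \<Rightarrow> real" where
  "vec_dist V \<xi> \<zeta> =
     (if \<xi> \<in> carrier V \<and> \<zeta> \<in> carrier V then vec_norm V (\<xi> \<ominus>\<^bsub>V\<^esub> \<zeta>) else 0)"

locale hilbert_space =
  Module.module complex_ring V for V :: "'v inner_module" +
  assumes inner_add_left:
      "\<lbrakk>\<xi> \<in> carrier V; \<zeta> \<in> carrier V; \<omega> \<in> carrier V\<rbrakk> \<Longrightarrow>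
         inner_prod V (\<xi> \<oplus>\<^bsub>V\<^esub> \<zeta>) \<omega> = inner_prod V \<xi> \<omega> + inner_prod V \<zeta> \<omega>"
    and inner_smult_left:
      "\<lbrakk>\<xi> \<in> carrier V; \<omega> \<in> carrier V\<rbrakk> \<Longrightarrow>
         inner_prod V (c \<odot>\<^bsub>V\<^esub> \<xi>) \<omega> = c * inner_prod V \<xi> \<omega>"
    and inner_commute:
      "\<lbrakk>\<xi> \<in> carrier V; \<zeta> \<in> carrier V\<rbrakk> \<Longrightarrow> inner_prod V \<xi> \<zeta> = cnj (inner_prod V \<zeta> \<xi>)"
    and inner_positive:
      "\<xi> \<in> carrier V \<Longrightarrow> \<xi> \<noteq> \<zero>\<^bsub>V\<^esub> \<Longrightarrow> Re (inner_prod V \<xi> \<xi>) > 0"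
    and complete: "Metric_space.mcomplete (carrier V) (vec_dist V)"

definition unitary_operators :: "'v inner_module \<Rightarrow> ('v \<Rightarrow> 'v) set" where
  "unitary_operators V = {U. bij_betw U (carrier V) (carrier V) \<and>
     (\<forall>\<xi>\<in>carrier V. \<forall>\<zeta>\<in>carrier V. U (\<xi> \<oplus>\<^bsub>V\<^esub> \<zeta>) = U \<xi> \<oplus>\<^bsub>V\<^esub> U \<zeta>) \<and>
     (\<forall>c. \<forall>\<xi>\<in>carrier V. U (c \<odot>\<^bsub>V\<^esub> \<xi>) = c \<odot>\<^bsub>V\<^esub> U \<xi>) \<and>
     (\<forall>\<xi>\<in>carrier V. \<forall>\<zeta>\<in>carrier V. inner_prod V (U \<xi>) (U \<zeta>) = inner_prod V \<xi> \<zeta>)}"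

definition unitary_representation ::
  "('a, 'b) monoid_scheme \<Rightarrow> 'a topology \<Rightarrow> 'v inner_module \<Rightarrow> ('a \<Rightarrow> 'v \<Rightarrow> 'v) \<Rightarrow> bool"
  where "unitary_representation G T V \<pi> \<longleftrightarrow>
     hilbert_space V \<and>
     (\<forall>x\<in>carrier G. \<pi> x \<in> unitary_operators V) \<and>
     (\<forall>x\<in>carrier G. \<forall>y\<in>carrier G. \<forall>\<xi>\<in>carrier V. \<pi> (x \<otimes>\<^bsub>G\<^esub> y) \<xi> = \<pi> x (\<pi> y \<xi>)) \<and>
     (\<forall>\<xi>\<in>carrier V. continuous_map T (Metric_space.mtopology (carrier V) (vec_dist V)) (\<lambda>x. \<pi> x \<xi>))"

section \<open>Fourier-Stieltjes and Fourier algebras\<close>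

text \<open>A complex function on a group \<open>G\<close> is represented by its extension by zero to the
  ambient type, so that pointwise operations and equality of functions are those of the type.\<close>

definition on_group :: "('a, 'b) monoid_scheme \<Rightarrow> ('a \<Rightarrow> complex) \<Rightarrow> 'a \<Rightarrow> complex" where
  "on_group G u = (\<lambda>x. if x \<in> carrier G then u x else 0)"

text \<open>
  Every coefficient \<open>\<langle>\<pi>(x)\<xi>, \<zeta>\<rangle>\<close> of a unitary representation on an arbitrary Hilbert space is a
  coefficient of the closed cyclic subspace \<open>W\<close> generated by \<open>\<xi>\<close>, with \<open>\<zeta>\<close> replaced by its
  orthogonal projection, which does not increase the product of the norms. The map sending
  \<open>\<omega> \<in> W\<close> to \<open>x \<mapsto> \<langle>\<omega>, \<pi>(x)\<xi>\<rangle>\<close> is linear and injective, so \<open>W\<close> has an isomorphic copy whose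
  underlying set consists of functions on \<open>G\<close>. Therefore Hilbert spaces with elements of type
  \<^typ>\<open>'a \<Rightarrow> complex\<close> yield all coefficients, and the correct norm.
\<close>

definition coefficient_of ::
  "('a, 'b) monoid_scheme \<Rightarrow> 'a topology \<Rightarrow> ('a \<Rightarrow> complex) \<Rightarrow>
   ('a \<Rightarrow> complex) inner_module \<Rightarrow> ('a \<Rightarrow> ('a \<Rightarrow> complex) \<Rightarrow> ('a \<Rightarrow> complex)) \<Rightarrow>
   ('a \<Rightarrow> complex) \<Rightarrow> ('a \<Rightarrow> complex) \<Rightarrow> bool"
  where "coefficient_of G T u V \<pi> \<xi> \<zeta> \<longleftrightarrow>
     unitary_representation G T V \<pi> \<and> \<xi> \<in> carrier V \<and> \<zeta> \<in> carrier V \<and>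
     u = on_group G (\<lambda>x. inner_prod V (\<pi> x \<xi>) \<zeta>)"

definition fourier_stieltjes :: "('a, 'b) monoid_scheme \<Rightarrow> 'a topology \<Rightarrow> ('a \<Rightarrow> complex) set" where
  "fourier_stieltjes G T = {u. \<exists>V \<pi> \<xi> \<zeta>. coefficient_of G T u V \<pi> \<xi> \<zeta>}"

text \<open>The norm of B(G) as the dual of the group C*-algebra; by Eymard it is the infimum
  of the products of norms over all representations as a coefficient. Outside B(G) the infimum is
  taken over the empty set and equals infinity.\<close>

definition fs_norm :: "('a, 'b) monoid_scheme \<Rightarrow> 'a topology \<Rightarrow> ('a \<Rightarrow> complex) \<Rightarrow> ennreal" where
  "fs_norm G T u =
     Inf {ennreal (vec_norm V \<xi> * vec_norm V \<zeta>) | V \<pi> \<xi> \<zeta>. coefficient_of G T u V \<pi> \<xi> \<zeta>}"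

definition fs_closure ::
  "('a, 'b) monoid_scheme \<Rightarrow> 'a topology \<Rightarrow> ('a \<Rightarrow> complex) set \<Rightarrow> ('a \<Rightarrow> complex) set" where
  "fs_closure G T A = {u \<in> fourier_stieltjes G T.
     \<forall>\<epsilon>>0. \<exists>v\<in>A. fs_norm G T (\<lambda>x. u x - v x) < ennreal \<epsilon>}"

text \<open>Eymard's definition of A(G): the closure in B(G) of the functions of compact support.\<close>

definition fourier_algebra :: "('a, 'b) monoid_scheme \<Rightarrow> 'a topology \<Rightarrow> ('a \<Rightarrow> complex) set" where
  "fourier_algebra G T =
     fs_closure G T {u \<in> fourier_stieltjes G T. compactin T (T closure_of {x \<in> carrier G. u x \<noteq> 0})}"

section \<open>The reduced spine\<close>

text \<open>
  Let \<open>\<eta>\<close> be a continuous homomorphism from \<open>G\<close> into a Hausdorff topological group \<open>H\<close>.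
  Replacing \<open>H\<close> by the closure of the range of \<open>\<eta>\<close>, which is again locally compact if \<open>H\<close> is,
  changes neither the topology induced on \<open>G\<close> nor \<open>\<eta>\<close>, and makes the range dense. Then
  mapping \<open>h\<close> to the set of all preimages under \<open>\<eta>\<close> of open neighbourhoods of \<open>h\<close> is an injection
  of \<open>H\<close> into the subsets of the power set of \<open>G\<close>. Hence a group on a type of
  arbitrary size may be replaced by one with elements of type \<^typ>\<open>'a set set\<close>, which
  is the type used for the groups \<open>H\<close> below; see \<open>reduced_topologies_any_type\<close> and
  \<open>lc_completion_exists\<close>.
\<close>

definition reduced_topologies :: "('a, 'b) monoid_scheme \<Rightarrow> 'a topology \<Rightarrow> 'a topology set" where
  "reduced_topologies G T = {\<tau>. Hausdorff_space \<tau> \<and>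
     (\<exists>(H :: 'a set set monoid) S \<eta>. locally_compact_group H S \<and> \<eta> \<in> continuous_hom G T H S \<and>
        \<tau> = pullback_topology (carrier G) \<eta> S)}"

definition lc_completion ::
  "('a, 'b) monoid_scheme \<Rightarrow> 'a topology \<Rightarrow> 'a topology \<Rightarrow>
   ('h, 'c) monoid_scheme \<Rightarrow> 'h topology \<Rightarrow> ('a \<Rightarrow> 'h) \<Rightarrow> bool"
  where "lc_completion G T \<tau> H S \<eta> \<longleftrightarrow>
     locally_compact_group H S \<and> \<eta> \<in> continuous_hom G T H S \<and>
     S closure_of (\<eta> ` carrier G) = carrier H \<and> \<tau> = pullback_topology (carrier G) \<eta> S"

text \<open>The pair \<open>(\<eta>, H)\<close> attached to \<open>\<tau>\<close> is unique up to isomorphism, and the resulting space of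
  functions on \<open>G\<close> is invariant under isomorphism, so the choice of the pair can be left open.\<close>

definition fourier_pullback ::
  "('a, 'b) monoid_scheme \<Rightarrow> 'a topology \<Rightarrow> 'a topology \<Rightarrow> ('a \<Rightarrow> complex) set" where
  "fourier_pullback G T \<tau> =
     {on_group G (u \<circ> \<eta>) | (H :: 'a set set monoid) S \<eta> u.
        lc_completion G T \<tau> H S \<eta> \<and> u \<in> fourier_algebra H S}"

definition reduced_spine :: "('a, 'b) monoid_scheme \<Rightarrow> 'a topology \<Rightarrow> ('a \<Rightarrow> complex) set" where
  "reduced_spine G T = fs_closure G T
     {(\<lambda>x. \<Sum>\<tau>\<in>F. u \<tau> x) | F u.
        finite F \<and> F \<subseteq> reduced_topologies G T \<and> (\<forall>\<tau>\<in>F. u \<tau> \<in> fourier_pullback G T \<tau>)}"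

definition unital_function_algebra :: "('a \<Rightarrow> complex) set \<Rightarrow> bool" where
  "unital_function_algebra A \<longleftrightarrow> (\<exists>e\<in>A. \<forall>u\<in>A. (\<lambda>x. e x * u x) = u)"

section \<open>The almost periodic compactification\<close>

text \<open>The Bohr compactification is the closure of the image of \<open>G\<close> in the product of all compact
  groups \<open>K\<close>, taken over all continuous homomorphisms \<open>\<phi>\<close> from \<open>G\<close> into \<open>K\<close>; again
  compact groups with elements of type \<^typ>\<open>'a set set\<close> suffice. The lemma
  \<open>bohr_universal\<close> below is its universal property with respect to compact groups on
  arbitrary types.\<close>

type_synonym 'a compact_image =
  "'a set set monoid \<times> 'a set set topology \<times> ('a \<Rightarrow> 'a set set)"

definition compact_images :: "('a, 'b) monoid_scheme \<Rightarrow> 'a topology \<Rightarrow> 'a compact_image set" where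
  "compact_images G T = {(K, S, \<phi>). compact_group K S \<and> \<phi> \<in> continuous_hom G T K S}"

definition bohr_product :: "('a, 'b) monoid_scheme \<Rightarrow> 'a topology \<Rightarrow> ('a compact_image \<Rightarrow> 'a set set) monoid" where
  "bohr_product G T = product_group (compact_images G T) (\<lambda>(K, S, \<phi>). K)"

definition bohr_product_topology ::
  "('a, 'b) monoid_scheme \<Rightarrow> 'a topology \<Rightarrow> ('a compact_image \<Rightarrow> 'a set set) topology" where
  "bohr_product_topology G T = product_topology (\<lambda>(K, S, \<phi>). S) (compact_images G T)"

definition bohr_map ::
  "('a, 'b) monoid_scheme \<Rightarrow> 'a topology \<Rightarrow> 'a \<Rightarrow> ('a compact_image \<Rightarrow> 'a set set)" where
  "bohr_map G T x = (\<lambda>(K, S, \<phi>)\<in>compact_images G T. \<phi> x)"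

definition bohr_group ::
  "('a, 'b) monoid_scheme \<Rightarrow> 'a topology \<Rightarrow> ('a compact_image \<Rightarrow> 'a set set) monoid" where
  "bohr_group G T = (bohr_product G T)
     \<lparr>carrier := bohr_product_topology G T closure_of (bohr_map G T ` carrier G)\<rparr>"

definition bohr_topology ::
  "('a, 'b) monoid_scheme \<Rightarrow> 'a topology \<Rightarrow> ('a compact_image \<Rightarrow> 'a set set) topology" where
  "bohr_topology G T = subtopology (bohr_product_topology G T) (carrier (bohr_group G T))"

definition maximally_almost_periodic :: "('a, 'b) monoid_scheme \<Rightarrow> 'a topology \<Rightarrow> bool" where
  "maximally_almost_periodic G T \<longleftrightarrow> inj_on (bohr_map G T) (carrier G)"

section \<open>Independence of the choice of types\<close>

lemma closure_of_subgroup: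
  assumes "topological_group H S" and E: "subgroup E H"
  shows "subgroup (S closure_of E) H"
proof -
  interpret topological_group H S by fact
  have EH: "E \<subseteq> carrier H" using E by (rule subgroup.subset)
  have sub: "E \<subseteq> S closure_of E" using EH by (simp add: closure_of_subset topspace_eq)
  show ?thesis
  proof
    show "S closure_of E \<subseteq> carrier H"
      using closure_of_subset_topspace topspace_eq by metis
    show "\<one>\<^bsub>H\<^esub> \<in> S closure_of E" using sub subgroup.one_closed[OF E] by blast
  next
    fix x y assume xy: "x \<in> S closure_of E" "y \<in> S closure_of E"
    have "(\<lambda>(x, y). x \<otimes>\<^bsub>H\<^esub> y) ` (prod_topology S S closure_of (E \<times> E))
        \<subseteq> S closure_of ((\<lambda>(x, y). x \<otimes>\<^bsub>H\<^esub> y) ` (E \<times> E))"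
      by (rule continuous_map_image_closure_subset[OF continuous_mult])
    also have "\<dots> \<subseteq> S closure_of E"
      by (rule closure_of_mono) (auto intro: subgroup.m_closed[OF E])
    finally show "x \<otimes>\<^bsub>H\<^esub> y \<in> S closure_of E" using xy by (force simp: closure_of_Times)
  next
    fix x assume x: "x \<in> S closure_of E"
    have "(\<lambda>x. inv\<^bsub>H\<^esub> x) ` (S closure_of E) \<subseteq> S closure_of ((\<lambda>x. inv\<^bsub>H\<^esub> x) ` E)"
      by (rule continuous_map_image_closure_subset[OF continuous_inv])
    also have "\<dots> \<subseteq> S closure_of E"
      by (rule closure_of_mono) (auto intro: subgroup.m_inv_closed[OF E])
    finally show "inv\<^bsub>H\<^esub> x \<in> S closure_of E" using x by blast
  qed
qed

lemma topological_group_subgroup: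
  assumes "topological_group H S" and D: "subgroup D H"
  shows "topological_group (H\<lparr>carrier := D\<rparr>) (subtopology S D)"
proof -
  interpret topological_group H S by fact
  interpret D: Group.group "H\<lparr>carrier := D\<rparr>" using D by (rule subgroup_imp_group)
  have DH: "D \<subseteq> carrier H" using D by (rule subgroup.subset)
  show ?thesis
  proof
    show "topspace (subtopology S D) = carrier (H\<lparr>carrier := D\<rparr>)"
      using DH by (auto simp: topspace_eq)
    have "continuous_map (subtopology (prod_topology S S) (D \<times> D)) (subtopology S D)
            (\<lambda>(x, y). x \<otimes>\<^bsub>H\<^esub> y)"
      using continuous_mult
      by (intro continuous_map_into_subtopology continuous_map_from_subtopology)
        (auto intro: subgroup.m_closed[OF D])
    then show "continuous_map (prod_topology (subtopology S D) (subtopology S D)) (subtopology S D)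
         (\<lambda>(x, y). x \<otimes>\<^bsub>H\<lparr>carrier := D\<rparr>\<^esub> y)"
      by (simp add: subtopology_Times)
    have "continuous_map (subtopology S D) (subtopology S D) (\<lambda>x. inv\<^bsub>H\<^esub> x)"
      using continuous_inv
      by (intro continuous_map_into_subtopology continuous_map_from_subtopology)
        (auto intro: subgroup.m_inv_closed[OF D])
    then show "continuous_map (subtopology S D) (subtopology S D) (\<lambda>x. inv\<^bsub>H\<lparr>carrier := D\<rparr>\<^esub> x)"
      by (rule continuous_map_eq) (use D in auto)
  qed
qed

lemma topological_group_transport:
  fixes H :: "('h, 'c) monoid_scheme" and f :: "'h \<Rightarrow> 'k"
  assumes "topological_group H S" and inj: "inj_on f (carrier H)"
  obtains K :: "'k monoid" and R
  where "topological_group K R" "f \<in> iso H K" "homeomorphic_map S R f"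
proof -
  interpret topological_group H S by fact
  define g where "g = inv_into (carrier H) f"
  have gf: "g (f x) = x" if "x \<in> carrier H" for x using that inj by (simp add: g_def)
  define K where "K = \<lparr>carrier = f ` carrier H, monoid.mult = (\<lambda>a b. f (g a \<otimes>\<^bsub>H\<^esub> g b)), one = f \<one>\<^bsub>H\<^esub>\<rparr>"
  define R where "R = pullback_topology (f ` carrier H) g S"
  have K: "Group.group K"
  proof (rule groupI)
    fix x assume "x \<in> carrier K"
    then obtain h where h: "h \<in> carrier H" "x = f h" by (auto simp: K_def)
    then show "\<exists>y\<in>carrier K. y \<otimes>\<^bsub>K\<^esub> x = \<one>\<^bsub>K\<^esub>"
      by (intro bexI[of _ "f (inv\<^bsub>H\<^esub> h)"]) (auto simp: K_def gf)
  qed (auto simp: K_def gf m_assoc)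
  interpret K: Group.group K by fact
  have topR: "topspace R = f ` carrier H"
    by (auto simp: R_def topspace_pullback_topology topspace_eq gf)
  have g_cont: "continuous_map R S g"
    unfolding R_def using continuous_map_pullback[of S S id] by (simp add: o_def id_def)
  have f_cont: "continuous_map S R f"
    unfolding R_def
  proof (rule continuous_map_pullback')
    show "continuous_map S S (g \<circ> f)"
      by (rule continuous_map_eq[of S S id]) (auto simp: gf topspace_eq)
  qed (auto simp: topspace_eq)
  have fg: "f (g y) = y" if "y \<in> f ` carrier H" for y using that gf by auto
  have "homeomorphic_maps S R f g"
    unfolding homeomorphic_maps_def using f_cont g_cont gf fg topR topspace_eq by auto
  then have homeo: "homeomorphic_map S R f" using homeomorphic_map_maps by blast
  have hom: "f \<in> hom H K" by (auto simp: hom_def K_def gf)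
  have iso: "f \<in> iso H K" using hom inj by (auto simp: iso_def bij_betw_def K_def)
  have ghf: "group_hom H K f" by (intro group_hom.intro group_hom_axioms.intro hom K group_axioms)
  have "topological_group K R"
  proof
    show "topspace R = carrier K" by (simp add: topR K_def)
    have "continuous_map (prod_topology R R) (prod_topology S S) (\<lambda>(a, b). (g a, g b))"
      using g_cont by (simp add: continuous_map_prod_top)
    from continuous_map_compose[OF continuous_map_compose[OF this continuous_mult] f_cont]
    show "continuous_map (prod_topology R R) R (\<lambda>(x, y). x \<otimes>\<^bsub>K\<^esub> y)"
      by (rule continuous_map_eq) (auto simp: K_def)
    show "continuous_map R R (\<lambda>x. inv\<^bsub>K\<^esub> x)"
      using continuous_map_compose[OF continuous_map_compose[OF g_cont continuous_inv] f_cont]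
    proof (rule continuous_map_eq)
      fix x assume "x \<in> topspace R"
      then obtain h where h: "h \<in> carrier H" "x = f h" by (auto simp: topR)
      then show "(f \<circ> (m_inv H \<circ> g)) x = inv\<^bsub>K\<^esub> x" by (simp add: gf group_hom.hom_inv[OF ghf])
    qed
  qed
  then show thesis using that iso homeo by blast
qed

text \<open>Any Hausdorff group with a dense homomorphic image of \<open>G\<close> has an isomorphic copy with
  elements of type \<^typ>\<open>'a set set\<close>.\<close>

lemma closed_range_transport:
  fixes G :: "('a, 'b) monoid_scheme" and H :: "('h, 'c) monoid_scheme"
  assumes "topological_group H S" and haus: "Hausdorff_space S" and "topological_group G T"
    and \<eta>: "\<eta> \<in> continuous_hom G T H S"
  obtains K :: "'a set set monoid" and R f
  where "topological_group K R" "f \<in> iso (H\<lparr>carrier := S closure_of (\<eta> ` carrier G)\<rparr>) K"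
    "homeomorphic_map (subtopology S (S closure_of (\<eta> ` carrier G))) R f"
    "f \<circ> \<eta> \<in> continuous_hom G T K R" "R closure_of ((f \<circ> \<eta>) ` carrier G) = carrier K"
proof -
  interpret topological_group H S by fact
  interpret G: topological_group G T by fact
  have \<eta>hom: "\<eta> \<in> hom G H" and \<eta>cont: "continuous_map T S \<eta>"
    using \<eta> by (auto simp: continuous_hom_def)
  have gh\<eta>: "group_hom G H \<eta>"
    by (intro group_hom.intro group_hom_axioms.intro \<eta>hom G.group_axioms group_axioms)
  define E where "E = \<eta> ` carrier G"
  define D where "D = S closure_of E"
  have EH: "E \<subseteq> carrier H" using \<eta>hom by (auto simp: E_def hom_def)
  have ED: "E \<subseteq> D" unfolding D_def using EH by (simp add: closure_of_subset topspace_eq)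
  have D: "subgroup D H" unfolding D_def E_def
    by (rule closure_of_subgroup[OF assms(1)]) (rule group_hom.img_is_subgroup[OF gh\<eta>])
  define f where "f h = {\<eta> -` U \<inter> carrier G | U. openin S U \<and> h \<in> U}" for h
  have inj: "inj_on f D"
  proof (rule inj_onI, rule ccontr)
    fix h k assume hk: "h \<in> D" "k \<in> D" "f h = f k" "h \<noteq> k"
    then have "h \<in> topspace S" "k \<in> topspace S"
      using subgroup.subset[OF D] topspace_eq by auto
    with haus hk(4) obtain U V
      where UV: "openin S U" "openin S V" "h \<in> U" "k \<in> V" "disjnt U V"
      unfolding Hausdorff_space_def by (elim allE[of _ h] allE[of _ k]) auto
    then have "\<eta> -` V \<inter> carrier G \<in> f k" by (auto simp: f_def)
    then have "\<eta> -` V \<inter> carrier G \<in> f h" by (simp only: hk(3))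
    then obtain W where W: "openin S W" "h \<in> W" "\<eta> -` V \<inter> carrier G = \<eta> -` W \<inter> carrier G"
      by (auto simp: f_def)
    have "openin S (U \<inter> W)" "h \<in> U \<inter> W" using UV W by auto
    with hk(1) obtain y where "y \<in> E" "y \<in> U \<inter> W" unfolding D_def in_closure_of by blast
    then show False using W UV by (auto simp: E_def disjnt_iff)
  qed
  interpret D: topological_group "H\<lparr>carrier := D\<rparr>" "subtopology S D"
    using assms(1) D by (rule topological_group_subgroup)
  obtain K :: "'a set set monoid" and R
    where KR: "topological_group K R" "f \<in> iso (H\<lparr>carrier := D\<rparr>) K"
      "homeomorphic_map (subtopology S D) R f"
    by (rule topological_group_transport[OF D.topological_group_axioms, of f]) (use inj in auto)
  interpret K: topological_group K R by fact
  have \<eta>D: "continuous_map T (subtopology S D) \<eta>"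
    by (rule continuous_map_into_subtopology[OF \<eta>cont]) (use ED in \<open>auto simp: E_def G.topspace_eq\<close>)
  have fcont: "continuous_map (subtopology S D) R f"
    using KR(3) by (rule homeomorphic_imp_continuous_map)
  have fhom: "f \<in> hom (H\<lparr>carrier := D\<rparr>) K" using KR(2) by (simp add: iso_def)
  have f\<eta>: "f \<circ> \<eta> \<in> continuous_hom G T K R"
    unfolding continuous_hom_def
  proof (intro CollectI conjI)
    show "continuous_map T R (f \<circ> \<eta>)" using \<eta>D fcont by (rule continuous_map_compose)
    have "\<eta> \<in> hom G (H\<lparr>carrier := D\<rparr>)" using \<eta>hom ED by (auto simp: hom_def E_def)
    then show "f \<circ> \<eta> \<in> hom G K" using fhom by (rule Group.hom_compose)
  qed
  have "f ` (subtopology S D closure_of E) \<subseteq> R closure_of (f ` E)"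
    by (rule continuous_map_image_closure_subset[OF fcont])
  moreover have "subtopology S D closure_of E = D"
    unfolding closure_of_subtopology using ED by (simp add: Int_absorb1 flip: D_def)
  moreover have "f ` D = carrier K" using KR(2) by (auto simp: iso_def bij_betw_def)
  moreover have "R closure_of (f ` E) \<subseteq> carrier K"
    using closure_of_subset_topspace[of R] K.topspace_eq by auto
  ultimately have "R closure_of ((f \<circ> \<eta>) ` carrier G) = carrier K"
    by (simp add: E_def image_comp)
  with KR f\<eta> show thesis using that unfolding D_def E_def by blast
qed

text \<open>The topologies induced by locally compact groups on arbitrary types are all contained in
  \<open>reduced_topologies\<close>, and are induced by a homomorphism with dense range.\<close>

lemma lc_completion_exists:
  fixes G :: "('a, 'b) monoid_scheme" and H :: "('h, 'c) monoid_scheme"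
  assumes "topological_group G T" "locally_compact_group H S" "\<eta> \<in> continuous_hom G T H S"
  shows "\<exists>(K :: 'a set set monoid) R \<theta>.
           lc_completion G T (pullback_topology (carrier G) \<eta> S) K R \<theta>"
proof -
  interpret G: topological_group G T by fact
  have H: "topological_group H S" "Hausdorff_space S" "locally_compact_space S"
    using assms(2) by (auto simp: locally_compact_group_def)
  let ?D = "S closure_of (\<eta> ` carrier G)"
  obtain K :: "'a set set monoid" and R f
    where K: "topological_group K R" "f \<in> iso (H\<lparr>carrier := ?D\<rparr>) K"
      "homeomorphic_map (subtopology S ?D) R f"
      "f \<circ> \<eta> \<in> continuous_hom G T K R" "R closure_of ((f \<circ> \<eta>) ` carrier G) = carrier K"
    by (rule closed_range_transport[OF H(1,2) assms(1,3)])
  have homeo: "subtopology S ?D homeomorphic_space R"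
    using K(3) by (auto simp: homeomorphic_space homeomorphic_map_imp_homeomorphic_space)
  have "locally_compact_space R"
    using locally_compact_space_closed_subset[OF H(3) closedin_closure_of]
      homeomorphic_locally_compact_space[OF homeo] by blast
  moreover have "Hausdorff_space R"
    using Hausdorff_space_subtopology[OF H(2)] homeomorphic_Hausdorff_space[OF homeo] by blast
  moreover have "pullback_topology (carrier G) \<eta> S = pullback_topology (carrier G) (f \<circ> \<eta>) R"
    unfolding topology_eq openin_pullback_topology
  proof (intro allI iffI)
    have sub: "\<eta> ` carrier G \<subseteq> ?D" "?D \<subseteq> topspace S"
      using assms(3) topological_group.topspace_eq[OF H(1)]
        closure_of_subset[of "\<eta> ` carrier G" S] closure_of_subset_topspace[of S "\<eta> ` carrier G"]
      by (auto simp: continuous_hom_def hom_def)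
    have inj: "inj_on f ?D" using K(2) by (auto simp: iso_def bij_betw_def)
    fix X
    { assume "\<exists>U. openin S U \<and> X = \<eta> -` U \<inter> carrier G"
      then obtain U where U: "openin S U" "X = \<eta> -` U \<inter> carrier G" by blast
      have "openin (subtopology S ?D) (U \<inter> ?D)" using U by (auto simp: openin_subtopology)
      then have "openin R (f ` (U \<inter> ?D))"
        using K(3) homeomorphic_imp_open_map open_map_def by blast
      moreover have "X = (f \<circ> \<eta>) -` (f ` (U \<inter> ?D)) \<inter> carrier G"
      proof -
        have *: "f (\<eta> x) \<in> f ` (U \<inter> ?D) \<longleftrightarrow> \<eta> x \<in> U \<inter> ?D" if "x \<in> carrier G" for x
          using that sub(1) by (intro inj_on_image_mem_iff[OF inj]) auto
        have **: "x \<in> X \<longleftrightarrow> x \<in> (f \<circ> \<eta>) -` (f ` (U \<inter> ?D)) \<inter> carrier G" for x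
        proof (cases "x \<in> carrier G")
          case True
          then have "\<eta> x \<in> ?D" using sub(1) by blast
          then show ?thesis using *[OF True] True by (simp only: U(2) vimage_eq Int_iff o_apply simp_thms)
        next
          case False
          then show ?thesis by (simp only: U(2) Int_iff simp_thms)
        qed
        show ?thesis by (rule Set.set_eqI) (rule **)
      qed
      ultimately show "\<exists>V. openin R V \<and> X = (f \<circ> \<eta>) -` V \<inter> carrier G" by blast }
    { assume "\<exists>V. openin R V \<and> X = (f \<circ> \<eta>) -` V \<inter> carrier G"
      then obtain V where V: "openin R V" "X = (f \<circ> \<eta>) -` V \<inter> carrier G" by blast
      have "continuous_map (subtopology S ?D) R f" using K(3) by (rule homeomorphic_imp_continuous_map)
      with V(1) have "openin (subtopology S ?D) {x \<in> topspace (subtopology S ?D). f x \<in> V}"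
        by (simp only: continuous_map_def)
      then obtain U where U: "openin S U" "{x \<in> topspace (subtopology S ?D). f x \<in> V} = U \<inter> ?D"
        by (auto simp: openin_subtopology)
      have "x \<in> X \<longleftrightarrow> x \<in> \<eta> -` U \<inter> carrier G" for x
      proof (cases "x \<in> carrier G")
        case True
        then have D: "\<eta> x \<in> ?D" "\<eta> x \<in> topspace S" using sub by blast+
        then have "f (\<eta> x) \<in> V \<longleftrightarrow> \<eta> x \<in> U"
          using arg_cong[OF U(2), of "\<lambda>A. \<eta> x \<in> A"] by simp
        then show ?thesis using True by (simp only: V(2) vimage_eq Int_iff o_apply simp_thms)
      next
        case False
        then show ?thesis by (simp only: V(2) Int_iff simp_thms)
      qed
      with U(1) show "\<exists>U. openin S U \<and> X = \<eta> -` U \<inter> carrier G" by (auto simp: set_eq_iff) }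
  qed
  ultimately show ?thesis
    using K unfolding lc_completion_def locally_compact_group_def by blast
qed

lemma reduced_topologies_any_type:
  fixes G :: "('a, 'b) monoid_scheme" and H :: "('h, 'c) monoid_scheme"
  assumes "topological_group G T" "locally_compact_group H S" "\<eta> \<in> continuous_hom G T H S"
    and "Hausdorff_space (pullback_topology (carrier G) \<eta> S)"
  shows "pullback_topology (carrier G) \<eta> S \<in> reduced_topologies G T"
  using lc_completion_exists[OF assms(1-3)] assms(4)
  unfolding reduced_topologies_def lc_completion_def by blast

lemma topological_group_product:
  assumes "\<And>i. i \<in> I \<Longrightarrow> topological_group (K i) (S i)"
  shows "topological_group (product_group I K) (product_topology S I)"
proof -
  have grp: "Group.group (K i)" if "i \<in> I" for i
    using assms[OF that] by (simp add: topological_group_def)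
  interpret P: Group.group "product_group I K" using grp by simp
  have top: "topspace (product_topology S I) = carrier (product_group I K)"
    using topological_group.topspace_eq[OF assms] by (auto intro!: PiE_cong)
  have proj: "continuous_map (product_topology S I) (S i) (\<lambda>x. x i)" if "i \<in> I" for i
    using that by (rule continuous_map_product_projection)
  show ?thesis
  proof
    show "topspace (product_topology S I) = carrier (product_group I K)" by (fact top)
    show "continuous_map (prod_topology (product_topology S I) (product_topology S I))
        (product_topology S I) (\<lambda>(x, y). x \<otimes>\<^bsub>product_group I K\<^esub> y)"
    proof (rule continuous_map_coordinatewise_then_product)
      fix i assume i: "i \<in> I"
      have "continuous_map (prod_topology (product_topology S I) (product_topology S I))
          (prod_topology (S i) (S i)) (\<lambda>(x, y). (x i, y i))"
        using proj[OF i] by (simp add: continuous_map_prod_top)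
      from continuous_map_compose[OF this topological_group.continuous_mult[OF assms[OF i]]]
      show "continuous_map (prod_topology (product_topology S I) (product_topology S I)) (S i)
          (\<lambda>p. (case p of (x, y) \<Rightarrow> x \<otimes>\<^bsub>product_group I K\<^esub> y) i)"
        by (rule continuous_map_eq) (use i in auto)
    qed auto
    have "continuous_map (product_topology S I) (product_topology S I) (\<lambda>x. \<lambda>i\<in>I. inv\<^bsub>K i\<^esub> x i)"
    proof (rule continuous_map_coordinatewise_then_product)
      fix i assume i: "i \<in> I"
      from continuous_map_compose[OF proj[OF i] topological_group.continuous_inv[OF assms[OF i]]]
      show "continuous_map (product_topology S I) (S i) (\<lambda>x. (\<lambda>i\<in>I. inv\<^bsub>K i\<^esub> x i) i)"
        by (rule continuous_map_eq) (use i in auto)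
    qed auto
    then show "continuous_map (product_topology S I) (product_topology S I)
        (\<lambda>x. inv\<^bsub>product_group I K\<^esub> x)"
      by (rule continuous_map_eq) (use top grp in auto)
  qed
qed

lemma bohr_compactification:
  fixes G :: "('a, 'b) monoid_scheme"
  assumes "topological_group G T"
  shows "compact_group (bohr_group G T) (bohr_topology G T)"
    and "bohr_map G T \<in> continuous_hom G T (bohr_group G T) (bohr_topology G T)"
    and "bohr_topology G T closure_of (bohr_map G T ` carrier G) = carrier (bohr_group G T)"
proof -
  interpret G: topological_group G T by fact
  define I where "I = compact_images G T"
  define P where "P = bohr_product G T"
  define Q where "Q = bohr_product_topology G T"
  define b where "b = bohr_map G T"
  define D where "D = Q closure_of (b ` carrier G)"
  have ci: "compact_group (fst i) (fst (snd i))" "snd (snd i) \<in> continuous_hom G T (fst i) (fst (snd i))"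
    if "i \<in> I" for i using that by (auto simp: I_def compact_images_def)
  have P_eq: "P = product_group I fst" and Q_eq: "Q = product_topology (\<lambda>i. fst (snd i)) I"
    and b_eq: "b = (\<lambda>x. \<lambda>i\<in>I. snd (snd i) x)"
    by (auto simp: P_def Q_def b_def I_def bohr_product_def bohr_product_topology_def
        bohr_map_def fun_eq_iff case_prod_beta' restrict_def)
  have tgP: "topological_group P Q" unfolding P_eq Q_eq
    using ci by (intro topological_group_product) (auto simp: compact_group_def)
  interpret P: topological_group P Q by fact
  have bhom: "b \<in> hom G P" unfolding hom_def
  proof (intro CollectI conjI ballI funcsetI)
    fix x assume "x \<in> carrier G"
    then show "b x \<in> carrier P"
      using ci(2) by (auto simp: b_eq P_eq continuous_hom_def hom_def Pi_iff)
  next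
    fix x y assume "x \<in> carrier G" "y \<in> carrier G"
    then show "b (x \<otimes>\<^bsub>G\<^esub> y) = b x \<otimes>\<^bsub>P\<^esub> b y"
      using ci(2) by (auto simp: b_eq P_eq continuous_hom_def hom_def intro!: restrict_ext)
  qed
  have ghb: "group_hom G P b"
    by (intro group_hom.intro group_hom_axioms.intro bhom G.group_axioms P.group_axioms)
  have D: "subgroup D P" unfolding D_def
    by (rule closure_of_subgroup[OF tgP]) (rule group_hom.img_is_subgroup[OF ghb])
  have bD: "b ` carrier G \<subseteq> D"
    unfolding D_def by (rule closure_of_subset) (use P.topspace_eq bhom in \<open>auto simp: hom_def\<close>)
  have bcont: "continuous_map T Q b" unfolding Q_eq
  proof (rule continuous_map_coordinatewise_then_product)
    fix i assume i: "i \<in> I"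
    have "continuous_map T (fst (snd i)) (snd (snd i))" using ci(2)[OF i] by (simp add: continuous_hom_def)
    then show "continuous_map T (fst (snd i)) (\<lambda>x. b x i)" using i by (simp add: b_eq)
  qed (auto simp: b_eq)
  have bg: "bohr_group G T = P\<lparr>carrier := D\<rparr>" and bt: "bohr_topology G T = subtopology Q D"
    by (auto simp: bohr_group_def bohr_topology_def P_def D_def Q_def b_def)
  have "Hausdorff_space Q"
    using ci(1) by (auto simp: Q_eq Hausdorff_space_product_topology compact_group_def)
  moreover have "compact_space Q"
    using ci(1) by (auto simp: Q_eq compact_space_product_topology compact_group_def)
  then have "compact_space (subtopology Q D)"
    by (simp add: D_def closedin_compact_space compact_space_subtopology)
  ultimately show "compact_group (bohr_group G T) (bohr_topology G T)"
    unfolding compact_group_def bg bt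
    using topological_group_subgroup[OF tgP D] Hausdorff_space_subtopology by blast
  have "continuous_map T (subtopology Q D) b"
    by (rule continuous_map_into_subtopology[OF bcont]) (use bD G.topspace_eq in auto)
  then have "b \<in> continuous_hom G T (P\<lparr>carrier := D\<rparr>) (subtopology Q D)"
    using bhom bD by (auto simp: continuous_hom_def hom_def)
  then show "bohr_map G T \<in> continuous_hom G T (bohr_group G T) (bohr_topology G T)"
    by (simp add: bg bt b_def)
  have "subtopology Q D closure_of (b ` carrier G) = D"
    unfolding closure_of_subtopology using bD by (simp add: Int_absorb1 flip: D_def)
  then show "bohr_topology G T closure_of (bohr_map G T ` carrier G) = carrier (bohr_group G T)"
    by (simp add: bg bt b_def)
qed

text \<open>The factorization is unique because the range of \<open>bohr_map\<close> is dense.\<close>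

lemma bohr_universal:
  fixes G :: "('a, 'b) monoid_scheme" and H :: "('h, 'c) monoid_scheme"
  assumes "topological_group G T" "compact_group H S" "\<phi> \<in> continuous_hom G T H S"
  shows "\<exists>\<psi> \<in> continuous_hom (bohr_group G T) (bohr_topology G T) H S.
           \<forall>x\<in>carrier G. \<psi> (bohr_map G T x) = \<phi> x"
proof -
  interpret G: topological_group G T by fact
  have H: "topological_group H S" "Hausdorff_space S" "compact_space S"
    using assms(2) by (auto simp: compact_group_def)
  interpret H: topological_group H S by (fact H(1))
  let ?D = "S closure_of (\<phi> ` carrier G)"
  obtain K :: "'a set set monoid" and R f
    where K: "topological_group K R" "f \<in> iso (H\<lparr>carrier := ?D\<rparr>) K"
      "homeomorphic_map (subtopology S ?D) R f"
      "f \<circ> \<phi> \<in> continuous_hom G T K R" "R closure_of ((f \<circ> \<phi>) ` carrier G) = carrier K"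
    by (rule closed_range_transport[OF H(1,2) assms(1,3)])
  interpret K: topological_group K R by (fact K(1))
  have homeo: "subtopology S ?D homeomorphic_space R"
    using K(3) by (auto simp: homeomorphic_map_imp_homeomorphic_space)
  have "compact_space (subtopology S ?D)"
    using H(3) by (simp add: closedin_compact_space compact_space_subtopology)
  then have "compact_group K R"
    using K(1) Hausdorff_space_subtopology[OF H(2)] homeomorphic_Hausdorff_space[OF homeo]
      homeomorphic_compact_space[OF homeo] by (auto simp: compact_group_def)
  then have i: "(K, R, f \<circ> \<phi>) \<in> compact_images G T" (is "?i \<in> _")
    using K(4) by (simp add: compact_images_def)
  obtain g where g: "homeomorphic_maps (subtopology S ?D) R f g"
    using K(3) homeomorphic_map_maps by blast
  have Dsub: "?D \<subseteq> topspace S" by (rule closure_of_subset_topspace)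
  have \<phi>D: "\<phi> x \<in> ?D" if "x \<in> carrier G" for x
    using that assms(3) closure_of_subset[of "\<phi> ` carrier G" S] H.topspace_eq
    by (auto simp: continuous_hom_def hom_def)
  have gf: "g (f y) = y" if "y \<in> ?D" for y
    using g that Dsub by (auto simp: homeomorphic_maps_def)
  have fD: "f ` ?D = carrier K" "inj_on f ?D" using K(2) by (auto simp: iso_def bij_betw_def)
  have fhom: "f (x \<otimes>\<^bsub>H\<^esub> y) = f x \<otimes>\<^bsub>K\<^esub> f y" if "x \<in> ?D" "y \<in> ?D" for x y
    using K(2) that by (auto simp: iso_def hom_def)
  have "group_hom G H \<phi>"
    using assms(3) by (intro group_hom.intro group_hom_axioms.intro G.group_axioms H.group_axioms)
      (simp add: continuous_hom_def)
  then have sub: "subgroup ?D H"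
    by (intro closure_of_subgroup[OF H(1)] group_hom.img_is_subgroup)
  have ghom: "g \<in> hom K H"
  proof (rule homI)
    fix a assume "a \<in> carrier K"
    then have "a \<in> f ` ?D" using fD(1) by simp
    then obtain x where "x \<in> ?D" "a = f x" by (rule imageE)
    then show "g a \<in> carrier H" using gf Dsub unfolding H.topspace_eq by (metis subsetD)
  next
    fix a b assume "a \<in> carrier K" "b \<in> carrier K"
    then have "a \<in> f ` ?D" "b \<in> f ` ?D" using fD(1) by simp_all
    then obtain x y where "x \<in> ?D" "a = f x" "y \<in> ?D" "b = f y" by (elim imageE)
    then show "g (a \<otimes>\<^bsub>K\<^esub> b) = g a \<otimes>\<^bsub>H\<^esub> g b"
      using gf subgroup.m_closed[OF sub] by (metis fhom)
  qed
  have gcont: "continuous_map R S g"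
    using g by (auto simp: homeomorphic_maps_def continuous_map_in_subtopology)
  have carr: "carrier (bohr_group G T) \<subseteq> carrier (bohr_product G T)"
  proof -
    have "carrier (bohr_group G T) \<subseteq> topspace (bohr_product_topology G T)"
      by (simp add: bohr_group_def closure_of_subset_topspace)
    also have "\<dots> = carrier (bohr_product G T)"
      by (auto simp: bohr_product_topology_def bohr_product_def compact_images_def
          compact_group_def topological_group.topspace_eq intro!: PiE_cong)
    finally show ?thesis .
  qed
  have proj: "(\<lambda>p. p ?i) \<in> hom (bohr_group G T) K"
  proof (rule homI)
    fix p assume "p \<in> carrier (bohr_group G T)"
    then have "p \<in> (\<Pi>\<^sub>E j\<in>compact_images G T. carrier (case j of (K, S, \<phi>) \<Rightarrow> K))"
      using carr by (simp only: bohr_product_def carrier_product_group) (rule subsetD)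
    from PiE_mem[OF this i] show "p ?i \<in> carrier K" by simp
  next
    fix p q
    show "(p \<otimes>\<^bsub>bohr_group G T\<^esub> q) ?i = p ?i \<otimes>\<^bsub>K\<^esub> q ?i"
      using i by (simp add: bohr_group_def bohr_product_def)
  qed
  have pcont: "continuous_map (bohr_topology G T) R (\<lambda>p. p ?i)"
    unfolding bohr_topology_def bohr_product_topology_def
    using continuous_map_product_projection[OF i, of "\<lambda>(K, S, \<phi>). S"]
    by (intro continuous_map_from_subtopology) simp
  show ?thesis
  proof (rule bexI[of _ "g \<circ> (\<lambda>p. p ?i)"])
    show "g \<circ> (\<lambda>p. p ?i) \<in> continuous_hom (bohr_group G T) (bohr_topology G T) H S"
      using Group.hom_compose[OF proj ghom] continuous_map_compose[OF pcont gcont]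
      by (simp add: continuous_hom_def)
    show "\<forall>x\<in>carrier G. (g \<circ> (\<lambda>p. p ?i)) (bohr_map G T x) = \<phi> x"
      using i gf \<phi>D by (simp add: bohr_map_def)
  qed
qed

end

theory Submission
  imports Defs "HOL-Library.Function_Algebras"
begin

text \<open>
  The reduced spine has no common zero in \<open>G\<close>: on every locally compact group an invariant positive
  functional \<open>I\<close> on compactly supported functions yields the compactly supported positive definite
  function \<open>x \<mapsto> I (g \<cdot> L\<^sub>x g)\<close>. Hence the unit is the constant \<open>1\<close>, and it is within \<open>1/2\<close> of a finite
  sum of elements of \<open>A\<^sub>\<tau>(G)\<close>. Since each of these vanishes at infinity on \<open>G\<^sub>\<tau>\<close> and the norm dominates
  the supremum norm, \<open>G\<close> is a finite union of preimages of compact sets \<open>K\<^sub>\<tau> \<subseteq> G\<^sub>\<tau>\<close>. An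
  argument as for coverings by cosets shows that the image of \<open>G\<close> in a single \<open>G\<^sub>\<tau>\<close> is relatively
  compact. Then \<open>G\<^sub>\<tau>\<close> is compact, and \<open>G \<rightarrow> G\<^sub>\<tau>\<close> is injective because \<open>\<tau>\<close> is Hausdorff.
\<close>

section \<open>The Haar functional\<close>

text \<open>Two features of the definitions shape the proof. Membership in B(G) means being a
  coefficient of a representation on a Hilbert space whose vectors are functions on the group, so
  the GNS space of a positive definite function is realized as a reproducing kernel space, which
  consists of such functions. And an element of the spine must come from A(H) and lie in B(G) as
  well, so this space is built twice: over a completion H and over G. The topologies in the finite
  sum belong to different groups, so their compact sets cannot be compared. What the preimages have
  in common is that, for each topology, the sets with relatively compact image are stable under
  finite unions, under translation by G and under passing from A to the set of quotients of its
  elements. The covering argument rests on this stability. The threshold 1/2 is chosen because no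
  number is within 1/2 of both 0 and 1 when the bounds are strict.\<close>

lemma member_le_sum_list_nonneg:
  fixes f :: "'a \<Rightarrow> real"
  assumes "x \<in> set xs" "\<And>y. y \<in> set xs \<Longrightarrow> 0 \<le> f y"
  shows "f x \<le> sum_list (map f xs)"
  using assms
proof (induction xs)
  case (Cons a xs)
  have "0 \<le> sum_list (map f xs)" using Cons.prems by (intro sum_list_nonneg) auto
  then show ?case using Cons by (auto simp: add_increasing)
qed simp

section \<open>Nonnegative functions of compact support and their translates\<close>

context topological_group
begin

lemma continuous_map_group_mult:
  assumes "continuous_map X T f" "continuous_map X T g"
  shows "continuous_map X T (\<lambda>x. f x \<otimes> g x)"
proof -
  have "continuous_map X (prod_topology T T) (\<lambda>x. (f x, g x))"
    using assms by (simp add: continuous_map_pairwise o_def)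
  from continuous_map_compose[OF this continuous_mult] show ?thesis by (simp add: o_def)
qed

lemma continuous_map_group_inv:
  "continuous_map X T f \<Longrightarrow> continuous_map X T (\<lambda>x. inv f x)"
  using continuous_map_compose[OF _ continuous_inv, of X f] by (simp add: o_def)

lemma continuous_map_translation: "a \<in> carrier G \<Longrightarrow> continuous_map T T (\<lambda>x. a \<otimes> x)"
  by (rule continuous_map_group_mult) (auto simp: topspace_eq)

text \<open>The invariant functional is built from covering numbers of nonnegative functions, so its
  domain is a cone. The compact set lies in the carrier; hence members vanish off the group, and
  agreeing on the group means being equal.\<close>

definition cc_cone :: "('a \<Rightarrow> real) set" where
  "cc_cone = {f. continuous_map T euclideanreal f \<and> (\<forall>x. 0 \<le> f x) \<and>
     (\<exists>K. compactin T K \<and> (\<forall>x. x \<notin> K \<longrightarrow> f x = 0))}"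

definition shift :: "'a \<Rightarrow> ('a \<Rightarrow> real) \<Rightarrow> 'a \<Rightarrow> real" where
  "shift s f = (\<lambda>x. if x \<in> carrier G then f (inv s \<otimes> x) else 0)"

lemma cc_coneI:
  "\<lbrakk>continuous_map T euclideanreal f; \<And>x. 0 \<le> f x; compactin T K; \<And>x. x \<notin> K \<Longrightarrow> f x = 0\<rbrakk>
    \<Longrightarrow> f \<in> cc_cone"
  by (auto simp: cc_cone_def)

lemma cc_cone_nonneg: "f \<in> cc_cone \<Longrightarrow> 0 \<le> f x"
  by (simp add: cc_cone_def)

lemma cc_cone_continuous: "f \<in> cc_cone \<Longrightarrow> continuous_map T euclideanreal f"
  by (simp add: cc_cone_def)

lemma cc_cone_support:
  assumes "f \<in> cc_cone"
  obtains K where "compactin T K" "K \<subseteq> carrier G" "\<And>x. x \<notin> K \<Longrightarrow> f x = 0"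
  using assms compactin_subset_topspace topspace_eq unfolding cc_cone_def by blast

lemma cc_cone_outside: "\<lbrakk>f \<in> cc_cone; x \<notin> carrier G\<rbrakk> \<Longrightarrow> f x = 0"
  by (erule cc_cone_support) blast

lemma cc_cone_add:
  assumes "f \<in> cc_cone" "g \<in> cc_cone" shows "(\<lambda>x. f x + g x) \<in> cc_cone"
proof -
  obtain K L where "compactin T K" "\<And>x. x \<notin> K \<Longrightarrow> f x = 0" "compactin T L" "\<And>x. x \<notin> L \<Longrightarrow> g x = 0"
    using assms by (metis cc_cone_support)
  then show ?thesis using assms
    by (intro cc_coneI[of _ "K \<union> L"] continuous_map_add compactin_Un)
      (auto simp: cc_cone_def)
qed

lemma cc_cone_mult:
  assumes "f \<in> cc_cone" "continuous_map T euclideanreal g" "\<And>x. 0 \<le> g x"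
  shows "(\<lambda>x. f x * g x) \<in> cc_cone"
proof -
  obtain K where "compactin T K" "\<And>x. x \<notin> K \<Longrightarrow> f x = 0"
    using assms by (metis cc_cone_support)
  then show ?thesis using assms
    by (intro cc_coneI[of _ K] continuous_map_real_mult) (auto simp: cc_cone_def)
qed

lemma cc_cone_scale: "\<lbrakk>f \<in> cc_cone; 0 \<le> c\<rbrakk> \<Longrightarrow> (\<lambda>x. c * f x) \<in> cc_cone"
  using cc_cone_mult[of f "\<lambda>_. c"] by (simp add: mult.commute)

lemma cc_cone_zero: "(\<lambda>x. 0) \<in> cc_cone"
  by (rule cc_coneI[of _ "{}"]) auto

lemma continuous_map_shift:
  assumes "continuous_map T euclideanreal f" "s \<in> carrier G"
  shows "continuous_map T euclideanreal (shift s f)"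
proof -
  have "continuous_map T euclideanreal (f \<circ> (\<lambda>x. inv s \<otimes> x))"
    by (rule continuous_map_compose[OF continuous_map_translation]) (use assms in auto)
  then show ?thesis by (rule continuous_map_eq) (auto simp: shift_def topspace_eq)
qed

lemma cc_cone_shift:
  assumes f: "f \<in> cc_cone" and s: "s \<in> carrier G" shows "shift s f \<in> cc_cone"
proof -
  obtain K where K: "compactin T K" "K \<subseteq> carrier G" "\<And>x. x \<notin> K \<Longrightarrow> f x = 0"
    using f by (metis cc_cone_support)
  have "compactin T ((\<lambda>x. s \<otimes> x) ` K)"
    by (rule image_compactin[OF K(1) continuous_map_translation[OF s]])
  moreover have "shift s f x = 0" if "x \<notin> (\<lambda>x. s \<otimes> x) ` K" for x
  proof (cases "x \<in> carrier G")
    case True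
    then have "x = s \<otimes> (inv s \<otimes> x)" using s by (simp flip: m_assoc)
    then have "inv s \<otimes> x \<notin> K" using that by blast
    then show ?thesis by (simp add: shift_def K(3))
  qed (simp add: shift_def)
  moreover have "0 \<le> shift s f x" for x using cc_cone_nonneg[OF f] by (simp add: shift_def)
  ultimately show ?thesis
    using continuous_map_shift[OF cc_cone_continuous[OF f] s] by (metis cc_coneI)
qed

lemma shift_shift:
  "\<lbrakk>s \<in> carrier G; t \<in> carrier G\<rbrakk> \<Longrightarrow> shift s (shift t f) = shift (s \<otimes> t) f"
  by (auto simp: shift_def inv_mult_group m_assoc)

lemma shift_one: "f \<in> cc_cone \<Longrightarrow> shift \<one> f = f"
  by (auto simp: shift_def cc_cone_outside)

lemma shift_mult: "shift s (\<lambda>x. f x * g x) = (\<lambda>x. shift s f x * shift s g x)"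
  by (auto simp: shift_def)

lemma cc_cone_bounded:
  assumes f: "f \<in> cc_cone"
  obtains M where "0 < M" "\<And>x. f x \<le> M"
proof -
  obtain K where K: "compactin T K" "\<And>x. x \<notin> K \<Longrightarrow> f x = 0"
    using f by (metis cc_cone_support)
  have "compact (f ` K)"
    using image_compactin[OF K(1) cc_cone_continuous[OF f]] by simp
  then obtain M where M: "\<And>x. x \<in> K \<Longrightarrow> \<bar>f x\<bar> \<le> M"
    using compact_imp_bounded bounded_iff by (metis image_eqI real_norm_def)
  have "f x \<le> \<bar>M\<bar> + 1" for x by (cases "x \<in> K") (use M[of x] K(2) in auto)
  then show ?thesis by (intro that[of "\<bar>M\<bar> + 1"]) auto
qed

text \<open>The tube lemma on \<open>K \<times> {\<one>}\<close> makes the estimate uniform over the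
  support \<open>K\<close>. If neither \<open>s\<close> nor \<open>s \<otimes> v\<close> lies in
  \<open>K\<close>, both values vanish.\<close>

lemma cc_cone_uniformly_continuous:
  assumes h: "h \<in> cc_cone" and e: "0 < (e::real)"
  obtains V where "openin T V" "\<one> \<in> V"
    "\<And>s v. \<lbrakk>s \<in> carrier G; v \<in> V\<rbrakk> \<Longrightarrow> \<bar>h (s \<otimes> v) - h s\<bar> < e"
proof -
  obtain K where K: "compactin T K" "K \<subseteq> carrier G" "\<And>x. x \<notin> K \<Longrightarrow> h x = 0"
    using h by (metis cc_cone_support)
  let ?P = "prod_topology T T"
  have c1: "continuous_map ?P euclideanreal (\<lambda>p. h (fst p \<otimes> snd p))"
    using continuous_map_compose[OF continuous_mult cc_cone_continuous[OF h]]
    by (simp add: o_def case_prod_beta')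
  have c2: "continuous_map ?P euclideanreal (\<lambda>p. h (fst p))"
    using continuous_map_compose[OF continuous_map_fst cc_cone_continuous[OF h]]
    by (simp add: o_def)
  have "continuous_map ?P euclideanreal (\<lambda>p. \<bar>h (fst p \<otimes> snd p) - h (fst p)\<bar>)"
    by (intro continuous_map_real_abs continuous_map_diff c1 c2)
  then have op: "openin ?P {p \<in> topspace ?P. \<bar>h (fst p \<otimes> snd p) - h (fst p)\<bar> \<in> {..<e}}" (is "openin _ ?W")
    by (rule openin_continuous_map_preimage) simp
  have sub: "K \<times> {\<one>} \<subseteq> ?W" using K(2) e by (auto simp: topspace_eq)
  have one: "compactin T {\<one>}" by (simp add: topspace_eq)
  obtain U V where UV: "openin T U" "openin T V" "K \<subseteq> U" "{\<one>} \<subseteq> V" "U \<times> V \<subseteq> ?W"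
    by (rule Wallace_theorem_prod_topology[OF K(1) one op sub])
  have near: "\<bar>h (s \<otimes> v) - h s\<bar> < e" if "s \<in> K" "v \<in> V" for s v
  proof -
    have "(s, v) \<in> ?W" using UV that by blast
    then show ?thesis by simp
  qed
  \<comment> \<open>Symmetrizing \<open>V\<close> settles the case that only
    \<open>s \<otimes> v\<close> lies in \<open>K\<close>: the estimate is applied at that point
    with \<open>inv v\<close>, which leads back to \<open>s\<close>.\<close>
  define V' where "V' = V \<inter> {x \<in> topspace T. inv x \<in> V}"
  have "openin T {x \<in> topspace T. inv x \<in> V}"
    using continuous_inv UV(2) by (rule openin_continuous_map_preimage)
  then have "openin T V'" using UV(2) by (auto simp: V'_def)
  moreover have "\<one> \<in> V'" using UV(4) by (auto simp: V'_def topspace_eq)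
  moreover have "\<bar>h (s \<otimes> v) - h s\<bar> < e" if s: "s \<in> carrier G" and v: "v \<in> V'" for s v
  proof -
    have v': "v \<in> carrier G" "v \<in> V" "inv v \<in> V" using v by (auto simp: V'_def topspace_eq)
    consider "s \<in> K" | "s \<otimes> v \<in> K" | "s \<notin> K" "s \<otimes> v \<notin> K" by blast
    then show ?thesis
    proof cases
      case 2
      have "s \<otimes> v \<otimes> inv v = s" using s v' by (simp add: m_assoc)
      then show ?thesis using near[OF 2 v'(3)] by simp
    qed (use near v' K(3) e in auto)
  qed
  ultimately show ?thesis by (rule that)
qed

section \<open>Haar's covering numbers\<close>

definition comb :: "('a \<Rightarrow> real) \<Rightarrow> (real \<times> 'a) list \<Rightarrow> 'a \<Rightarrow> real" where
  "comb \<phi> l x = (\<Sum>(c, s)\<leftarrow>l. c * shift s \<phi> x)"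

definition weights :: "(real \<times> 'a) list set" where
  "weights = lists ({0..} \<times> carrier G)"

definition covers :: "('a \<Rightarrow> real) \<Rightarrow> ('a \<Rightarrow> real) \<Rightarrow> (real \<times> 'a) list \<Rightarrow> bool" where
  "covers f \<phi> l \<longleftrightarrow> l \<in> weights \<and> (\<forall>x. f x \<le> comb \<phi> l x)"

text \<open>This is Haar's covering number \<open>(f : \<phi>)\<close>. Lists serve as combinations
  because concatenation adds them and a translate may occur repeatedly.\<close>

definition cov :: "('a \<Rightarrow> real) \<Rightarrow> ('a \<Rightarrow> real) \<Rightarrow> real" where
  "cov f \<phi> = Inf {sum_list (map fst l) | l. covers f \<phi> l}"

definition bumps :: "'a set \<Rightarrow> ('a \<Rightarrow> real) set" where
  "bumps V = {\<phi> \<in> cc_cone. 0 < \<phi> \<one> \<and> (\<forall>x. x \<notin> V \<longrightarrow> \<phi> x = 0)}"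

lemma weights_simps [simp]:
  "[] \<in> weights" "(c, s) # l \<in> weights \<longleftrightarrow> 0 \<le> c \<and> s \<in> carrier G \<and> l \<in> weights"
  "l @ l' \<in> weights \<longleftrightarrow> l \<in> weights \<and> l' \<in> weights"
  by (auto simp: weights_def)

lemma weightsD: "\<lbrakk>l \<in> weights; (c, s) \<in> set l\<rbrakk> \<Longrightarrow> 0 \<le> c \<and> s \<in> carrier G"
  by (auto simp: weights_def lists_eq_set)

lemma weights_sum_nonneg: "l \<in> weights \<Longrightarrow> 0 \<le> sum_list (map fst l)"
  by (rule sum_list_nonneg) (auto dest: weightsD)

lemma comb_simps [simp]:
  "comb \<phi> [] x = 0" "comb \<phi> ((c, s) # l) x = c * shift s \<phi> x + comb \<phi> l x"
  "comb \<phi> (l @ l') x = comb \<phi> l x + comb \<phi> l' x"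
  by (simp_all add: comb_def)

lemma comb_cc_cone:
  assumes "\<phi> \<in> cc_cone" "l \<in> weights" shows "comb \<phi> l \<in> cc_cone"
  using assms(2)
proof (induction l)
  case Nil
  then show ?case using cc_cone_zero by (simp add: comb_def[abs_def])
next
  case (Cons p l)
  obtain c s where p: "p = (c, s)" by (cases p)
  have "(\<lambda>x. c * shift s \<phi> x + comb \<phi> l x) \<in> cc_cone"
    using Cons assms(1) by (intro cc_cone_add cc_cone_scale cc_cone_shift) (auto simp: p)
  then show ?case by (simp add: p comb_def[abs_def])
qed

lemma comb_scale: "comb \<phi> (map (\<lambda>(c, s). (a * c, s)) l) x = a * comb \<phi> l x"
  by (induction l) (auto simp: algebra_simps)

lemma sum_scale: "sum_list (map fst (map (\<lambda>(c, s). (a * c, s)) l)) = a * sum_list (map fst l)"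
  for a :: real
  by (induction l) (auto simp: algebra_simps)

lemma weights_scale: "\<lbrakk>0 \<le> a; l \<in> weights\<rbrakk> \<Longrightarrow> map (\<lambda>(c, s). (a * c, s)) l \<in> weights"
  by (induction l) auto

lemma weights_shift:
  "\<lbrakk>l \<in> weights; t \<in> carrier G\<rbrakk> \<Longrightarrow> map (\<lambda>(c, s). (c, t \<otimes> s)) l \<in> weights"
  by (induction l) auto

lemma comb_shift:
  assumes "l \<in> weights" "t \<in> carrier G"
  shows "comb \<phi> (map (\<lambda>(c, s). (c, t \<otimes> s)) l) = shift t (comb \<phi> l)"
proof (rule ext)
  fix x
  show "comb \<phi> (map (\<lambda>(c, s). (c, t \<otimes> s)) l) x = shift t (comb \<phi> l) x"
    using assms
  proof (induction l)
    case Nil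
    then show ?case by (simp add: shift_def)
  next
    case (Cons p l)
    obtain c s where p: "p = (c, s)" by (cases p)
    have "shift (t \<otimes> s) \<phi> x = shift t (shift s \<phi>) x"
      using Cons.prems by (simp add: shift_shift p)
    then show ?case using Cons by (auto simp: p shift_def)
  qed
qed

text \<open>Translates of the open set where \<open>\<phi>\<close> exceeds half its value at the
  unit cover \<open>K\<close>. Finitely many suffice, and the weight
  \<open>2 / \<phi> \<one>\<close> lifts each of them to at least \<open>1\<close> there.\<close>

lemma dominating:
  assumes K: "compactin T K" and \<phi>: "\<phi> \<in> cc_cone" "0 < \<phi> \<one>"
  obtains l where "l \<in> weights" "\<And>x. x \<in> K \<Longrightarrow> 1 \<le> comb \<phi> l x"
proof -
  define W where "W s = {x \<in> topspace T. shift s \<phi> x \<in> {\<phi> \<one> / 2<..}}" for s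
  have Ksub: "K \<subseteq> carrier G" using compactin_subset_topspace[OF K] by (simp add: topspace_eq)
  have "openin T (W s)" if "s \<in> carrier G" for s
    unfolding W_def
    by (rule openin_continuous_map_preimage[OF continuous_map_shift[OF cc_cone_continuous[OF \<phi>(1)] that]]) simp
  moreover have "K \<subseteq> \<Union>(W ` carrier G)"
  proof
    fix x assume "x \<in> K"
    then have x: "x \<in> carrier G" using Ksub by blast
    then have "x \<in> W x" using \<phi>(2) by (simp add: W_def topspace_eq shift_def)
    then show "x \<in> \<Union>(W ` carrier G)" using x by blast
  qed
  ultimately obtain \<F> where F: "finite \<F>" "\<F> \<subseteq> W ` carrier G" "K \<subseteq> \<Union>\<F>"
    using compactinD[OF K, of "W ` carrier G"] by blast
  then obtain S where S: "finite S" "S \<subseteq> carrier G" "\<F> = W ` S"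
    by (meson finite_subset_image)
  obtain xs where xs: "set xs = S" using S(1) finite_list by blast
  define l where "l = map (\<lambda>s. (2 / \<phi> \<one>, s)) xs"
  have l: "l \<in> weights" using S(2) \<phi>(2) xs by (auto simp: l_def weights_def)
  moreover have "1 \<le> comb \<phi> l x" if x: "x \<in> K" for x
  proof -
    obtain s where s: "s \<in> S" "x \<in> W s" using F(3) S(3) x by blast
    have "1 \<le> 2 / \<phi> \<one> * shift s \<phi> x" using s(2) \<phi>(2) by (simp add: W_def field_simps)
    also have "\<dots> \<le> (\<Sum>s\<leftarrow>xs. 2 / \<phi> \<one> * shift s \<phi> x)"
      using s(1) xs \<phi> S(2)
      by (intro member_le_sum_list_nonneg[where f = "\<lambda>s. 2 / \<phi> \<one> * shift s \<phi> x"])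
        (auto intro!: mult_nonneg_nonneg simp: cc_cone_nonneg shift_def)
    also have "\<dots> = comb \<phi> l x" by (simp add: comb_def l_def o_def)
    finally show ?thesis .
  qed
  ultimately show ?thesis by (rule that)
qed

lemma covers_exists:
  assumes f: "f \<in> cc_cone" and \<phi>: "\<phi> \<in> cc_cone" "0 < \<phi> \<one>"
  obtains l where "covers f \<phi> l"
proof -
  obtain K where K: "compactin T K" "K \<subseteq> carrier G" "\<And>x. x \<notin> K \<Longrightarrow> f x = 0"
    using f by (metis cc_cone_support)
  obtain M where M: "0 < M" "\<And>x. f x \<le> M" using f by (metis cc_cone_bounded)
  obtain l where l: "l \<in> weights" "\<And>x. x \<in> K \<Longrightarrow> 1 \<le> comb \<phi> l x"
    using dominating[OF K(1) \<phi>] by blast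
  have "covers f \<phi> (map (\<lambda>(c, s). (M * c, s)) l)"
    unfolding covers_def comb_scale
  proof (intro conjI allI)
    show "map (\<lambda>(c, s). (M * c, s)) l \<in> weights" using M l by (intro weights_scale) auto
    fix x
    show "f x \<le> M * comb \<phi> l x"
    proof (cases "x \<in> K")
      case True
      then have "M * 1 \<le> M * comb \<phi> l x" using l(2) M(1) by (intro mult_left_mono) auto
      then show ?thesis using M(2)[of x] by simp
    next
      case False
      then show ?thesis
        using K(3) M(1) cc_cone_nonneg[OF comb_cc_cone[OF \<phi>(1) l(1)]] by simp
    qed
  qed
  then show ?thesis by (rule that)
qed

lemma cov_le: "covers f \<phi> l \<Longrightarrow> cov f \<phi> \<le> sum_list (map fst l)"
  unfolding cov_def
  by (rule cInf_lower) (auto intro!: bdd_belowI[of _ 0] weights_sum_nonneg simp: covers_def)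

context
  fixes \<phi> assumes \<phi>: "\<phi> \<in> cc_cone" "0 < \<phi> \<one>"
begin

lemma cov_greatest:
  "\<lbrakk>f \<in> cc_cone; \<And>l. covers f \<phi> l \<Longrightarrow> a \<le> sum_list (map fst l)\<rbrakk> \<Longrightarrow> a \<le> cov f \<phi>"
  unfolding cov_def using covers_exists[OF _ \<phi>, of f] by (intro cInf_greatest) auto

lemma cov_nonneg: "f \<in> cc_cone \<Longrightarrow> 0 \<le> cov f \<phi>"
  by (rule cov_greatest) (auto intro!: weights_sum_nonneg simp: covers_def)

lemma cov_add:
  assumes "f \<in> cc_cone" "g \<in> cc_cone"
  shows "cov (\<lambda>x. f x + g x) \<phi> \<le> cov f \<phi> + cov g \<phi>"
proof -
  have "cov (\<lambda>x. f x + g x) \<phi> - cov g \<phi> \<le> cov f \<phi>"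
  proof (rule cov_greatest[OF assms(1)])
    fix l assume l: "covers f \<phi> l"
    have "cov (\<lambda>x. f x + g x) \<phi> - sum_list (map fst l) \<le> cov g \<phi>"
    proof (rule cov_greatest[OF assms(2)])
      fix l' assume "covers g \<phi> l'"
      with l have "covers (\<lambda>x. f x + g x) \<phi> (l @ l')"
        by (auto simp: covers_def intro: add_mono)
      from cov_le[OF this] show "cov (\<lambda>x. f x + g x) \<phi> - sum_list (map fst l) \<le> sum_list (map fst l')"
        by simp
    qed
    then show "cov (\<lambda>x. f x + g x) \<phi> - cov g \<phi> \<le> sum_list (map fst l)" by simp
  qed
  then show ?thesis by simp
qed

text \<open>Here and in \<open>cov_shift\<close> one inequality is enough: for the functional it
  becomes an equality when applied again with the inverse scalar or the inverse translation.\<close>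

lemma cov_scale:
  assumes f: "f \<in> cc_cone" and c: "0 \<le> c"
  shows "cov (\<lambda>x. c * f x) \<phi> \<le> c * cov f \<phi>"
proof (cases "c = 0")
  case True
  then show ?thesis using cov_le[of "\<lambda>x. 0" \<phi> "[]"] by (simp add: covers_def)
next
  case False
  have "cov (\<lambda>x. c * f x) \<phi> / c \<le> cov f \<phi>"
  proof (rule cov_greatest[OF f])
    fix l assume "covers f \<phi> l"
    then have "covers (\<lambda>x. c * f x) \<phi> (map (\<lambda>(b, s). (c * b, s)) l)"
      using c unfolding covers_def comb_scale by (auto intro: mult_left_mono weights_scale)
    from cov_le[OF this] have "cov (\<lambda>x. c * f x) \<phi> \<le> c * sum_list (map fst l)" unfolding sum_scale .
    then show "cov (\<lambda>x. c * f x) \<phi> / c \<le> sum_list (map fst l)"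
      using c False by (simp add: field_simps)
  qed
  then show ?thesis using c False by (simp add: field_simps)
qed

lemma cov_mono:
  assumes "g \<in> cc_cone" "\<And>x. f x \<le> g x"
  shows "cov f \<phi> \<le> cov g \<phi>"
proof (rule cov_greatest[OF assms(1)])
  fix l assume "covers g \<phi> l"
  then have "covers f \<phi> l" using assms(2) order_trans unfolding covers_def by blast
  then show "cov f \<phi> \<le> sum_list (map fst l)" by (rule cov_le)
qed

lemma cov_shift:
  assumes f: "f \<in> cc_cone" and t: "t \<in> carrier G"
  shows "cov (shift t f) \<phi> \<le> cov f \<phi>"
proof (rule cov_greatest[OF f])
  fix l assume l: "covers f \<phi> l"
  have "covers (shift t f) \<phi> (map (\<lambda>(c, s). (c, t \<otimes> s)) l)"
    unfolding covers_def
  proof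
    show "map (\<lambda>(c, s). (c, t \<otimes> s)) l \<in> weights" using l t by (simp add: covers_def weights_shift)
    show "\<forall>x. shift t f x \<le> comb \<phi> (map (\<lambda>(c, s). (c, t \<otimes> s)) l) x"
      using l t by (auto simp: covers_def comb_shift) (simp add: shift_def)
  qed
  from cov_le[OF this] show "cov (shift t f) \<phi> \<le> sum_list (map fst l)"
    by (simp add: o_def case_prod_beta')
qed

text \<open>Evaluating a cover at \<open>x\<close> shows that its weight is at least
  \<open>f x / M\<close>, where \<open>M\<close> bounds \<open>\<phi>\<close>.\<close>

lemma cov_pos:
  assumes f: "f \<in> cc_cone" "0 < f x"
  shows "0 < cov f \<phi>"
proof -
  obtain M where M: "0 < M" "\<And>x. \<phi> x \<le> M" using \<phi>(1) by (metis cc_cone_bounded)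
  have "f x / M \<le> cov f \<phi>"
  proof (rule cov_greatest[OF f(1)])
    fix l assume l: "covers f \<phi> l"
    have "comb \<phi> l x \<le> sum_list (map fst l) * M" if "l \<in> weights" for l
      using that
    proof (induction l)
      case (Cons p l)
      obtain c s where p: "p = (c, s)" by (cases p)
      have "c * shift s \<phi> x \<le> c * M" using Cons.prems M by (intro mult_left_mono) (auto simp: p shift_def)
      then show ?case using Cons by (auto simp: p algebra_simps)
    qed simp
    with l have "f x \<le> sum_list (map fst l) * M" unfolding covers_def using order_trans by blast
    then show "f x / M \<le> sum_list (map fst l)" using M by (simp add: field_simps)
  qed
  moreover have "0 < f x / M" using f M by simp
  ultimately show ?thesis by simp
qed

end

text \<open>Inserting a cover of \<open>\<psi>\<close> into a cover of \<open>f\<close> by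
  translates of \<open>\<psi>\<close> multiplies the weights; subadditivity along the list does the
  insertion. The resulting bound on \<open>ratio\<close> is what makes the compactness argument
  possible.\<close>

lemma cov_trans:
  assumes f: "f \<in> cc_cone" and \<psi>: "\<psi> \<in> cc_cone" "0 < \<psi> \<one>" and \<phi>: "\<phi> \<in> cc_cone" "0 < \<phi> \<one>"
  shows "cov f \<phi> \<le> cov f \<psi> * cov \<psi> \<phi>"
proof -
  have le: "cov (comb \<psi> l) \<phi> \<le> sum_list (map fst l) * cov \<psi> \<phi>" if "l \<in> weights" for l
    using that
  proof (induction l)
    case Nil
    have "covers (comb \<psi> []) \<phi> []" by (simp add: covers_def)
    from cov_le[OF this] show ?case by (simp del: comb_simps)
  next
    case (Cons p l)
    obtain c s where p: "p = (c, s)" by (cases p)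
    have c: "0 \<le> c" "s \<in> carrier G" "l \<in> weights" using Cons.prems by (auto simp: p)
    have "comb \<psi> (p # l) = (\<lambda>x. c * shift s \<psi> x + comb \<psi> l x)" by (auto simp: p)
    then have "cov (comb \<psi> (p # l)) \<phi> \<le> cov (\<lambda>x. c * shift s \<psi> x) \<phi> + cov (comb \<psi> l) \<phi>"
      using cov_add[OF \<phi> cc_cone_scale[OF cc_cone_shift[OF \<psi>(1) c(2)] c(1)] comb_cc_cone[OF \<psi>(1) c(3)]]
      by simp
    also have "cov (\<lambda>x. c * shift s \<psi> x) \<phi> \<le> c * cov (shift s \<psi>) \<phi>"
      using \<phi> \<psi> c by (intro cov_scale cc_cone_shift)
    also have "c * cov (shift s \<psi>) \<phi> \<le> c * cov \<psi> \<phi>"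
      using \<phi> \<psi> c by (intro mult_left_mono cov_shift)
    finally show ?case using Cons.IH c by (simp add: p algebra_simps del: comb_simps)
  qed
  show ?thesis
  proof (cases "cov \<psi> \<phi> = 0")
    case True
    then show ?thesis using cov_pos[OF \<phi> \<psi>] by simp
  next
    case False
    then have pos: "0 < cov \<psi> \<phi>" using cov_nonneg[OF \<phi> \<psi>(1)] by simp
    have "cov f \<phi> / cov \<psi> \<phi> \<le> cov f \<psi>"
    proof (rule cov_greatest[OF \<psi> f])
      fix l assume l: "covers f \<psi> l"
      then have "cov f \<phi> \<le> cov (comb \<psi> l) \<phi>"
        by (intro cov_mono[OF \<phi>] comb_cc_cone \<psi>) (auto simp: covers_def)
      also have "\<dots> \<le> sum_list (map fst l) * cov \<psi> \<phi>" using l by (intro le) (simp add: covers_def)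
      finally show "cov f \<phi> / cov \<psi> \<phi> \<le> sum_list (map fst l)" using pos by (simp add: field_simps)
    qed
    then show ?thesis using pos by (simp add: field_simps)
  qed
qed

text \<open>Supplies the function that replaces the constant \<open>1\<close> on the supports in the
  next lemma.\<close>

lemma dominating_cc_cone:
  assumes "compactin T K" "\<phi> \<in> cc_cone" "0 < \<phi> \<one>"
  obtains f where "f \<in> cc_cone" "\<And>x. x \<in> K \<Longrightarrow> 1 \<le> f x"
  using dominating[OF assms] comb_cc_cone[OF assms(2)] by metis

text \<open>Writing \<open>f\<^sub>i = h h\<^sub>i\<close>, a cover of \<open>h\<close> by translates of a function \<open>\<phi>\<close> supported near the
  unit splits, because \<open>h\<^sub>i\<close> is almost constant on each translate.\<close>

lemma cov_almost_superadditive: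
  assumes f: "f\<^sub>1 \<in> cc_cone" "f\<^sub>2 \<in> cc_cone" and g: "g \<in> cc_cone"
    and K: "\<And>x. x \<notin> K \<Longrightarrow> f\<^sub>1 x = 0 \<and> f\<^sub>2 x = 0" "\<And>x. x \<in> K \<Longrightarrow> 1 \<le> g x" and e: "0 < \<epsilon>"
  obtains V where "openin T V" "\<one> \<in> V"
    "\<And>\<phi>. \<phi> \<in> bumps V \<Longrightarrow>
       cov f\<^sub>1 \<phi> + cov f\<^sub>2 \<phi> \<le> (1 + 2 * \<epsilon>) * (cov (\<lambda>x. f\<^sub>1 x + f\<^sub>2 x) \<phi> + \<epsilon> * cov g \<phi>)"
proof -
  \<comment> \<open>The constant \<open>\<epsilon>\<close> keeps \<open>h\<close> positive, so that
    dividing by it is continuous also at the edge of the supports. As \<open>h\<close> need not have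
    compact support, the function to be covered is \<open>h'\<close>, which is at least
    \<open>h\<close> on \<open>K\<close>.\<close>
  define h where "h x = f\<^sub>1 x + f\<^sub>2 x + \<epsilon>" for x
  define h' where "h' x = f\<^sub>1 x + f\<^sub>2 x + \<epsilon> * g x" for x
  have h_pos: "0 < h x" for x using e cc_cone_nonneg[OF f(1), of x] cc_cone_nonneg[OF f(2), of x] by (simp add: h_def)
  have h_cont: "continuous_map T euclideanreal (\<lambda>x. inverse (h x))"
  proof (rule continuous_map_real_inverse)
    show "continuous_map T euclideanreal h"
      unfolding h_def by (intro continuous_map_add cc_cone_continuous[OF f(1)] cc_cone_continuous[OF f(2)]) auto
    show "h x \<noteq> 0" for x using h_pos[of x] by simp
  qed
  have h': "h' \<in> cc_cone" unfolding h'_def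
    using e by (intro cc_cone_add f cc_cone_scale g) auto
  define q where "q f x = f x * inverse (h x)" for f x
  have q: "q f \<in> cc_cone" if "f \<in> cc_cone" for f
    unfolding q_def using h_pos that h_cont by (intro cc_cone_mult) (auto simp: less_imp_le)
  have q_sum: "q f\<^sub>1 x + q f\<^sub>2 x \<le> 1" for x
    using h_pos[of x] e by (simp add: q_def field_simps) (simp add: h_def)
  obtain V\<^sub>1 where V1: "openin T V\<^sub>1" "\<one> \<in> V\<^sub>1" "\<And>s v. \<lbrakk>s \<in> carrier G; v \<in> V\<^sub>1\<rbrakk> \<Longrightarrow> \<bar>q f\<^sub>1 (s \<otimes> v) - q f\<^sub>1 s\<bar> < \<epsilon>"
    using cc_cone_uniformly_continuous[OF q[OF f(1)] e] by blast
  obtain V\<^sub>2 where V2: "openin T V\<^sub>2" "\<one> \<in> V\<^sub>2" "\<And>s v. \<lbrakk>s \<in> carrier G; v \<in> V\<^sub>2\<rbrakk> \<Longrightarrow> \<bar>q f\<^sub>2 (s \<otimes> v) - q f\<^sub>2 s\<bar> < \<epsilon>"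
    using cc_cone_uniformly_continuous[OF q[OF f(2)] e] by blast
  show ?thesis
  proof (rule that[of "V\<^sub>1 \<inter> V\<^sub>2"])
    show "openin T (V\<^sub>1 \<inter> V\<^sub>2)" "\<one> \<in> V\<^sub>1 \<inter> V\<^sub>2" using V1 V2 by auto
    fix \<phi> assume "\<phi> \<in> bumps (V\<^sub>1 \<inter> V\<^sub>2)"
    then have \<phi>: "\<phi> \<in> cc_cone" "0 < \<phi> \<one>" and supp: "\<And>x. x \<notin> V\<^sub>1 \<inter> V\<^sub>2 \<Longrightarrow> \<phi> x = 0"
      by (auto simp: bumps_def)
    \<comment> \<open>On the support of the translate by \<open>s\<close>, the quotient
      \<open>q f\<close> differs from its value at \<open>s\<close> by less than
      \<open>\<epsilon>\<close>, so each weight is multiplied by \<open>q f s + \<epsilon>\<close>.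
      The two quotients add up to at most \<open>1\<close>, whence the factor
      \<open>1 + 2 * \<epsilon>\<close> for both covers together.\<close>
    have part: "covers f \<phi> (map (\<lambda>(c, s). (c * (q f s + \<epsilon>), s)) l)"
      if l: "covers h' \<phi> l" and f: "f \<in> cc_cone" and zero: "\<And>x. x \<notin> K \<Longrightarrow> f x = 0"
        and near: "\<And>s v. \<lbrakk>s \<in> carrier G; v \<in> V\<^sub>1 \<inter> V\<^sub>2\<rbrakk> \<Longrightarrow> \<bar>q f (s \<otimes> v) - q f s\<bar> < \<epsilon>" for f l
      unfolding covers_def
    proof (intro conjI allI)
      have lw: "l \<in> weights" using l by (simp add: covers_def)
      show "map (\<lambda>(c, s). (c * (q f s + \<epsilon>), s)) l \<in> weights"
        using lw e cc_cone_nonneg[OF q[OF f]]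
        by (auto simp: weights_def intro!: mult_nonneg_nonneg add_nonneg_nonneg)
      fix x
      have "f x = h x * q f x" using h_pos[of x] by (simp add: q_def)
      also have "\<dots> \<le> h' x * q f x"
      proof (cases "x \<in> K")
        case True
        then have "h x \<le> h' x" using K(2)[of x] e by (simp add: h_def h'_def)
        then show ?thesis using cc_cone_nonneg[OF q[OF f]] by (rule mult_right_mono)
      next
        case False
        then show ?thesis using zero by (simp add: q_def)
      qed
      also have "\<dots> \<le> comb \<phi> l x * q f x"
        using l cc_cone_nonneg[OF q[OF f]] by (intro mult_right_mono) (auto simp: covers_def)
      also have "\<dots> \<le> comb \<phi> (map (\<lambda>(c, s). (c * (q f s + \<epsilon>), s)) l) x"
        using lw
      proof (induction l)
        case (Cons p l)
        obtain c s where p: "p = (c, s)" by (cases p)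
        have c: "0 \<le> c" "s \<in> carrier G" using Cons.prems by (auto simp: p)
        have "shift s \<phi> x * q f x \<le> shift s \<phi> x * (q f s + \<epsilon>)"
        proof (cases "x \<in> carrier G \<and> inv s \<otimes> x \<in> V\<^sub>1 \<inter> V\<^sub>2")
          case True
          then have "s \<otimes> (inv s \<otimes> x) = x" using c(2) by (simp flip: m_assoc)
          then have "\<bar>q f x - q f s\<bar> < \<epsilon>" using near[OF c(2), of "inv s \<otimes> x"] True by simp
          then show ?thesis using cc_cone_nonneg[OF \<phi>(1)] by (intro mult_left_mono) (auto simp: shift_def)
        next
          case False
          then have "shift s \<phi> x = 0" using supp by (auto simp: shift_def)
          then show ?thesis by simp
        qed
        from mult_left_mono[OF this c(1)] show ?case
          using Cons by (simp add: p algebra_simps)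
      qed simp
      finally show "f x \<le> comb \<phi> (map (\<lambda>(c, s). (c * (q f s + \<epsilon>), s)) l) x" .
    qed
    have "(cov f\<^sub>1 \<phi> + cov f\<^sub>2 \<phi>) / (1 + 2 * \<epsilon>) \<le> cov h' \<phi>"
    proof (rule cov_greatest[OF \<phi> h'])
      fix l assume l: "covers h' \<phi> l"
      have "cov f\<^sub>1 \<phi> + cov f\<^sub>2 \<phi> \<le> sum_list (map fst (map (\<lambda>(c, s). (c * (q f\<^sub>1 s + \<epsilon>), s)) l))
          + sum_list (map fst (map (\<lambda>(c, s). (c * (q f\<^sub>2 s + \<epsilon>), s)) l))"
        using V1(3) V2(3) K(1) by (intro add_mono cov_le part[OF l] f) auto
      also have "\<dots> \<le> (1 + 2 * \<epsilon>) * sum_list (map fst l)"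
        using l[unfolded covers_def, THEN conjunct1]
      proof (induction l)
        case (Cons p l)
        obtain c s where p: "p = (c, s)" by (cases p)
        have "c * (q f\<^sub>1 s + \<epsilon> + (q f\<^sub>2 s + \<epsilon>)) \<le> c * (1 + 2 * \<epsilon>)"
          using Cons.prems q_sum[of s] by (intro mult_left_mono) (auto simp: p)
        then show ?case using Cons by (simp add: p algebra_simps)
      qed simp
      finally show "(cov f\<^sub>1 \<phi> + cov f\<^sub>2 \<phi>) / (1 + 2 * \<epsilon>) \<le> sum_list (map fst l)"
        using e by (simp add: field_simps)
    qed
    then have "cov f\<^sub>1 \<phi> + cov f\<^sub>2 \<phi> \<le> (1 + 2 * \<epsilon>) * cov h' \<phi>" using e by (simp add: field_simps)
    also have "cov h' \<phi> \<le> cov (\<lambda>x. f\<^sub>1 x + f\<^sub>2 x) \<phi> + cov (\<lambda>x. \<epsilon> * g x) \<phi>"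
      unfolding h'_def using e by (intro cov_add[OF \<phi>] cc_cone_add f cc_cone_scale g) auto
    also have "cov (\<lambda>x. \<epsilon> * g x) \<phi> \<le> \<epsilon> * cov g \<phi>" using e by (intro cov_scale \<phi> g) auto
    finally show "cov f\<^sub>1 \<phi> + cov f\<^sub>2 \<phi> \<le> (1 + 2 * \<epsilon>) * (cov (\<lambda>x. f\<^sub>1 x + f\<^sub>2 x) \<phi> + \<epsilon> * cov g \<phi>)"
      using e by (simp add: mult_left_mono)
  qed
qed

lemma bumps_subset: "V \<subseteq> W \<Longrightarrow> bumps V \<subseteq> bumps W"
  by (auto simp: bumps_def)

text \<open>Complete regularity separates the unit from the complement of
  \<open>U \<inter> V\<close>; the relatively compact neighbourhood \<open>U\<close> is there to
  make the support compact.\<close>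

lemma bumps_nonempty:
  assumes "Hausdorff_space T" "locally_compact_space T" and V: "openin T V" "\<one> \<in> V"
  shows "bumps V \<noteq> {}"
proof -
  obtain U K where U: "openin T U" "compactin T K" "\<one> \<in> U" "U \<subseteq> K"
    using assms(2) unfolding locally_compact_space_def by (metis one_closed topspace_eq)
  have "completely_regular_space T"
    using assms by (simp add: locally_compact_regular_imp_completely_regular_space)
  moreover have "closedin T (topspace T - U \<inter> V)" using U V by (intro closedin_diff) auto
  moreover have "\<one> \<in> topspace T - (topspace T - U \<inter> V)" using U V by (auto simp: topspace_eq)
  ultimately obtain f :: "'a \<Rightarrow> real" where f: "continuous_map T (top_of_set {0..1}) f" "f \<one> = 0"
      "f ` (topspace T - U \<inter> V) \<subseteq> {1}"
    unfolding completely_regular_space_def by blast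
  define g where "g x = (if x \<in> carrier G then 1 - f x else 0)" for x
  have f': "continuous_map T euclideanreal f" "\<And>x. x \<in> carrier G \<Longrightarrow> f x \<le> 1"
    using f(1) by (auto simp: continuous_map_in_subtopology topspace_eq)
  have zero: "g x = 0" if "x \<notin> U \<inter> V" for x
    using f(3) that by (auto simp: g_def topspace_eq image_subset_iff)
  have "continuous_map T euclideanreal (\<lambda>x. 1 - f x)"
    by (intro continuous_map_diff f') auto
  then have "continuous_map T euclideanreal g"
    by (rule continuous_map_eq) (auto simp: g_def topspace_eq)
  moreover have "0 \<le> g x" for x using f'(2) by (simp add: g_def)
  ultimately have "g \<in> cc_cone" using U(2,4) zero by (intro cc_coneI[of g K]) auto
  then have "g \<in> bumps V" using zero f(2) by (auto simp: bumps_def) (simp add: g_def)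
  then show ?thesis by blast
qed

end

section \<open>The invariant functional as a cluster point\<close>

locale invariant_functional = topological_group +
  fixes I :: "('a \<Rightarrow> real) \<Rightarrow> real"
  assumes I_nonneg: "f \<in> cc_cone \<Longrightarrow> 0 \<le> I f"
    and I_add: "\<lbrakk>f \<in> cc_cone; g \<in> cc_cone\<rbrakk> \<Longrightarrow> I (\<lambda>x. f x + g x) = I f + I g"
    and I_scale: "\<lbrakk>f \<in> cc_cone; 0 \<le> c\<rbrakk> \<Longrightarrow> I (\<lambda>x. c * f x) = c * I f"
    and I_shift: "\<lbrakk>f \<in> cc_cone; s \<in> carrier G\<rbrakk> \<Longrightarrow> I (shift s f) = I f"

locale haar = topological_group +
  fixes f\<^sub>0 :: "'a \<Rightarrow> real"
  assumes Hausdorff: "Hausdorff_space T" and loc_compact: "locally_compact_space T"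
    and f0: "f\<^sub>0 \<in> cc_cone" "0 < f\<^sub>0 \<one>"
begin

text \<open>Covering numbers may grow without bound as \<open>\<phi>\<close> concentrates at the
  unit. Relative to \<open>f\<^sub>0\<close> they stay between \<open>0\<close> and
  \<open>cov f f\<^sub>0\<close>.\<close>

definition ratio :: "('a \<Rightarrow> real) \<Rightarrow> ('a \<Rightarrow> real) \<Rightarrow> real" where
  "ratio \<phi> f = cov f \<phi> / cov f\<^sub>0 \<phi>"

lemma cov_f0_pos: "\<phi> \<in> bumps V \<Longrightarrow> 0 < cov f\<^sub>0 \<phi>"
  using cov_pos[OF _ _ f0] by (auto simp: bumps_def)

text \<open>The functional is a cluster point of the \<open>ratio \<phi>\<close> as the support of \<open>\<phi>\<close> shrinks to the unit;
  it exists since these functionals lie in a product of compact intervals.\<close>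

lemma cluster_point:
  obtains I where "\<And>V S. \<lbrakk>openin T V; \<one> \<in> V; finite S; S \<subseteq> cc_cone\<rbrakk> \<Longrightarrow>
    \<exists>\<Phi>. (\<forall>n::nat. \<Phi> n \<in> bumps V) \<and> (\<forall>f\<in>S. (\<lambda>n. ratio (\<Phi> n) f) \<longlonglongrightarrow> I f)"
proof -
  define X where "X = product_topology (\<lambda>f. top_of_set {0..cov f f\<^sub>0}) cc_cone"
  define R where "R V = (\<lambda>\<phi>. restrict (ratio \<phi>) cc_cone) ` bumps V" for V
  define N where "N = {V. openin T V \<and> \<one> \<in> V}"
  have "compact_space X"
    by (auto simp: X_def compact_space_product_topology compact_space_subtopology)
  have Rsub: "R V \<subseteq> topspace X" for V
  proof -
    have "ratio \<phi> f \<in> {0..cov f f\<^sub>0}" if "\<phi> \<in> bumps V" "f \<in> cc_cone" for \<phi> f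
      using cov_f0_pos[OF that(1)] cov_nonneg[OF _ _ that(2), of \<phi>] cov_trans[OF that(2) f0, of \<phi>] that(1)
      by (auto simp: ratio_def field_simps bumps_def)
    then show ?thesis by (auto simp: R_def X_def)
  qed
  have "\<exists>I. I \<in> \<Inter>((\<lambda>V. X closure_of R V) ` N)"
  proof -
    have "\<Inter>\<F> \<noteq> {}" if F: "finite \<F>" "\<F> \<subseteq> (\<lambda>V. X closure_of R V) ` N" for \<F>
    proof -
      obtain \<V> where V: "finite \<V>" "\<V> \<subseteq> N" "\<F> = (\<lambda>V. X closure_of R V) ` \<V>"
        using F by (meson finite_subset_image)
      \<comment> \<open>\<open>R\<close> is monotone, so a bump supported in a finite intersection
        of neighbourhoods yields the finite intersection property. The factor
        \<open>carrier G\<close> keeps \<open>W\<close> inside the group when the family is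
        empty.\<close>
      define W where "W = carrier G \<inter> \<Inter>\<V>"
      have W: "openin T W"
        unfolding W_def topspace_eq[symmetric] using V by (intro openin_Int_Inter) (auto simp: N_def)
      have oneW: "\<one> \<in> W" using V by (auto simp: W_def N_def)
      obtain r where r: "r \<in> R W"
        using bumps_nonempty[OF Hausdorff loc_compact W oneW] by (auto simp: R_def)
      have "r \<in> X closure_of R V" if "V \<in> \<V>" for V
      proof -
        have "R W \<subseteq> R V" unfolding R_def using that by (intro image_mono bumps_subset) (auto simp: W_def)
        then show ?thesis using r closure_of_subset[OF Rsub] by blast
      qed
      then show ?thesis using V(3) by blast
    qed
    then show ?thesis
      using \<open>compact_space X\<close>[unfolded compact_space_fip, rule_format, of "(\<lambda>V. X closure_of R V) ` N"]
      by auto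
  qed
  then obtain I where I: "\<And>V. V \<in> N \<Longrightarrow> I \<in> X closure_of R V" by blast
  show ?thesis
  proof (rule that)
    fix V S assume V: "openin T V" "\<one> \<in> V" and S: "finite S" "S \<subseteq> cc_cone"
    have IX: "I \<in> topspace X" "I \<in> X closure_of R V"
      using I[of V] V in_closure_of[of I X] by (auto simp: N_def)
    have "\<exists>\<phi>\<in>bumps V. \<forall>f\<in>S. \<bar>ratio \<phi> f - I f\<bar> < e" if e: "0 < e" for e
    proof -
      have proj: "continuous_map X euclideanreal (\<lambda>g. g f)" if "f \<in> cc_cone" for f
        using continuous_map_product_projection[OF that, of "\<lambda>f. top_of_set {0..cov f f\<^sub>0}"]
        by (simp add: X_def continuous_map_in_subtopology)
      define B where "B f = {g \<in> topspace X. g f \<in> ball (I f) e}" for f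
      have "openin X (B f)" if "f \<in> S" for f unfolding B_def
        by (rule openin_continuous_map_preimage[OF proj]) (use S that in auto)
      then have "openin X (topspace X \<inter> \<Inter>(B ` S))"
        using S by (intro openin_Int_Inter) auto
      moreover have "I \<in> topspace X \<inter> \<Inter>(B ` S)" using IX e by (auto simp: B_def)
      ultimately obtain r where r: "r \<in> R V" "r \<in> \<Inter>(B ` S)"
        using IX(2) unfolding in_closure_of by blast
      then obtain \<phi> where \<phi>: "\<phi> \<in> bumps V" "r = restrict (ratio \<phi>) cc_cone" by (auto simp: R_def)
      have "\<bar>ratio \<phi> f - I f\<bar> < e" if "f \<in> S" for f
      proof -
        have "r \<in> B f" using r(2) that by blast
        then show ?thesis using \<phi>(2) S(2) that by (auto simp: B_def dist_real_def abs_minus_commute)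
      qed
      then show ?thesis using \<phi>(1) by blast
    qed
    \<comment> \<open>The product need not be first countable, but only the finitely many
      coordinates in \<open>S\<close> matter. Tolerances \<open>1 / (n + 1)\<close> therefore give a
      sequence, to which the ordinary limit laws apply.\<close>
    then have "\<exists>\<phi>\<in>bumps V. \<forall>f\<in>S. \<bar>ratio \<phi> f - I f\<bar> < inverse (real (Suc n))" for n by simp
    then obtain \<Phi> where \<Phi>: "\<And>n. \<Phi> n \<in> bumps V"
      "\<And>n f. f \<in> S \<Longrightarrow> \<bar>ratio (\<Phi> n) f - I f\<bar> < inverse (real (Suc n))"
      by metis
    have "(\<lambda>n. ratio (\<Phi> n) f) \<longlonglongrightarrow> I f" if "f \<in> S" for f
    proof -
      have "(\<lambda>n. ratio (\<Phi> n) f - I f) \<longlonglongrightarrow> 0"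
        by (rule tendsto_rabs_zero_cancel, rule tendsto_sandwich[OF _ _ tendsto_const LIMSEQ_inverse_real_of_nat])
          (use \<Phi>(2)[OF that] in \<open>auto intro!: always_eventually less_imp_le\<close>)
      then show ?thesis by (rule LIM_zero_cancel)
    qed
    with \<Phi>(1) show "\<exists>\<Phi>. (\<forall>n::nat. \<Phi> n \<in> bumps V) \<and> (\<forall>f\<in>S. (\<lambda>n. ratio (\<Phi> n) f) \<longlonglongrightarrow> I f)"
      by blast
  qed
qed

text \<open>Each law concerns finitely many functions, so it is a limit of inequalities between
  covering numbers along one sequence of bumps. Superadditivity requires the bumps to be supported
  close to the unit, which is why \<open>cluster_point\<close> allows any neighbourhood.\<close>

lemma invariant_functional:
  obtains I where "invariant_functional G T I" "I f\<^sub>0 = 1"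
proof -
  obtain I where I: "\<And>V S. \<lbrakk>openin T V; \<one> \<in> V; finite S; S \<subseteq> cc_cone\<rbrakk> \<Longrightarrow>
      \<exists>\<Phi>. (\<forall>n::nat. \<Phi> n \<in> bumps V) \<and> (\<forall>f\<in>S. (\<lambda>n. ratio (\<Phi> n) f) \<longlonglongrightarrow> I f)"
    using cluster_point by blast
  have I': "\<exists>\<Phi>. (\<forall>n::nat. \<Phi> n \<in> bumps (carrier G)) \<and> (\<forall>f\<in>S. (\<lambda>n. ratio (\<Phi> n) f) \<longlonglongrightarrow> I f)"
    if "finite S" "S \<subseteq> cc_cone" for S
    using I[OF openin_topspace _ that] by (simp add: topspace_eq)
  note ratio_mono = divide_right_mono[OF _ less_imp_le[OF cov_f0_pos]]
  have norm: "I f\<^sub>0 = 1"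
  proof -
    obtain \<Phi> :: "nat \<Rightarrow> _" where \<Phi>: "\<And>n. \<Phi> n \<in> bumps (carrier G)" "(\<lambda>n. ratio (\<Phi> n) f\<^sub>0) \<longlonglongrightarrow> I f\<^sub>0"
      using I'[of "{f\<^sub>0}"] f0 by auto
    have "ratio (\<Phi> n) f\<^sub>0 = 1" for n using cov_f0_pos[OF \<Phi>(1)[of n]] by (simp add: ratio_def)
    then show ?thesis using \<Phi>(2) by (simp add: LIMSEQ_const_iff)
  qed
  have nonneg: "0 \<le> I f" if f: "f \<in> cc_cone" for f
  proof -
    obtain \<Phi> :: "nat \<Rightarrow> _" where \<Phi>: "\<And>n. \<Phi> n \<in> bumps (carrier G)" "(\<lambda>n. ratio (\<Phi> n) f) \<longlonglongrightarrow> I f"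
      using I'[of "{f}"] f by auto
    have b: "\<Phi> n \<in> cc_cone" "0 < \<Phi> n \<one>" for n using \<Phi>(1) by (auto simp: bumps_def)
    have "0 \<le> ratio (\<Phi> n) f" for n
      using ratio_mono[OF cov_nonneg[OF b f] \<Phi>(1)] by (simp add: ratio_def)
    then show ?thesis by (intro LIMSEQ_le_const[OF \<Phi>(2)]) auto
  qed
  have scale_le: "I (\<lambda>x. c * f x) \<le> c * I f" if f: "f \<in> cc_cone" and c: "0 \<le> c" for f c
  proof -
    obtain \<Phi> :: "nat \<Rightarrow> _" where \<Phi>: "\<And>n. \<Phi> n \<in> bumps (carrier G)" "(\<lambda>n. ratio (\<Phi> n) f) \<longlonglongrightarrow> I f"
        "(\<lambda>n. ratio (\<Phi> n) (\<lambda>x. c * f x)) \<longlonglongrightarrow> I (\<lambda>x. c * f x)"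
      using I'[of "{f, \<lambda>x. c * f x}"] f cc_cone_scale[OF f c] by auto
    have b: "\<Phi> n \<in> cc_cone" "0 < \<Phi> n \<one>" for n using \<Phi>(1) by (auto simp: bumps_def)
    have "ratio (\<Phi> n) (\<lambda>x. c * f x) \<le> c * ratio (\<Phi> n) f" for n
      using ratio_mono[OF cov_scale[OF b f c] \<Phi>(1)] by (simp add: ratio_def)
    then show ?thesis by (intro LIMSEQ_le[OF \<Phi>(3) tendsto_mult_left[OF \<Phi>(2)]]) auto
  qed
  have scale: "I (\<lambda>x. c * f x) = c * I f" if f: "f \<in> cc_cone" and c: "0 \<le> c" for f c
  proof (cases "c = 0")
    case True
    then show ?thesis using scale_le[OF f c] nonneg[OF cc_cone_zero] by simp
  next
    case False
    have "I (\<lambda>x. inverse c * (c * f x)) \<le> inverse c * I (\<lambda>x. c * f x)"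
      using c by (intro scale_le cc_cone_scale f) auto
    moreover have "(\<lambda>x. inverse c * (c * f x)) = f" using False by (auto simp: field_simps)
    ultimately have "c * I f \<le> I (\<lambda>x. c * f x)" using c False by (simp add: field_simps)
    then show ?thesis using scale_le[OF f c] by simp
  qed
  have shift_le: "I (shift s f) \<le> I f" if f: "f \<in> cc_cone" and s: "s \<in> carrier G" for f s
  proof -
    obtain \<Phi> :: "nat \<Rightarrow> _" where \<Phi>: "\<And>n. \<Phi> n \<in> bumps (carrier G)" "(\<lambda>n. ratio (\<Phi> n) f) \<longlonglongrightarrow> I f"
        "(\<lambda>n. ratio (\<Phi> n) (shift s f)) \<longlonglongrightarrow> I (shift s f)"
      using I'[of "{f, shift s f}"] f cc_cone_shift[OF f s] by auto
    have b: "\<Phi> n \<in> cc_cone" "0 < \<Phi> n \<one>" for n using \<Phi>(1) by (auto simp: bumps_def)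
    have "ratio (\<Phi> n) (shift s f) \<le> ratio (\<Phi> n) f" for n
      using ratio_mono[OF cov_shift[OF b f s] \<Phi>(1)] by (simp add: ratio_def)
    then show ?thesis by (intro LIMSEQ_le[OF \<Phi>(3) \<Phi>(2)]) auto
  qed
  have shift: "I (shift s f) = I f" if f: "f \<in> cc_cone" and s: "s \<in> carrier G" for f s
    using shift_le[OF f s] shift_le[OF cc_cone_shift[OF f s], of "inv s"] s f
    by (simp add: shift_shift shift_one)
  have add_le: "I (\<lambda>x. f x + g x) \<le> I f + I g" if f: "f \<in> cc_cone" and g: "g \<in> cc_cone" for f g
  proof -
    obtain \<Phi> :: "nat \<Rightarrow> _" where \<Phi>: "\<And>n. \<Phi> n \<in> bumps (carrier G)" "(\<lambda>n. ratio (\<Phi> n) f) \<longlonglongrightarrow> I f"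
        "(\<lambda>n. ratio (\<Phi> n) g) \<longlonglongrightarrow> I g" "(\<lambda>n. ratio (\<Phi> n) (\<lambda>x. f x + g x)) \<longlonglongrightarrow> I (\<lambda>x. f x + g x)"
      using I'[of "{f, g, \<lambda>x. f x + g x}"] f g cc_cone_add[OF f g] by auto
    have b: "\<Phi> n \<in> cc_cone" "0 < \<Phi> n \<one>" for n using \<Phi>(1) by (auto simp: bumps_def)
    have "ratio (\<Phi> n) (\<lambda>x. f x + g x) \<le> ratio (\<Phi> n) f + ratio (\<Phi> n) g" for n
      using ratio_mono[OF cov_add[OF b f g] \<Phi>(1)]
      by (simp add: ratio_def add_divide_distrib)
    then show ?thesis by (intro LIMSEQ_le[OF \<Phi>(4) tendsto_add[OF \<Phi>(2,3)]]) auto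
  qed
  have le_add: "I f + I g \<le> I (\<lambda>x. f x + g x)" if f: "f \<in> cc_cone" and g: "g \<in> cc_cone" for f g
  proof -
    obtain K L where KL: "compactin T K" "\<And>x. x \<notin> K \<Longrightarrow> f x = 0" "compactin T L" "\<And>x. x \<notin> L \<Longrightarrow> g x = 0"
      using f g by (metis cc_cone_support)
    obtain d where d: "d \<in> cc_cone" "\<And>x. x \<in> K \<union> L \<Longrightarrow> 1 \<le> d x"
      using dominating_cc_cone[OF compactin_Un[OF KL(1,3)] f0] by blast
    \<comment> \<open>The neighbourhood depends on \<open>\<epsilon>\<close>. So the limit over
      bumps is taken with \<open>\<epsilon>\<close> fixed, and \<open>\<epsilon>\<close> tends to
      \<open>0\<close> afterwards.\<close>
    have approx: "I f + I g \<le> (1 + 2 * \<epsilon>) * (I (\<lambda>x. f x + g x) + \<epsilon> * I d)" if e: "0 < \<epsilon>" for \<epsilon>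
    proof -
      have supp: "f x = 0 \<and> g x = 0" if "x \<notin> K \<union> L" for x using KL(2,4) that by simp
      obtain V where V: "openin T V" "\<one> \<in> V" "\<And>\<phi>. \<phi> \<in> bumps V \<Longrightarrow>
          cov f \<phi> + cov g \<phi> \<le> (1 + 2 * \<epsilon>) * (cov (\<lambda>x. f x + g x) \<phi> + \<epsilon> * cov d \<phi>)"
        using cov_almost_superadditive[OF f g d(1) supp d(2) e] by blast
      obtain \<Phi> :: "nat \<Rightarrow> _" where \<Phi>: "\<And>n. \<Phi> n \<in> bumps V" "(\<lambda>n. ratio (\<Phi> n) f) \<longlonglongrightarrow> I f"
          "(\<lambda>n. ratio (\<Phi> n) g) \<longlonglongrightarrow> I g" "(\<lambda>n. ratio (\<Phi> n) (\<lambda>x. f x + g x)) \<longlonglongrightarrow> I (\<lambda>x. f x + g x)"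
          "(\<lambda>n. ratio (\<Phi> n) d) \<longlonglongrightarrow> I d"
        using I[OF V(1,2), of "{f, g, \<lambda>x. f x + g x, d}"] f g d cc_cone_add[OF f g] by auto
      have "ratio (\<Phi> n) f + ratio (\<Phi> n) g
          \<le> (1 + 2 * \<epsilon>) * (ratio (\<Phi> n) (\<lambda>x. f x + g x) + \<epsilon> * ratio (\<Phi> n) d)" for n
        using ratio_mono[OF V(3)[OF \<Phi>(1)] \<Phi>(1), of n n]
        by (simp add: ratio_def add_divide_distrib algebra_simps)
      then show ?thesis
        by (intro LIMSEQ_le[OF tendsto_add[OF \<Phi>(2,3)]
              tendsto_mult_left[OF tendsto_add[OF \<Phi>(4) tendsto_mult_left[OF \<Phi>(5)]]]]) auto
    qed
    have "((\<lambda>\<epsilon>. (1 + 2 * \<epsilon>) * (I (\<lambda>x. f x + g x) + \<epsilon> * I d)) \<longlongrightarrow>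
        (1 + 2 * 0) * (I (\<lambda>x. f x + g x) + 0 * I d)) (at_right 0)"
      by (intro tendsto_intros)
    from tendsto_lowerbound[OF this, of "I f + I g"] show ?thesis
      using approx by (simp add: eventually_at_right_less eventually_at_right_field) (metis zero_less_one)
  qed
  show ?thesis
  proof (rule that)
    show "invariant_functional G T I"
      by unfold_locales (use nonneg scale shift add_le le_add in \<open>auto intro: antisym\<close>)
  qed (fact norm)
qed

end

section \<open>Positive definite functions of compact support\<close>

text \<open>Because the quadratic form is tested through its real part, hermitian symmetry is
  demanded separately. A list may repeat a point, which amounts to adding the coefficients.\<close>

definition positive_definite :: "('a, 'b) monoid_scheme \<Rightarrow> ('a \<Rightarrow> complex) \<Rightarrow> bool" where
  "positive_definite G \<phi> \<longleftrightarrow>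
     (\<forall>x\<in>carrier G. \<phi> (inv\<^bsub>G\<^esub> x) = cnj (\<phi> x)) \<and>
     (\<forall>l\<in>lists (UNIV \<times> carrier G).
        0 \<le> Re (\<Sum>(d, y)\<leftarrow>l. \<Sum>(c, x)\<leftarrow>l. c * cnj d * \<phi> (inv\<^bsub>G\<^esub> y \<otimes>\<^bsub>G\<^esub> x)))"

lemma sum_list_product:
  "(\<Sum>p\<leftarrow>List.product xs ys. f p) = (\<Sum>x\<leftarrow>xs. \<Sum>y\<leftarrow>ys. f (x, y))"
  by (induction xs) (auto simp: o_def)

lemma sum_list_square:
  fixes f :: "'a \<Rightarrow> 'b :: comm_semiring_0"
  shows "(\<Sum>x\<leftarrow>xs. \<Sum>y\<leftarrow>ys. f x * g y) = (\<Sum>x\<leftarrow>xs. f x) * (\<Sum>y\<leftarrow>ys. g y)"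
  by (simp add: sum_list_const_mult sum_list_mult_const)

lemma Re_sum_list: "Re (\<Sum>x\<leftarrow>xs. f x) = (\<Sum>x\<leftarrow>xs. Re (f x))"
  by (induction xs) auto

section \<open>Autocorrelations\<close>

context invariant_functional
begin

lemma I_mono:
  assumes f: "f \<in> cc_cone" and g: "g \<in> cc_cone" and le: "\<And>x. f x \<le> g x"
  shows "I f \<le> I g"
proof -
  obtain K where K: "compactin T K" "\<And>x. x \<notin> K \<Longrightarrow> g x = 0" using g by (metis cc_cone_support)
  have "f x = 0" if "x \<notin> K" for x using K(2)[OF that] le[of x] cc_cone_nonneg[OF f, of x] by simp
  then have d: "(\<lambda>x. g x - f x) \<in> cc_cone" using le K
    by (intro cc_coneI[of _ K] continuous_map_diff cc_cone_continuous[OF f] cc_cone_continuous[OF g]) auto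
  from I_add[OF f this] have "I g = I f + I (\<lambda>x. g x - f x)" by simp
  with I_nonneg[OF d] show ?thesis by simp
qed

lemma combination_cc_cone:
  assumes "\<And>p. p \<in> set L \<Longrightarrow> F p \<in> cc_cone" "\<And>p. p \<in> set L \<Longrightarrow> 0 \<le> w p"
  shows "(\<lambda>x. \<Sum>p\<leftarrow>L. w p * F p x) \<in> cc_cone \<and> I (\<lambda>x. \<Sum>p\<leftarrow>L. w p * F p x) = (\<Sum>p\<leftarrow>L. w p * I (F p))"
  using assms
proof (induction L)
  case Nil
  then show ?case using cc_cone_zero I_scale[OF cc_cone_zero, of 0] by simp
next
  case (Cons p L)
  then have "F p \<in> cc_cone" "0 \<le> w p" by auto
  with Cons show ?case by (auto simp: I_add I_scale cc_cone_scale intro!: cc_cone_add)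
qed

text \<open>The laws of \<open>I\<close> hold on the cone, so signed weights are separated into
  positive and negative parts; the hypothesis becomes an inequality between two members of the cone,
  to which monotonicity applies.\<close>

lemma I_nonneg_combination:
  assumes F: "\<And>p. p \<in> set L \<Longrightarrow> F p \<in> cc_cone" and nonneg: "\<And>x. 0 \<le> (\<Sum>p\<leftarrow>L. w p * F p x)"
  shows "0 \<le> (\<Sum>p\<leftarrow>L. w p * I (F p))"
proof -
  have split: "(\<Sum>p\<leftarrow>L. w p * a p) = (\<Sum>p\<leftarrow>L. max (w p) 0 * a p) - (\<Sum>p\<leftarrow>L. max (- w p) 0 * a p)"
    for a :: "_ \<Rightarrow> real"
    by (induction L) (auto simp: algebra_simps max_def)
  have P: "(\<lambda>x. \<Sum>p\<leftarrow>L. max (w p) 0 * F p x) \<in> cc_cone"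
    "I (\<lambda>x. \<Sum>p\<leftarrow>L. max (w p) 0 * F p x) = (\<Sum>p\<leftarrow>L. max (w p) 0 * I (F p))"
    using combination_cc_cone[OF F, where w = "\<lambda>p. max (w p) 0"] by auto
  have N: "(\<lambda>x. \<Sum>p\<leftarrow>L. max (- w p) 0 * F p x) \<in> cc_cone"
    "I (\<lambda>x. \<Sum>p\<leftarrow>L. max (- w p) 0 * F p x) = (\<Sum>p\<leftarrow>L. max (- w p) 0 * I (F p))"
    using combination_cc_cone[OF F, where w = "\<lambda>p. max (- w p) 0"] by auto
  have "I (\<lambda>x. \<Sum>p\<leftarrow>L. max (- w p) 0 * F p x) \<le> I (\<lambda>x. \<Sum>p\<leftarrow>L. max (w p) 0 * F p x)"
  proof (rule I_mono[OF N(1) P(1)])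
    show "(\<Sum>p\<leftarrow>L. max (- w p) 0 * F p x) \<le> (\<Sum>p\<leftarrow>L. max (w p) 0 * F p x)" for x
      using nonneg[of x] split[of "\<lambda>p. F p x"] by linarith
  qed
  then show ?thesis unfolding split P(2) N(2) by simp
qed

text \<open>This is the diagonal coefficient at \<open>g\<close> of the left regular representation,
  with \<open>I\<close> in the role of the Haar integral.\<close>

definition autocorrelation :: "('a \<Rightarrow> real) \<Rightarrow> 'a \<Rightarrow> real" where
  "autocorrelation g x = (if x \<in> carrier G then I (\<lambda>z. g z * shift x g z) else 0)"

lemma shift_product_cc_cone:
  "\<lbrakk>g \<in> cc_cone; x \<in> carrier G; y \<in> carrier G\<rbrakk> \<Longrightarrow> (\<lambda>z. shift y g z * shift x g z) \<in> cc_cone"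
  using cc_cone_shift[of g] by (intro cc_cone_mult cc_cone_continuous cc_cone_nonneg) auto

text \<open>Translating the integrand by \<open>y\<close> leaves \<open>I\<close> unchanged and
  makes the expression symmetric in \<open>x\<close> and \<open>y\<close>. Both clauses of positive
  definiteness are read off from this form.\<close>

lemma autocorrelation_eq:
  assumes "g \<in> cc_cone" "x \<in> carrier G" "y \<in> carrier G"
  shows "autocorrelation g (inv y \<otimes> x) = I (\<lambda>z. shift y g z * shift x g z)"
proof -
  have "shift y (\<lambda>z. g z * shift (inv y \<otimes> x) g z) = (\<lambda>z. shift y g z * shift x g z)"
    using assms by (simp add: shift_mult shift_shift flip: m_assoc)
  moreover have "(\<lambda>z. g z * shift (inv y \<otimes> x) g z) \<in> cc_cone"
    using shift_product_cc_cone[of g "inv y \<otimes> x" \<one>] assms by (simp add: shift_one)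
  ultimately show ?thesis using assms I_shift[of _ y] by (metis autocorrelation_def inv_closed m_closed)
qed

lemma positive_definite_autocorrelation:
  assumes g: "g \<in> cc_cone"
  shows "positive_definite G (\<lambda>x. complex_of_real (autocorrelation g x))"
  unfolding positive_definite_def
proof (intro conjI ballI)
  fix x assume x: "x \<in> carrier G"
  have "autocorrelation g (inv x) = autocorrelation g x"
    using autocorrelation_eq[OF g _ x, of \<one>] autocorrelation_eq[OF g x, of \<one>] x
    by (simp add: mult.commute)
  then show "complex_of_real (autocorrelation g (inv x)) = cnj (complex_of_real (autocorrelation g x))"
    by simp
next
  fix l :: "(complex \<times> 'a) list" assume "l \<in> lists (UNIV \<times> carrier G)"
  then have l: "\<And>c x. (c, x) \<in> set l \<Longrightarrow> x \<in> carrier G" by (auto simp: lists_eq_set)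
  \<comment> \<open>For real coefficients the form is \<open>I\<close> of the square of a
    combination of translates. The complex form is \<open>q Re + q Im\<close>, because the
    autocorrelation is real and \<open>Re (c * cnj d) = Re c * Re d + Im c * Im d\<close>.\<close>
  define q where "q r = (\<Sum>(d, y)\<leftarrow>l. \<Sum>(c, x)\<leftarrow>l. r c * r d * autocorrelation g (inv y \<otimes> x))"
    for r :: "complex \<Rightarrow> real"
  have q: "0 \<le> q r" for r
  proof -
    define w where "w = (\<lambda>((c, x :: 'a), (d, y :: 'a)). r c * r d)"
    let ?F = "\<lambda>p z. shift (snd (fst p)) g z * shift (snd (snd p)) g z"
    let ?w = "\<lambda>p. r (fst (fst p)) * r (fst (snd p))"
    have "0 \<le> (\<Sum>p\<leftarrow>List.product l l. ?w p * I (?F p))"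
    proof (rule I_nonneg_combination)
      fix p assume "p \<in> set (List.product l l)"
      then show "?F p \<in> cc_cone" using l by (intro shift_product_cc_cone[OF g]) auto
    next
      fix z
      have "(\<Sum>p\<leftarrow>List.product l l. ?w p * ?F p z)
          = (\<Sum>p\<leftarrow>l. \<Sum>p'\<leftarrow>l. (r (fst p) * shift (snd p) g z) * (r (fst p') * shift (snd p') g z))"
        by (simp add: sum_list_product mult_ac)
      also have "\<dots> = (\<Sum>p\<leftarrow>l. r (fst p) * shift (snd p) g z)\<^sup>2"
        by (simp only: sum_list_square power2_eq_square)
      finally show "0 \<le> (\<Sum>p\<leftarrow>List.product l l. ?w p * ?F p z)" by simp
    qed
    also have "\<dots> = q r"
      unfolding q_def sum_list_product using l
      by (auto simp: case_prod_beta' autocorrelation_eq[OF g] intro!: arg_cong[where f = sum_list] map_cong)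
    finally show ?thesis .
  qed
  have "Re (\<Sum>(d, y)\<leftarrow>l. \<Sum>(c, x)\<leftarrow>l. c * cnj d * complex_of_real (autocorrelation g (inv y \<otimes> x)))
      = q Re + q Im"
    unfolding q_def by (simp add: Re_sum_list case_prod_beta' algebra_simps sum_list_addf)
  then show "0 \<le> Re (\<Sum>(d, y)\<leftarrow>l. \<Sum>(c, x)\<leftarrow>l. c * cnj d * complex_of_real (autocorrelation g (inv y \<otimes> x)))"
    using q by simp
qed

text \<open>If both factors are nonzero at \<open>z\<close>, then
  \<open>x = z \<otimes> inv (inv x \<otimes> z)\<close> is a quotient of two points of the support
  of \<open>g\<close>.\<close>

lemma autocorrelation_support:
  assumes g: "g \<in> cc_cone"
  obtains K where "compactin T K" "\<And>x. x \<notin> K \<Longrightarrow> autocorrelation g x = 0"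
proof -
  obtain K where K: "compactin T K" "K \<subseteq> carrier G" "\<And>x. x \<notin> K \<Longrightarrow> g x = 0"
    using g by (metis cc_cone_support)
  let ?L = "(\<lambda>p. fst p \<otimes> inv (snd p)) ` (K \<times> K)"
  have "continuous_map (prod_topology T T) T (\<lambda>p. fst p \<otimes> inv (snd p))"
    by (intro continuous_map_group_mult continuous_map_group_inv continuous_map_fst continuous_map_snd)
  then have "compactin T ?L" using K(1) by (intro image_compactin) (auto simp: compactin_Times)
  moreover have "autocorrelation g x = 0" if "x \<notin> ?L" for x
  proof (cases "x \<in> carrier G")
    case True
    have "(\<lambda>z. g z * shift x g z) = (\<lambda>z. 0)"
    proof (rule ext, rule ccontr)
      fix z assume "g z * shift x g z \<noteq> 0"
      then have z: "z \<in> K" "inv x \<otimes> z \<in> K" using K(3) by (auto simp: shift_def split: if_splits)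
      then have "x = z \<otimes> inv (inv x \<otimes> z)" using True K(2)
        by (simp add: inv_mult_group subsetD flip: m_assoc)
      with z that show False by (metis (no_types, lifting) SigmaI fst_conv image_eqI snd_conv)
    qed
    then show ?thesis using I_scale[OF cc_cone_zero, of 0] by (simp add: autocorrelation_def)
  qed (simp add: autocorrelation_def)
  ultimately show ?thesis by (rule that)
qed

text \<open>\<open>cc_cone_uniformly_continuous\<close> perturbs the argument on the right, whereas
  varying \<open>x\<close> in \<open>shift x g\<close> perturbs it on the left. Inversion exchanges
  the sides in the continuity proof that follows.\<close>

lemma cc_cone_inv:
  assumes g: "g \<in> cc_cone"
  shows "(\<lambda>x. if x \<in> carrier G then g (inv x) else 0) \<in> cc_cone"
proof -
  obtain K where K: "compactin T K" "K \<subseteq> carrier G" "\<And>x. x \<notin> K \<Longrightarrow> g x = 0"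
    using g by (metis cc_cone_support)
  show ?thesis
  proof (rule cc_coneI)
    show "compactin T ((\<lambda>x. inv x) ` K)" by (rule image_compactin[OF K(1) continuous_inv])
    have "continuous_map T euclideanreal (\<lambda>x. g (inv x))"
      using continuous_map_compose[OF continuous_inv cc_cone_continuous[OF g]] by (simp add: o_def)
    then show "continuous_map T euclideanreal (\<lambda>x. if x \<in> carrier G then g (inv x) else 0)"
      by (rule continuous_map_eq) (simp add: topspace_eq)
    fix x assume "x \<notin> (\<lambda>x. inv x) ` K"
    then show "(if x \<in> carrier G then g (inv x) else 0) = 0"
      using K(3) by (metis image_eqI inv_inv)
  qed (simp add: cc_cone_nonneg[OF g])
qed

lemma continuous_autocorrelation:
  assumes g: "g \<in> cc_cone"
  shows "continuous_map T euclideanreal (autocorrelation g)"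
proof -
  let ?g' = "\<lambda>x. if x \<in> carrier G then g (inv x) else 0"
  have "\<exists>U. openin T U \<and> y \<in> U \<and> (\<forall>x\<in>U. autocorrelation g x \<in> ball (autocorrelation g y) e)"
    if y: "y \<in> carrier G" and e: "0 < e" for y e
  proof -
    \<comment> \<open>Varying the translate by at most \<open>d\<close> changes the integral by at
      most \<open>d * I g\<close>; the added \<open>1\<close> guards against
      \<open>I g = 0\<close>.\<close>
    define d where "d = e / (I g + 1)"
    have d: "0 < d" "d * I g < e" using e I_nonneg[OF g] by (auto simp: d_def field_simps)
    obtain V where V: "openin T V" "\<one> \<in> V"
        "\<And>s v. \<lbrakk>s \<in> carrier G; v \<in> V\<rbrakk> \<Longrightarrow> \<bar>?g' (s \<otimes> v) - ?g' s\<bar> < d"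
      using cc_cone_uniformly_continuous[OF cc_cone_inv[OF g] d(1)] by blast
    define U where "U = {x \<in> topspace T. inv y \<otimes> x \<in> V}"
    have "openin T U" unfolding U_def
      by (rule openin_continuous_map_preimage[OF continuous_map_translation]) (use y V(1) in auto)
    moreover have "y \<in> U" using y V(2) by (simp add: U_def topspace_eq)
    moreover have "\<bar>autocorrelation g x - autocorrelation g y\<bar> < e" if "x \<in> U" for x
    proof -
      have x: "x \<in> carrier G" "inv y \<otimes> x \<in> V" using that by (auto simp: U_def topspace_eq)
      have near: "\<bar>shift x g z - shift y g z\<bar> \<le> d" for z
      proof (cases "z \<in> carrier G")
        case True
        have "inv z \<otimes> y \<otimes> (inv y \<otimes> x) = inv z \<otimes> x" using x y True
          by (metis inv_closed inv_solve_left m_assoc m_closed)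
        then have "\<bar>?g' (inv z \<otimes> x) - ?g' (inv z \<otimes> y)\<bar> < d"
          using V(3)[of "inv z \<otimes> y" "inv y \<otimes> x"] x y True by simp
        then show ?thesis using x y True by (simp add: shift_def inv_mult_group)
      qed (use d in \<open>simp add: shift_def\<close>)
      have cc: "(\<lambda>z. g z * shift s g z) \<in> cc_cone" if "s \<in> carrier G" for s
        using shift_product_cc_cone[OF g that one_closed] by (simp add: shift_one[OF g])
      have le: "I (\<lambda>z. g z * shift s g z) \<le> I (\<lambda>z. g z * shift t g z) + d * I g"
        if st: "s \<in> carrier G" "t \<in> carrier G" and near: "\<And>z. shift s g z \<le> shift t g z + d" for s t
      proof -
        have "I (\<lambda>z. g z * shift s g z) \<le> I (\<lambda>z. g z * shift t g z + d * g z)"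
        proof (rule I_mono)
          show "g z * shift s g z \<le> g z * shift t g z + d * g z" for z
            using mult_left_mono[OF near cc_cone_nonneg[OF g]] by (simp add: algebra_simps)
        qed (use d st in \<open>auto intro!: cc cc_cone_add cc_cone_scale g\<close>)
        then show ?thesis using st d by (simp add: I_add I_scale cc cc_cone_scale g)
      qed
      have "shift x g z \<le> shift y g z + d" "shift y g z \<le> shift x g z + d" for z using near[of z] by auto
      then show ?thesis using le[OF x(1) y] le[OF y x(1)] x y d(2) by (simp add: autocorrelation_def)
    qed
    ultimately show ?thesis by (auto simp: dist_real_def abs_minus_commute intro!: exI[of _ U])
  qed
  then show ?thesis
    using Met_TC.continuous_map_to_metric[of T "autocorrelation g"] by (simp add: topspace_eq)
qed

end

lemma locally_compact_group_positive_definite: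
  assumes "locally_compact_group G T"
  obtains \<phi> :: "'a \<Rightarrow> complex" and K where "positive_definite G \<phi>" "continuous_map T euclidean \<phi>"
    "\<phi> \<one>\<^bsub>G\<^esub> \<noteq> 0" "compactin T K" "\<And>x. x \<notin> K \<Longrightarrow> \<phi> x = 0"
proof -
  have G: "topological_group G T" "Hausdorff_space T" "locally_compact_space T"
    using assms by (auto simp: locally_compact_group_def)
  interpret topological_group G T by (fact G(1))
  obtain g where "g \<in> bumps (carrier G)"
    using bumps_nonempty[OF G(2,3) openin_topspace] by (auto simp: topspace_eq)
  then have g: "g \<in> cc_cone" "0 < g \<one>\<^bsub>G\<^esub>" by (auto simp: bumps_def)
  \<comment> \<open>Normalizing at the square of \<open>g\<close> makes the autocorrelation of
    \<open>g\<close> equal to \<open>1\<close> at the unit.\<close>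
  interpret haar G T "\<lambda>x. g x * g x"
    using G g by unfold_locales (auto intro!: cc_cone_mult cc_cone_continuous cc_cone_nonneg)
  obtain I where "invariant_functional G T I" and I: "I (\<lambda>x. g x * g x) = 1"
    by (rule invariant_functional)
  interpret invariant_functional G T I by fact
  obtain K where K: "compactin T K" "\<And>x. x \<notin> K \<Longrightarrow> autocorrelation g x = 0"
    using autocorrelation_support[OF g(1)] by blast
  have "continuous_map T euclidean (complex_of_real \<circ> autocorrelation g)"
    by (rule continuous_map_compose[OF continuous_autocorrelation[OF g(1)]])
      (simp add: continuous_on_of_real)
  moreover have "autocorrelation g \<one>\<^bsub>G\<^esub> = 1" using I by (simp add: autocorrelation_def shift_one[OF g(1)])
  ultimately show ?thesis
    using positive_definite_autocorrelation[OF g(1)] K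
    by (intro that[of "\<lambda>x. complex_of_real (autocorrelation g x)" K]) (auto simp: o_def)
qed

section \<open>The Hilbert space of a positive definite kernel\<close>

lemma null_sandwich:
  fixes a b :: "nat \<Rightarrow> real"
  assumes "\<And>n. 0 \<le> a n" "\<And>n. a n \<le> b n" "b \<longlonglongrightarrow> 0"
  shows "a \<longlonglongrightarrow> 0"
  using assms by (intro tendsto_sandwich[OF _ _ tendsto_const assms(3)]) auto

text \<open>The argument behind Cauchy-Schwarz, stated without an inner product so that it serves
  both the possibly degenerate \<open>form\<close> of a kernel and abstract Hilbert spaces. The
  hypothesis is tested at real multiples of \<open>z\<close>.\<close>

lemma discriminant_bound:
  fixes z :: complex
  assumes B: "0 \<le> B" and nonneg: "\<And>t. 0 \<le> A + 2 * Re (cnj t * z) + (cmod t)\<^sup>2 * B"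
  shows "(cmod z)\<^sup>2 \<le> A * B"
proof -
  define u where "u = (cmod z)\<^sup>2"
  have *: "0 \<le> A - 2 * s * u + s\<^sup>2 * u * B" for s :: real
  proof -
    have "z * cnj z = of_real u" by (simp only: u_def complex_norm_square)
    then have eq: "cnj (- of_real s * z) * z = - of_real (s * u)" by (simp add: mult.commute)
    show ?thesis
      using nonneg[of "- of_real s * z"] unfolding eq by (simp add: norm_mult power_mult_distrib u_def)
  qed
  show ?thesis
  proof (cases "B = 0")
    case False
    with *[of "1 / B"] B have "0 \<le> A - u / B" by (simp add: power2_eq_square field_simps)
    then show ?thesis using False B by (simp add: u_def field_simps)
  next
    case True
    have "u = 0"
    proof (rule ccontr)
      assume "u \<noteq> 0"
      \<comment> \<open>For \<open>B = 0\<close> the tested expression is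
        \<open>A - 2 * s * u\<close>, and this choice of \<open>s\<close> makes it
        \<open>- 1\<close>.\<close>
      then show False using *[of "(A + 1) / (2 * u)"] True by simp
    qed
    then show ?thesis using True by (simp add: u_def)
  qed
qed

definition cscale :: "complex \<Rightarrow> ('a \<Rightarrow> complex) \<Rightarrow> 'a \<Rightarrow> complex" where
  "cscale a g = (\<lambda>x. a * g x)"

lemma cscale_apply [simp]: "cscale a g x = a * g x"
  by (simp add: cscale_def)

lemma cscale_simps:
  "cscale a (g + h) = cscale a g + cscale a h" "cscale (a + b) g = cscale a g + cscale b g"
  "cscale (a * b) g = cscale a (cscale b g)" "cscale 1 g = g" "cscale (- 1) g = - g"
  "cscale a (g - h) = cscale a g - cscale a h" "cscale 0 g = 0"
  by (auto simp: fun_eq_iff algebra_simps)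

text \<open>A list of pairs \<open>(c, x)\<close> stands for the finite linear combination of the point masses at \<open>x\<close>
  with coefficients \<open>c\<close>; \<open>ev g l\<close> is conjugate linear in \<open>l\<close>.\<close>

locale positive_definite_kernel =
  fixes X :: "'a set" and k :: "'a \<Rightarrow> 'a \<Rightarrow> complex"
  assumes hermitian: "\<lbrakk>x \<in> X; y \<in> X\<rbrakk> \<Longrightarrow> k y x = cnj (k x y)"
    and positive: "l \<in> lists (UNIV \<times> X) \<Longrightarrow>
      0 \<le> Re (\<Sum>(d, y)\<leftarrow>l. \<Sum>(c, x)\<leftarrow>l. c * cnj d * k x y)"
begin

section \<open>Combinations of point masses and the dual norm\<close>

definition coeffs :: "(complex \<times> 'a) list set" where
  "coeffs = lists (UNIV \<times> X)"

definition ev :: "('a \<Rightarrow> complex) \<Rightarrow> (complex \<times> 'a) list \<Rightarrow> complex" where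
  "ev g l = (\<Sum>(d, y)\<leftarrow>l. cnj d * g y)"

definition ksum :: "(complex \<times> 'a) list \<Rightarrow> 'a \<Rightarrow> complex" where
  "ksum l = (\<lambda>y. if y \<in> X then \<Sum>(c, x)\<leftarrow>l. c * k x y else 0)"

text \<open>A semi-inner product on combinations of point masses. By Cauchy-Schwarz,
  \<open>q l = 0\<close> forces \<open>ksum l = 0\<close> for \<open>l\<close> in
  \<open>coeffs\<close>, so passing from lists to the functions \<open>ksum l\<close> takes the
  quotient by the null vectors.\<close>

definition form :: "(complex \<times> 'a) list \<Rightarrow> (complex \<times> 'a) list \<Rightarrow> complex" where
  "form l m = ev (ksum l) m"

definition q :: "(complex \<times> 'a) list \<Rightarrow> real" where
  "q l = Re (form l l)"

definition lscale :: "complex \<Rightarrow> (complex \<times> 'a) list \<Rightarrow> (complex \<times> 'a) list" where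
  "lscale a = map (\<lambda>(c, x). (a * c, x))"

lemma coeffs_simps [simp]:
  "[] \<in> coeffs" "(c, x) # l \<in> coeffs \<longleftrightarrow> x \<in> X \<and> l \<in> coeffs"
  "l @ m \<in> coeffs \<longleftrightarrow> l \<in> coeffs \<and> m \<in> coeffs"
  by (auto simp: coeffs_def)

lemma lscale_simps [simp]: "lscale a [] = []" "lscale a ((c, x) # l) = (a * c, x) # lscale a l"
  by (simp_all add: lscale_def)

lemma lscale_coeffs [simp]: "l \<in> coeffs \<Longrightarrow> lscale a l \<in> coeffs"
  by (induction l) auto

lemma ev_simps [simp]:
  "ev g [] = 0" "ev g ((d, y) # l) = cnj d * g y + ev g l" "ev g (l @ m) = ev g l + ev g m"
  "ev g (lscale a l) = cnj a * ev g l" "ev (g + h) l = ev g l + ev h l"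
  "ev (g - h) l = ev g l - ev h l" "ev (cscale a g) l = a * ev g l" "ev 0 l = 0"
proof -
  show "ev g (lscale a l) = cnj a * ev g l" "ev (g + h) l = ev g l + ev h l"
    "ev (g - h) l = ev g l - ev h l" "ev (cscale a g) l = a * ev g l" "ev 0 l = 0"
    by (induction l) (auto simp: ev_def algebra_simps)
qed (simp_all add: ev_def)

lemma ksum_outside: "y \<notin> X \<Longrightarrow> ksum l y = 0"
  by (simp add: ksum_def)

lemma ksum_simps:
  "ksum (l @ m) = ksum l + ksum m" "ksum (lscale a l) = cscale a (ksum l)"
  "ksum [] = 0"
proof -
  have "(\<Sum>(c, x)\<leftarrow>lscale a l. c * k x y) = a * (\<Sum>(c, x)\<leftarrow>l. c * k x y)" for y
    by (induction l) (auto simp: algebra_simps)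
  then show "ksum (lscale a l) = cscale a (ksum l)" by (auto simp: ksum_def)
qed (auto simp: ksum_def fun_eq_iff)

lemma ksum_Cons: "ksum ((c, x) # l) = cscale c (ksum [(1, x)]) + ksum l"
  by (auto simp: ksum_def fun_eq_iff)

lemma form_simps [simp]:
  "form (l @ l') m = form l m + form l' m" "form (lscale a l) m = a * form l m"
  "form l (m @ m') = form l m + form l m'" "form l (lscale a m) = cnj a * form l m"
  by (simp_all add: form_def ksum_simps)

lemma form_singleton: "y \<in> X \<Longrightarrow> form [(c, x)] [(d, y)] = cnj d * c * k x y"
  by (simp add: form_def ksum_def)

lemma form_hermitian:
  assumes "l \<in> coeffs" "m \<in> coeffs" shows "form m l = cnj (form l m)"
  using assms
proof (induction l)
  case Nil
  show ?case by (simp add: form_def ksum_simps)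
next
  case (Cons p l)
  obtain c x where p: "p = (c, x)" by (cases p)
  have x: "x \<in> X" using Cons.prems by (auto simp: p)
  have "form m [(c, x)] = cnj (form [(c, x)] m)" using Cons.prems(2)
  proof (induction m)
    case Nil
    show ?case by (simp add: form_def ksum_simps)
  next
    case (Cons p' m)
    obtain d y where p': "p' = (d, y)" by (cases p')
    have y: "y \<in> X" using Cons.prems by (auto simp: p')
    have "form ([(d, y)] @ m) [(c, x)] = cnj (form [(c, x)] ([(d, y)] @ m))"
      unfolding form_simps using Cons x y by (simp add: form_singleton hermitian[of x y] p')
    then show ?case by (simp add: p')
  qed
  then have "form m ([(c, x)] @ l) = cnj (form ([(c, x)] @ l) m)"
    unfolding form_simps using Cons by (simp add: p)
  then show ?case by (simp add: p)
qed

lemma q_nonneg: "l \<in> coeffs \<Longrightarrow> 0 \<le> q l"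
proof -
  assume l: "l \<in> coeffs"
  have "form l l = (\<Sum>(d, y)\<leftarrow>l. \<Sum>(c, x)\<leftarrow>l. c * cnj d * k x y)"
    unfolding form_def ev_def ksum_def using l
    by (auto simp: lists_eq_set coeffs_def case_prod_beta' mult_ac simp flip: sum_list_const_mult
        intro!: arg_cong[where f = sum_list] map_cong)
  then show ?thesis using positive[of l] l by (simp add: q_def coeffs_def)
qed

lemma q_add_scale:
  assumes "l \<in> coeffs" "m \<in> coeffs"
  shows "q (l @ lscale a m) = q l + 2 * Re (cnj a * form l m) + (cmod a)\<^sup>2 * q m"
proof -
  have "form m l = cnj (form l m)" using assms by (rule form_hermitian)
  then have "form (l @ lscale a m) (l @ lscale a m)
      = form l l + (cnj a * form l m + cnj (cnj a * form l m)) + (a * cnj a) * form m m"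
    by (simp add: algebra_simps)
  then show ?thesis
    by (simp only: q_def complex_add_cnj) (simp add: q_def flip: complex_norm_square)
qed

lemma form_cauchy_schwarz:
  assumes "l \<in> coeffs" "m \<in> coeffs"
  shows "cmod (form l m) \<le> sqrt (q l) * sqrt (q m)"
proof -
  have "(cmod (form l m))\<^sup>2 \<le> q l * q m"
  proof (rule discriminant_bound[OF q_nonneg[OF assms(2)]])
    fix t
    show "0 \<le> q l + 2 * Re (cnj t * form l m) + (cmod t)\<^sup>2 * q m"
      using q_nonneg[of "l @ lscale t m"] assms by (simp add: q_add_scale)
  qed
  then show ?thesis by (metis norm_ge_zero real_le_rsqrt real_sqrt_mult)
qed

text \<open>A function is regarded as the functional \<open>ev g\<close> on lists with the seminorm
  \<open>sqrt (q l)\<close>, and \<open>nrm\<close> is its dual norm. Phrasing it through bounds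
  rather than a supremum of quotients also forces \<open>ev g\<close> to vanish where
  \<open>q\<close> does.\<close>

definition bounded_by :: "('a \<Rightarrow> complex) \<Rightarrow> real \<Rightarrow> bool" where
  "bounded_by g M \<longleftrightarrow> 0 \<le> M \<and> (\<forall>l\<in>coeffs. cmod (ev g l) \<le> M * sqrt (q l))"

definition bdd :: "('a \<Rightarrow> complex) \<Rightarrow> bool" where
  "bdd g \<longleftrightarrow> (\<exists>M. bounded_by g M)"

definition nrm :: "('a \<Rightarrow> complex) \<Rightarrow> real" where
  "nrm g = Inf {M. bounded_by g M}"

lemma nrm_le: "bounded_by g M \<Longrightarrow> nrm g \<le> M"
  unfolding nrm_def by (rule cInf_lower) (auto simp: bounded_by_def intro: bdd_belowI[of _ 0])

lemma nrm_greatest: "\<lbrakk>bdd g; \<And>M. bounded_by g M \<Longrightarrow> a \<le> M\<rbrakk> \<Longrightarrow> a \<le> nrm g"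
  unfolding nrm_def by (rule cInf_greatest) (auto simp: bdd_def)

lemma nrm_nonneg: "bdd g \<Longrightarrow> 0 \<le> nrm g"
  by (rule nrm_greatest) (auto simp: bounded_by_def)

lemma bounded_by_nrm: "bdd g \<Longrightarrow> bounded_by g (nrm g)"
  unfolding bounded_by_def[of g "nrm g"]
proof (intro conjI ballI)
  fix l assume g: "bdd g" and l: "l \<in> coeffs"
  show "cmod (ev g l) \<le> nrm g * sqrt (q l)"
  proof (cases "q l = 0")
    case True
    then show ?thesis using g l by (auto simp: bdd_def bounded_by_def)
  next
    case False
    then have pos: "0 < sqrt (q l)" using q_nonneg[OF l] by simp
    have "cmod (ev g l) / sqrt (q l) \<le> nrm g"
      by (rule nrm_greatest[OF g]) (use l pos in \<open>auto simp: bounded_by_def field_simps\<close>)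
    then show ?thesis using pos by (simp add: field_simps)
  qed
qed (rule nrm_nonneg)

lemma bounded_by_add: "\<lbrakk>bounded_by g M; bounded_by h N\<rbrakk> \<Longrightarrow> bounded_by (g + h) (M + N)"
  unfolding bounded_by_def by (auto simp: algebra_simps intro!: order_trans[OF norm_triangle_ineq] add_mono)

lemma bounded_by_cscale: "bounded_by g M \<Longrightarrow> bounded_by (cscale a g) (cmod a * M)"
  unfolding bounded_by_def by (auto simp: norm_mult mult.assoc intro: mult_left_mono)

lemma bounded_by_ksum: "l \<in> coeffs \<Longrightarrow> bounded_by (ksum l) (sqrt (q l))"
  unfolding bounded_by_def using form_cauchy_schwarz q_nonneg by (auto simp: form_def)

lemma bdd_add: "\<lbrakk>bdd g; bdd h\<rbrakk> \<Longrightarrow> bdd (g + h)"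
  unfolding bdd_def using bounded_by_add by blast

lemma bdd_cscale: "bdd g \<Longrightarrow> bdd (cscale a g)"
  unfolding bdd_def using bounded_by_cscale by blast

lemma bdd_diff: "\<lbrakk>bdd g; bdd h\<rbrakk> \<Longrightarrow> bdd (g - h)"
  using bdd_add[of g "cscale (- 1) h"] bdd_cscale[of h "- 1"] by (simp add: cscale_simps)

lemma bdd_ksum: "l \<in> coeffs \<Longrightarrow> bdd (ksum l)"
  unfolding bdd_def using bounded_by_ksum by blast

lemma nrm_add: "\<lbrakk>bdd g; bdd h\<rbrakk> \<Longrightarrow> nrm (g + h) \<le> nrm g + nrm h"
  by (intro nrm_le bounded_by_add bounded_by_nrm)

lemma nrm_cscale_le: "bdd g \<Longrightarrow> nrm (cscale a g) \<le> cmod a * nrm g"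
  by (intro nrm_le bounded_by_cscale bounded_by_nrm)

lemma nrm_minus: "bdd g \<Longrightarrow> nrm (- g) = nrm g"
  using nrm_cscale_le[of g "- 1"] nrm_cscale_le[of "- g" "- 1"] bdd_cscale[of g "- 1"]
  by (simp add: cscale_simps)

lemma nrm_commute: "\<lbrakk>bdd g; bdd h\<rbrakk> \<Longrightarrow> nrm (g - h) = nrm (h - g)"
  using nrm_minus[of "g - h"] bdd_diff by simp

lemma nrm_triangle: "\<lbrakk>bdd f; bdd g; bdd h\<rbrakk> \<Longrightarrow> nrm (f - h) \<le> nrm (f - g) + nrm (g - h)"
  using nrm_add[of "f - g" "g - h"] bdd_diff by simp

lemma nrm_diff_abs: "\<lbrakk>bdd g; bdd h\<rbrakk> \<Longrightarrow> \<bar>nrm g - nrm h\<bar> \<le> nrm (g - h)"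
  using nrm_add[of "g - h" h] nrm_add[of "h - g" g] nrm_commute[of g h] bdd_diff by fastforce

text \<open>Cauchy-Schwarz gives the upper bound; testing the functional on \<open>l\<close> itself
  shows that it is attained.\<close>

lemma nrm_ksum: "l \<in> coeffs \<Longrightarrow> nrm (ksum l) = sqrt (q l)"
proof (rule antisym)
  assume l: "l \<in> coeffs"
  show "nrm (ksum l) \<le> sqrt (q l)" by (rule nrm_le[OF bounded_by_ksum[OF l]])
  have "q l \<le> nrm (ksum l) * sqrt (q l)"
    using bounded_by_nrm[OF bdd_ksum[OF l]] l complex_Re_le_cmod[of "form l l"]
    by (fastforce simp: bounded_by_def form_def q_def intro: order_trans)
  then have "sqrt (q l) * sqrt (q l) \<le> nrm (ksum l) * sqrt (q l)" using q_nonneg[OF l] by simp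
  then show "sqrt (q l) \<le> nrm (ksum l)"
    using nrm_nonneg[OF bdd_ksum[OF l]] q_nonneg[OF l] mult_right_le_imp_le[of "sqrt (q l)" "sqrt (q l)"]
    by (cases "q l = 0") auto
qed

text \<open>Testing on a single point mass bounds evaluation at \<open>x\<close>. Definiteness of
  the norm and the pointwise limits in the completeness proof depend on this.\<close>

lemma point_bound: "\<lbrakk>bdd g; x \<in> X\<rbrakk> \<Longrightarrow> cmod (g x) \<le> nrm g * sqrt (q [(1, x)])"
  using bounded_by_nrm[of g] by (auto simp: bounded_by_def dest!: bspec[of _ _ "[(1, x)]"])

text \<open>The completion of the span of the kernel functions is realized inside the functions on \<open>X\<close>
  that are bounded for the dual norm. The inner product is recovered from the norm by
  polarization, so that its laws extend from the span by continuity.\<close>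

definition rkhs :: "('a \<Rightarrow> complex) set" where
  "rkhs = {g. (\<forall>x. x \<notin> X \<longrightarrow> g x = 0) \<and> bdd g \<and> (\<forall>\<epsilon>>0. \<exists>l\<in>coeffs. nrm (g - ksum l) < \<epsilon>)}"

lemma rkhs_bdd: "g \<in> rkhs \<Longrightarrow> bdd g"
  by (simp add: rkhs_def)

lemma rkhs_approx: "\<lbrakk>g \<in> rkhs; 0 < \<epsilon>\<rbrakk> \<Longrightarrow> \<exists>l\<in>coeffs. nrm (g - ksum l) < \<epsilon>"
  by (simp add: rkhs_def)

lemma ksum_rkhs:
  assumes "l \<in> coeffs" shows "ksum l \<in> rkhs"
  unfolding rkhs_def
proof (intro CollectI conjI allI impI)
  fix \<epsilon> :: real assume "0 < \<epsilon>"
  then have "nrm (ksum l - ksum l) < \<epsilon>"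
    using nrm_ksum[of "[]"] by (simp add: q_def form_def ksum_simps)
  then show "\<exists>m\<in>coeffs. nrm (ksum l - ksum m) < \<epsilon>" using assms by blast
qed (use assms ksum_outside bdd_ksum in auto)

lemma rkhs_add:
  assumes g: "g \<in> rkhs" and h: "h \<in> rkhs" shows "g + h \<in> rkhs"
  unfolding rkhs_def
proof (intro CollectI conjI allI impI)
  fix \<epsilon> :: real assume e: "0 < \<epsilon>"
  obtain l m where l: "l \<in> coeffs" "nrm (g - ksum l) < \<epsilon> / 2"
    and m: "m \<in> coeffs" "nrm (h - ksum m) < \<epsilon> / 2"
    using rkhs_approx[OF g, of "\<epsilon> / 2"] rkhs_approx[OF h, of "\<epsilon> / 2"] e by auto
  have "nrm (g + h - ksum (l @ m)) = nrm ((g - ksum l) + (h - ksum m))"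
    by (simp add: ksum_simps algebra_simps)
  also have "\<dots> \<le> nrm (g - ksum l) + nrm (h - ksum m)"
    using l m g h by (intro nrm_add bdd_diff bdd_ksum rkhs_bdd)
  also have "\<dots> < \<epsilon>" using l m by simp
  finally show "\<exists>m\<in>coeffs. nrm (g + h - ksum m) < \<epsilon>" using l m by (intro bexI[of _ "l @ m"]) auto
qed (use g h bdd_add in \<open>auto simp: rkhs_def\<close>)

lemma rkhs_cscale:
  assumes g: "g \<in> rkhs" shows "cscale a g \<in> rkhs"
  unfolding rkhs_def
proof (intro CollectI conjI allI impI)
  fix \<epsilon> :: real assume e: "0 < \<epsilon>"
  obtain l where l: "l \<in> coeffs" "nrm (g - ksum l) < \<epsilon> / (cmod a + 1)"
    using rkhs_approx[OF g, of "\<epsilon> / (cmod a + 1)"] e by (auto simp: add_nonneg_pos)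
  have "nrm (cscale a g - ksum (lscale a l)) \<le> cmod a * nrm (g - ksum l)"
    using nrm_cscale_le[of "g - ksum l" a] l g
    by (simp add: ksum_simps cscale_simps bdd_diff bdd_ksum rkhs_bdd)
  also have "\<dots> \<le> (cmod a + 1) * nrm (g - ksum l)"
    using l g by (intro mult_right_mono nrm_nonneg bdd_diff bdd_ksum rkhs_bdd) auto
  also have "\<dots> < \<epsilon>" using l(2) by (simp add: pos_less_divide_eq add_nonneg_pos mult.commute)
  finally show "\<exists>m\<in>coeffs. nrm (cscale a g - ksum m) < \<epsilon>"
    using l by (intro bexI[of _ "lscale a l"]) auto
qed (use g bdd_cscale in \<open>auto simp: rkhs_def\<close>)

lemma rkhs_zero: "0 \<in> rkhs"
  using ksum_rkhs[of "[]"] by (simp add: ksum_simps)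

lemma rkhs_diff: "\<lbrakk>g \<in> rkhs; h \<in> rkhs\<rbrakk> \<Longrightarrow> g - h \<in> rkhs"
  using rkhs_add[of g "cscale (- 1) h"] rkhs_cscale[of h "- 1"] by (simp add: cscale_simps)

lemma nrm_eq_0: "g \<in> rkhs \<Longrightarrow> nrm g = 0 \<Longrightarrow> g = 0"
  using point_bound[of g] by (fastforce simp: rkhs_def fun_eq_iff)

definition ip :: "('a \<Rightarrow> complex) \<Rightarrow> ('a \<Rightarrow> complex) \<Rightarrow> complex" where
  "ip g h = (of_real ((nrm (g + h))\<^sup>2) - of_real ((nrm (g - h))\<^sup>2)
     + \<i> * of_real ((nrm (g + cscale \<i> h))\<^sup>2) - \<i> * of_real ((nrm (g - cscale \<i> h))\<^sup>2)) / 4"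

lemma nrm_ksum_combination:
  assumes "l \<in> coeffs" "m \<in> coeffs"
  shows "(nrm (ksum l + cscale a (ksum m)))\<^sup>2
    = q l + 2 * Re (cnj a * form l m) + (cmod a)\<^sup>2 * q m"
  using nrm_ksum[of "l @ lscale a m"] q_nonneg[of "l @ lscale a m"] assms
  by (simp add: ksum_simps q_add_scale)

lemma ip_ksum:
  assumes "l \<in> coeffs" "m \<in> coeffs"
  shows "ip (ksum l) (ksum m) = form l m"
proof -
  \<comment> \<open>Once all four terms have the shape \<open>g + cscale a h\<close>,
    \<open>nrm_ksum_combination\<close> evaluates each of them.\<close>
  have minus: "g - cscale a h = g + cscale (- a) h" for a and g h :: "'a \<Rightarrow> complex"
    by (simp add: fun_eq_iff)
  have "ip g h = (of_real ((nrm (g + cscale 1 h))\<^sup>2) - of_real ((nrm (g + cscale (- 1) h))\<^sup>2)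
     + \<i> * of_real ((nrm (g + cscale \<i> h))\<^sup>2) - \<i> * of_real ((nrm (g + cscale (- \<i>) h))\<^sup>2)) / 4" for g h
    unfolding ip_def minus by (simp add: cscale_simps)
  from this[of "ksum l" "ksum m"] show ?thesis
    unfolding nrm_ksum_combination[OF assms] by (simp add: complex_eq_iff)
qed

section \<open>Passage to limits and completeness\<close>

definition tends :: "(nat \<Rightarrow> 'a \<Rightarrow> complex) \<Rightarrow> ('a \<Rightarrow> complex) \<Rightarrow> bool" where
  "tends s g \<longleftrightarrow> (\<forall>n. bdd (s n)) \<and> bdd g \<and> (\<lambda>n. nrm (s n - g)) \<longlonglongrightarrow> 0"

lemma tends_nrm:
  assumes "tends s g" shows "(\<lambda>n. nrm (s n)) \<longlonglongrightarrow> nrm g"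
proof -
  have "(\<lambda>n. nrm (s n) - nrm g) \<longlonglongrightarrow> 0"
    by (rule tendsto_rabs_zero_cancel, rule null_sandwich[of _ "\<lambda>n. nrm (s n - g)"])
      (use assms nrm_diff_abs in \<open>auto simp: tends_def\<close>)
  then show ?thesis by (rule LIM_zero_cancel)
qed

lemma tends_add:
  assumes "tends s g" "tends t h" shows "tends (\<lambda>n. s n + t n) (g + h)"
  unfolding tends_def
proof (intro conjI allI)
  have b: "bdd (s n)" "bdd (t n)" "bdd g" "bdd h" for n using assms by (auto simp: tends_def)
  then show "bdd (s n + t n)" "bdd (g + h)" for n by (auto intro: bdd_add)
  have le: "nrm (s n + t n - (g + h)) \<le> nrm (s n - g) + nrm (t n - h)" for n
    using nrm_add[of "s n - g" "t n - h"] b by (simp add: bdd_diff algebra_simps)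
  have "(\<lambda>n. nrm (s n - g) + nrm (t n - h)) \<longlonglongrightarrow> 0 + 0"
    using assms by (intro tendsto_add) (auto simp: tends_def)
  then show "(\<lambda>n. nrm (s n + t n - (g + h))) \<longlonglongrightarrow> 0"
    by (intro null_sandwich[OF _ le] nrm_nonneg bdd_diff bdd_add b) simp
qed

lemma tends_cscale:
  assumes "tends s g" shows "tends (\<lambda>n. cscale a (s n)) (cscale a g)"
  unfolding tends_def
proof (intro conjI allI)
  have b: "bdd (s n)" "bdd g" for n using assms by (auto simp: tends_def)
  then show "bdd (cscale a (s n))" "bdd (cscale a g)" for n by (auto intro: bdd_cscale)
  have le: "nrm (cscale a (s n) - cscale a g) \<le> cmod a * nrm (s n - g)" for n
    using nrm_cscale_le[of "s n - g" a] b by (simp add: bdd_diff cscale_simps)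
  have "(\<lambda>n. cmod a * nrm (s n - g)) \<longlonglongrightarrow> cmod a * 0"
    using assms by (intro tendsto_intros) (auto simp: tends_def)
  then show "(\<lambda>n. nrm (cscale a (s n) - cscale a g)) \<longlonglongrightarrow> 0"
    by (intro null_sandwich[OF _ le] nrm_nonneg bdd_diff bdd_cscale b) simp
qed

lemma tends_diff:
  assumes "tends s g" "tends t h" shows "tends (\<lambda>n. s n - t n) (g - h)"
  using tends_add[OF assms(1) tends_cscale[OF assms(2), of "- 1"]] by (simp add: cscale_simps)

text \<open>\<open>ip\<close> is composed of norms of linear combinations, so its continuity is that
  of the norm. Identities that hold for \<open>form\<close> on the span thereby extend to
  \<open>rkhs\<close>.\<close>

lemma tends_ip:
  assumes "tends s g" "tends t h" shows "(\<lambda>n. ip (s n) (t n)) \<longlonglongrightarrow> ip g h"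
  unfolding ip_def
  by (intro tendsto_intros tends_nrm tends_add tends_diff tends_cscale assms) simp

lemma rkhs_sequence:
  assumes g: "g \<in> rkhs"
  obtains s where "\<And>n. s n \<in> coeffs" "tends (\<lambda>n. ksum (s n)) g"
proof -
  have "\<exists>l. l \<in> coeffs \<and> nrm (g - ksum l) < inverse (real (Suc n))" for n
    using rkhs_approx[OF g, of "inverse (real (Suc n))"] by auto
  then obtain s where s: "\<And>n. s n \<in> coeffs" "\<And>n. nrm (g - ksum (s n)) < inverse (real (Suc n))"
    by metis
  have "(\<lambda>n. nrm (ksum (s n) - g)) \<longlonglongrightarrow> 0"
    by (rule null_sandwich[OF _ _ LIMSEQ_inverse_real_of_nat])
      (use s g in \<open>auto intro!: less_imp_le nrm_nonneg bdd_diff bdd_ksum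
          simp: rkhs_bdd nrm_commute bdd_ksum\<close>)
  then have "tends (\<lambda>n. ksum (s n)) g" using s(1) g by (simp add: tends_def bdd_ksum rkhs_bdd)
  with s(1) show ?thesis by (rule that)
qed

lemma ip_add_left:
  assumes "f \<in> rkhs" "g \<in> rkhs" "h \<in> rkhs" shows "ip (f + g) h = ip f h + ip g h"
proof -
  obtain r where r: "\<And>n. r n \<in> coeffs" "tends (\<lambda>n. ksum (r n)) f" using rkhs_sequence[OF assms(1)] by blast
  obtain s where s: "\<And>n. s n \<in> coeffs" "tends (\<lambda>n. ksum (s n)) g" using rkhs_sequence[OF assms(2)] by blast
  obtain t where t: "\<And>n. t n \<in> coeffs" "tends (\<lambda>n. ksum (t n)) h" using rkhs_sequence[OF assms(3)] by blast
  have eq: "ip (ksum (r n) + ksum (s n)) (ksum (t n))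
      = ip (ksum (r n)) (ksum (t n)) + ip (ksum (s n)) (ksum (t n))" for n
    using ip_ksum[of "r n @ s n" "t n"] r s t by (simp add: ksum_simps ip_ksum)
  then show ?thesis
    using LIMSEQ_unique[OF tends_ip[OF tends_add[OF r(2) s(2)] t(2)]
        tendsto_add[OF tends_ip[OF r(2) t(2)] tends_ip[OF s(2) t(2)], folded eq]] by simp
qed

lemma ip_cscale_left:
  assumes "g \<in> rkhs" "h \<in> rkhs" shows "ip (cscale a g) h = a * ip g h"
proof -
  obtain s where s: "\<And>n. s n \<in> coeffs" "tends (\<lambda>n. ksum (s n)) g" using rkhs_sequence[OF assms(1)] by blast
  obtain t where t: "\<And>n. t n \<in> coeffs" "tends (\<lambda>n. ksum (t n)) h" using rkhs_sequence[OF assms(2)] by blast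
  have eq: "ip (cscale a (ksum (s n))) (ksum (t n)) = a * ip (ksum (s n)) (ksum (t n))" for n
    using ip_ksum[of "lscale a (s n)" "t n"] s t by (simp add: ksum_simps ip_ksum)
  then show ?thesis
    using LIMSEQ_unique[OF tends_ip[OF tends_cscale[OF s(2)] t(2)]
        tendsto_mult_left[OF tends_ip[OF s(2) t(2)], of a, folded eq]] by simp
qed

lemma ip_hermitian:
  assumes "g \<in> rkhs" "h \<in> rkhs" shows "ip g h = cnj (ip h g)"
proof -
  obtain s where s: "\<And>n. s n \<in> coeffs" "tends (\<lambda>n. ksum (s n)) g" using rkhs_sequence[OF assms(1)] by blast
  obtain t where t: "\<And>n. t n \<in> coeffs" "tends (\<lambda>n. ksum (t n)) h" using rkhs_sequence[OF assms(2)] by blast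
  have eq: "ip (ksum (s n)) (ksum (t n)) = cnj (ip (ksum (t n)) (ksum (s n)))" for n
    using s t form_hermitian[of "t n" "s n"] by (simp add: ip_ksum)
  then show ?thesis
    using LIMSEQ_unique[OF tends_ip[OF s(2) t(2)] tendsto_cnj[OF tends_ip[OF t(2) s(2)], folded eq]] by simp
qed

lemma ip_self: "g \<in> rkhs \<Longrightarrow> Re (ip g g) = (nrm g)\<^sup>2"
proof -
  assume g: "g \<in> rkhs"
  obtain s where s: "\<And>n. s n \<in> coeffs" "tends (\<lambda>n. ksum (s n)) g" using rkhs_sequence[OF g] by blast
  have eq: "Re (ip (ksum (s n)) (ksum (s n))) = (nrm (ksum (s n)))\<^sup>2" for n
    using s q_nonneg by (simp add: ip_ksum nrm_ksum q_def)
  then show ?thesis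
    using LIMSEQ_unique[OF tendsto_Re[OF tends_ip[OF s(2) s(2)]] tendsto_power[OF tends_nrm[OF s(2)], of 2, folded eq]]
    by simp
qed

text \<open>The limit is taken pointwise. Since \<open>ev\<close> at a fixed list involves finitely
  many points, the bound on \<open>s n - s m\<close> passes to the limit in \<open>m\<close> list by
  list, which turns pointwise convergence into convergence in the dual norm.\<close>

lemma rkhs_complete:
  assumes s: "\<And>n. s n \<in> rkhs" and cauchy: "\<And>\<epsilon>. 0 < \<epsilon> \<Longrightarrow> \<exists>N. \<forall>m\<ge>N. \<forall>n\<ge>N. nrm (s m - s n) < \<epsilon>"
  obtains g where "g \<in> rkhs" "(\<lambda>n. nrm (s n - g)) \<longlonglongrightarrow> 0"
proof -
  have b: "bdd (s n)" for n using s by (rule rkhs_bdd)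
  have "Cauchy (\<lambda>n. s n x)" if x: "x \<in> X" for x
  proof (rule CauchyI)
    fix e :: real assume e: "0 < e"
    \<comment> \<open>The added \<open>1\<close> keeps the divisor positive when the point mass at
      \<open>x\<close> is a null vector.\<close>
    let ?c = "sqrt (q [(1, x)]) + 1"
    have c: "0 < ?c" using q_nonneg[of "[(1, x)]"] x by (simp add: add_nonneg_pos)
    obtain N where N: "\<And>m n. \<lbrakk>N \<le> m; N \<le> n\<rbrakk> \<Longrightarrow> nrm (s m - s n) < e / ?c"
      using cauchy[of "e / ?c"] e c by (metis divide_pos_pos)
    have "cmod (s m x - s n x) < e" if "N \<le> m" "N \<le> n" for m n
    proof -
      have "cmod (s m x - s n x) \<le> nrm (s m - s n) * sqrt (q [(1, x)])"
        using point_bound[OF bdd_diff[OF b b] x, of m n] by simp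
      also have "\<dots> \<le> nrm (s m - s n) * ?c" by (intro mult_left_mono nrm_nonneg bdd_diff b) simp
      also have "\<dots> < e" using N[OF that] c by (simp add: field_simps)
      finally show ?thesis .
    qed
    then show "\<exists>M. \<forall>m\<ge>M. \<forall>n\<ge>M. norm (s m x - s n x) < e" by blast
  qed
  then have "\<exists>z. (\<lambda>n. s n x) \<longlonglongrightarrow> z" if "x \<in> X" for x
    using that Cauchy_convergent convergent_def by blast
  then obtain g' where g': "\<And>x. x \<in> X \<Longrightarrow> (\<lambda>n. s n x) \<longlonglongrightarrow> g' x" by metis
  define g where "g x = (if x \<in> X then g' x else 0)" for x
  have lim: "(\<lambda>n. ev (s n) l) \<longlonglongrightarrow> ev g l" if "l \<in> coeffs" for l
    using that
  proof (induction l)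
    case (Cons p l)
    then show ?case by (cases p) (auto simp: g_def intro!: tendsto_intros g')
  qed simp
  have near: "\<exists>N. \<forall>n\<ge>N. bounded_by (s n - g) \<epsilon>" if e: "0 < \<epsilon>" for \<epsilon>
  proof -
    obtain N where N: "\<And>m n. \<lbrakk>N \<le> m; N \<le> n\<rbrakk> \<Longrightarrow> nrm (s m - s n) < \<epsilon>"
      using cauchy[OF e] by blast
    have "cmod (ev (s n - g) l) \<le> \<epsilon> * sqrt (q l)" if n: "N \<le> n" and l: "l \<in> coeffs" for n l
    proof (rule LIMSEQ_le_const2)
      show "(\<lambda>m. cmod (ev (s n - s m) l)) \<longlonglongrightarrow> cmod (ev (s n - g) l)"
        unfolding ev_simps by (intro tendsto_intros lim l)
      have "cmod (ev (s n - s m) l) \<le> \<epsilon> * sqrt (q l)" if "N \<le> m" for m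
      proof -
        have "cmod (ev (s n - s m) l) \<le> nrm (s n - s m) * sqrt (q l)"
          using bounded_by_nrm[OF bdd_diff[OF b b]] l by (auto simp: bounded_by_def)
        also have "\<dots> \<le> \<epsilon> * sqrt (q l)"
          using N[OF n that] q_nonneg[OF l] by (intro mult_right_mono) auto
        finally show ?thesis .
      qed
      then show "\<exists>M. \<forall>m\<ge>M. cmod (ev (s n - s m) l) \<le> \<epsilon> * sqrt (q l)" by blast
    qed
    then show ?thesis using e by (auto simp: bounded_by_def)
  qed
  obtain n where "bounded_by (s n - g) 1" using near[of 1] by auto
  then have "bdd (s n - g)" by (auto simp: bdd_def)
  from bdd_diff[OF b this, of n] have bg: "bdd g" by simp
  have conv: "\<exists>N. \<forall>n\<ge>N. nrm (s n - g) \<le> \<epsilon>" if "0 < \<epsilon>" for \<epsilon>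
    using near[OF that] nrm_le by blast
  have "g \<in> rkhs" unfolding rkhs_def
  proof (intro CollectI conjI allI impI)
    fix \<epsilon> :: real assume e: "0 < \<epsilon>"
    obtain n where n: "nrm (s n - g) \<le> \<epsilon> / 2" using conv[of "\<epsilon> / 2"] e by auto
    obtain l where l: "l \<in> coeffs" "nrm (s n - ksum l) < \<epsilon> / 2" using rkhs_approx[OF s, of "\<epsilon> / 2"] e by auto
    have "nrm (g - ksum l) \<le> nrm (g - s n) + nrm (s n - ksum l)"
      using bg b l by (intro nrm_triangle bdd_ksum)
    also have "\<dots> < \<epsilon>" using n l nrm_commute[OF bg b] by simp
    finally show "\<exists>l\<in>coeffs. nrm (g - ksum l) < \<epsilon>" using l by blast
  qed (use bg in \<open>auto simp: g_def\<close>)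
  moreover have "(\<lambda>n. nrm (s n - g)) \<longlonglongrightarrow> 0"
  proof (rule LIMSEQ_I)
    fix r :: real assume r: "0 < r"
    obtain N where N: "\<And>n. N \<le> n \<Longrightarrow> nrm (s n - g) \<le> r / 2" using conv[of "r / 2"] r by auto
    have "norm (nrm (s n - g) - 0) < r" if "N \<le> n" for n
      using N[OF that] nrm_nonneg[OF bdd_diff[OF b bg], of n] r by simp
    then show "\<exists>N. \<forall>n\<ge>N. norm (nrm (s n - g) - 0) < r" by blast
  qed
  ultimately show ?thesis by (rule that)
qed

definition kernel_space :: "('a \<Rightarrow> complex) inner_module" where
  "kernel_space = \<lparr>carrier = rkhs, monoid.mult = (\<lambda>g h. g), one = 0, ring.zero = 0, add = (+),
     smult = cscale, inner_prod = ip\<rparr>"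

lemma kernel_space_simps [simp]:
  "carrier kernel_space = rkhs" "\<zero>\<^bsub>kernel_space\<^esub> = 0" "g \<oplus>\<^bsub>kernel_space\<^esub> h = g + h"
  "c \<odot>\<^bsub>kernel_space\<^esub> g = cscale c g" "inner_prod kernel_space = ip"
  by (simp_all add: kernel_space_def)

lemma abelian_group_kernel_space: "abelian_group kernel_space"
proof (rule abelian_groupI)
  fix g assume "g \<in> carrier kernel_space"
  then show "\<exists>h\<in>carrier kernel_space. h \<oplus>\<^bsub>kernel_space\<^esub> g = \<zero>\<^bsub>kernel_space\<^esub>"
    using rkhs_cscale[of g "- 1"] by (intro bexI[of _ "- g"]) (auto simp: cscale_simps)
qed (auto simp: rkhs_add rkhs_zero add_ac)

lemma minus_kernel_space:
  assumes "g \<in> rkhs" "h \<in> rkhs" shows "g \<ominus>\<^bsub>kernel_space\<^esub> h = g - h"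
proof -
  interpret abelian_group kernel_space by (rule abelian_group_kernel_space)
  have "\<ominus>\<^bsub>kernel_space\<^esub> h = - h"
    by (rule minus_equality) (use assms rkhs_cscale[of h "- 1"] in \<open>auto simp: cscale_simps\<close>)
  then show ?thesis by (simp add: a_minus_def)
qed

lemma vec_norm_kernel_space: "g \<in> rkhs \<Longrightarrow> vec_norm kernel_space g = nrm g"
  using nrm_nonneg[OF rkhs_bdd] by (simp add: vec_norm_def ip_self)

lemma vec_dist_kernel_space:
  "vec_dist kernel_space g h = (if g \<in> rkhs \<and> h \<in> rkhs then nrm (g - h) else 0)"
  by (simp add: vec_dist_def minus_kernel_space vec_norm_kernel_space rkhs_diff)

lemma Metric_space_kernel_space: "Metric_space rkhs (vec_dist kernel_space)"
proof
  show "0 \<le> vec_dist kernel_space g h" for g h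
    by (simp add: vec_dist_kernel_space nrm_nonneg bdd_diff rkhs_bdd)
  show "vec_dist kernel_space g h = vec_dist kernel_space h g" for g h
    by (simp add: vec_dist_kernel_space nrm_commute rkhs_bdd)
  show "vec_dist kernel_space g h = 0 \<longleftrightarrow> g = h" if "g \<in> rkhs" "h \<in> rkhs" for g h
    using that nrm_eq_0[OF rkhs_diff[OF that]] nrm_ksum[of "[]"]
    by (auto simp: vec_dist_kernel_space ksum_simps q_def form_def)
  show "vec_dist kernel_space f h \<le> vec_dist kernel_space f g + vec_dist kernel_space g h"
    if "f \<in> rkhs" "g \<in> rkhs" "h \<in> rkhs" for f g h
    using that by (simp add: vec_dist_kernel_space nrm_triangle rkhs_bdd)
qed

lemma hilbert_space_kernel_space: "hilbert_space kernel_space"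
proof -
  have "cring complex_ring"
  proof (intro cringI abelian_groupI comm_monoidI)
    fix x assume "x \<in> carrier complex_ring"
    show "\<exists>y\<in>carrier complex_ring. y \<oplus>\<^bsub>complex_ring\<^esub> x = \<zero>\<^bsub>complex_ring\<^esub>"
      by (rule bexI[of _ "- x"]) (auto simp: complex_ring_def)
  qed (auto simp: complex_ring_def algebra_simps)
  then have "Module.module complex_ring kernel_space"
    by (rule moduleI[OF _ abelian_group_kernel_space])
      (auto simp: complex_ring_def rkhs_cscale cscale_simps)
  moreover have "Metric_space.mcomplete rkhs (vec_dist kernel_space)"
  proof -
    interpret M: Metric_space rkhs "vec_dist kernel_space" by (rule Metric_space_kernel_space)
    show ?thesis unfolding M.mcomplete_def
    proof (intro allI impI)
      fix s assume s: "M.MCauchy s"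
      then have r: "s n \<in> rkhs" for n by (auto simp: M.MCauchy_def)
      have "\<exists>N. \<forall>m\<ge>N. \<forall>n\<ge>N. nrm (s m - s n) < e" if "0 < e" for e
        using s that r by (fastforce simp: M.MCauchy_def vec_dist_kernel_space)
      then obtain g where g: "g \<in> rkhs" "(\<lambda>n. nrm (s n - g)) \<longlonglongrightarrow> 0"
        using rkhs_complete[of s] r by blast
      then have "limitin M.mtopology s g sequentially"
        by (simp add: M.limitin_metric_dist_null vec_dist_kernel_space r)
      then show "\<exists>g. limitin M.mtopology s g sequentially" by blast
    qed
  qed
  ultimately show ?thesis
    unfolding hilbert_space_def hilbert_space_axioms_def
  proof (intro conjI allI impI)
    fix g assume "g \<in> carrier kernel_space" "g \<noteq> \<zero>\<^bsub>kernel_space\<^esub>"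
    then have "0 < nrm g" using nrm_nonneg[OF rkhs_bdd] nrm_eq_0 by (force simp: less_le)
    then show "0 < Re (inner_prod kernel_space g g)"
      using \<open>g \<in> carrier kernel_space\<close> by (simp add: ip_self)
  next
    fix g h assume "g \<in> carrier kernel_space" "h \<in> carrier kernel_space"
    then show "inner_prod kernel_space g h = cnj (inner_prod kernel_space h g)"
      unfolding kernel_space_simps by (rule ip_hermitian)
  qed (auto simp: ip_add_left ip_cscale_left)
qed

end

section \<open>The unitary representation of a positive definite function\<close>

text \<open>The GNS construction: \<open>\<phi> (inv y \<otimes> x)\<close> does not change when
  \<open>x\<close> and \<open>y\<close> are multiplied on the left by the same element, so left
  translation acts isometrically on the kernel space.\<close>

locale positive_definite_group = topological_group +
  fixes \<phi> :: "'a \<Rightarrow> complex"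
  assumes positive_definite: "positive_definite G \<phi>" and continuous: "continuous_map T euclidean \<phi>"
begin

sublocale positive_definite_kernel "carrier G" "\<lambda>x y. \<phi> (inv y \<otimes> x)"
proof
  fix x y assume xy: "x \<in> carrier G" "y \<in> carrier G"
  have "\<phi> (inv (inv y \<otimes> x)) = cnj (\<phi> (inv y \<otimes> x))"
    using positive_definite xy by (auto simp: positive_definite_def)
  then show "\<phi> (inv x \<otimes> y) = cnj (\<phi> (inv y \<otimes> x))"
    using xy by (simp add: inv_mult_group)
qed (use positive_definite in \<open>auto simp: positive_definite_def\<close>)

definition translate :: "'a \<Rightarrow> ('a \<Rightarrow> complex) \<Rightarrow> 'a \<Rightarrow> complex" where
  "translate s g = (\<lambda>x. if x \<in> carrier G then g (inv s \<otimes> x) else 0)"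

text \<open>The action on point masses that corresponds to \<open>translate\<close> under
  \<open>ksum\<close>. On the list argument of \<open>ev\<close> the inverse element acts, as for an
  adjoint.\<close>

definition ltranslate :: "'a \<Rightarrow> (complex \<times> 'a) list \<Rightarrow> (complex \<times> 'a) list" where
  "ltranslate s = map (\<lambda>(c, x). (c, s \<otimes> x))"

lemma ltranslate_simps [simp]:
  "ltranslate s [] = []" "ltranslate s ((c, x) # l) = (c, s \<otimes> x) # ltranslate s l"
  by (simp_all add: ltranslate_def)

lemma ltranslate_coeffs [simp]: "\<lbrakk>s \<in> carrier G; l \<in> coeffs\<rbrakk> \<Longrightarrow> ltranslate s l \<in> coeffs"
  by (induction l) auto

lemma ltranslate_inv: "\<lbrakk>s \<in> carrier G; l \<in> coeffs\<rbrakk> \<Longrightarrow> ltranslate (inv s) (ltranslate s l) = l"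
  by (induction l) (auto simp flip: m_assoc)

lemma translate_simps:
  "translate s (g + h) = translate s g + translate s h" "translate s (g - h) = translate s g - translate s h"
  "translate s (cscale a g) = cscale a (translate s g)"
  by (auto simp: translate_def fun_eq_iff)

lemma translate_translate:
  "\<lbrakk>s \<in> carrier G; t \<in> carrier G\<rbrakk> \<Longrightarrow> translate s (translate t g) = translate (s \<otimes> t) g"
  by (auto simp: translate_def inv_mult_group m_assoc)

lemma rkhs_outside: "\<lbrakk>g \<in> rkhs; x \<notin> carrier G\<rbrakk> \<Longrightarrow> g x = 0"
  by (simp add: rkhs_def)

lemma translate_one: "g \<in> rkhs \<Longrightarrow> translate \<one> g = g"
  by (auto simp: translate_def rkhs_outside)

lemma translate_ksum:
  assumes "s \<in> carrier G" "l \<in> coeffs"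
  shows "translate s (ksum l) = ksum (ltranslate s l)"
  using assms(2)
proof (induction l)
  case Nil
  show ?case by (auto simp: translate_def ksum_simps)
next
  case (Cons p l)
  obtain c x where p: "p = (c, x)" by (cases p)
  have x: "x \<in> carrier G" "l \<in> coeffs" using Cons.prems by (auto simp: p)
  have "translate s (ksum [(1, x)]) = ksum [(1, s \<otimes> x)]"
    using assms(1) x by (auto simp: translate_def ksum_def inv_mult_group m_assoc)
  then show ?case unfolding p ltranslate_simps ksum_Cons[of c] translate_simps
    using Cons.IH x by simp
qed

lemma ev_translate:
  "\<lbrakk>s \<in> carrier G; l \<in> coeffs\<rbrakk> \<Longrightarrow> ev (translate s g) l = ev g (ltranslate (inv s) l)"
  by (induction l) (auto simp: translate_def)

lemma form_ltranslate:
  assumes "s \<in> carrier G" "l \<in> coeffs" "m \<in> coeffs"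
  shows "form (ltranslate s l) (ltranslate s m) = form l m"
  using assms by (simp add: form_def ev_translate ltranslate_inv flip: translate_ksum)

text \<open>Translating the function amounts to translating the test list back, and \<open>q\<close>
  is invariant under translation of lists.\<close>

lemma bounded_by_translate:
  assumes "s \<in> carrier G" "bounded_by g M" shows "bounded_by (translate s g) M"
  unfolding bounded_by_def
proof (intro conjI ballI)
  show "0 \<le> M" using assms(2) by (simp add: bounded_by_def)
  fix l assume l: "l \<in> coeffs"
  have "cmod (ev g (ltranslate (inv s) l)) \<le> M * sqrt (q (ltranslate (inv s) l))"
    using assms l by (simp add: bounded_by_def)
  then show "cmod (ev (translate s g) l) \<le> M * sqrt (q l)"
    using assms(1) l by (simp add: ev_translate q_def form_ltranslate)
qed

lemma bdd_translate: "\<lbrakk>s \<in> carrier G; bdd g\<rbrakk> \<Longrightarrow> bdd (translate s g)"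
  unfolding bdd_def using bounded_by_translate by blast

lemma nrm_translate_le: "\<lbrakk>s \<in> carrier G; bdd g\<rbrakk> \<Longrightarrow> nrm (translate s g) \<le> nrm g"
  by (intro nrm_le bounded_by_translate bounded_by_nrm)

lemma translate_rkhs:
  assumes s: "s \<in> carrier G" and g: "g \<in> rkhs" shows "translate s g \<in> rkhs"
  unfolding rkhs_def
proof (intro CollectI conjI allI impI)
  show "bdd (translate s g)" using s g by (intro bdd_translate rkhs_bdd)
  fix \<epsilon> :: real assume e: "0 < \<epsilon>"
  obtain l where l: "l \<in> coeffs" "nrm (g - ksum l) < \<epsilon>" using rkhs_approx[OF g e] by blast
  have "nrm (translate s g - ksum (ltranslate s l)) = nrm (translate s (g - ksum l))"
    using s l by (simp add: translate_simps translate_ksum)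
  also have "\<dots> \<le> nrm (g - ksum l)" using s g l by (intro nrm_translate_le bdd_diff rkhs_bdd bdd_ksum)
  finally show "\<exists>m\<in>coeffs. nrm (translate s g - ksum m) < \<epsilon>"
    using l s by (intro bexI[of _ "ltranslate s l"]) auto
qed (simp add: translate_def)

lemma translate_inv:
  "\<lbrakk>s \<in> carrier G; g \<in> rkhs\<rbrakk> \<Longrightarrow> translate (inv s) (translate s g) = g"
  "\<lbrakk>s \<in> carrier G; g \<in> rkhs\<rbrakk> \<Longrightarrow> translate s (translate (inv s) g) = g"
  by (simp_all add: translate_translate translate_one)

lemma nrm_translate: "\<lbrakk>s \<in> carrier G; g \<in> rkhs\<rbrakk> \<Longrightarrow> nrm (translate s g) = nrm g"
  using nrm_translate_le[of s g] nrm_translate_le[of "inv s" "translate s g"]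
  by (simp add: rkhs_bdd bdd_translate translate_inv)

text \<open>By polarization, invariance of the norm is all that has to be checked.\<close>

lemma ip_translate:
  assumes "s \<in> carrier G" "g \<in> rkhs" "h \<in> rkhs"
  shows "ip (translate s g) (translate s h) = ip g h"
  using assms unfolding ip_def translate_simps[symmetric]
  by (simp add: nrm_translate rkhs_add rkhs_diff rkhs_cscale)

text \<open>Strong continuity of the representation at one vector, isolated as a predicate so that
  it can be verified on kernel functions, then on their span, then on limits.\<close>

definition continuous_orbit :: "('a \<Rightarrow> complex) \<Rightarrow> bool" where
  "continuous_orbit g \<longleftrightarrow> (\<forall>y\<in>carrier G. \<forall>\<epsilon>>0. \<exists>U. openin T U \<and> y \<in> U \<and>
     (\<forall>x\<in>U. nrm (translate x g - translate y g) < \<epsilon>))"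

lemma continuous_orbit_point:
  assumes z: "z \<in> carrier G" shows "continuous_orbit (ksum [(1, z)])"
  unfolding continuous_orbit_def
proof (intro ballI allI impI)
  fix y and \<epsilon> :: real assume y: "y \<in> carrier G" and e: "0 < \<epsilon>"
  define r where "r x = Re (\<phi> (inv (y \<otimes> z) \<otimes> (x \<otimes> z)))" for x
  have c: "continuous_map T T (\<lambda>x. inv (y \<otimes> z) \<otimes> (x \<otimes> z))"
    by (intro continuous_map_group_mult) (use y z in \<open>auto simp: topspace_eq\<close>)
  have "continuous_map euclidean euclideanreal Re" by (simp add: continuous_on_Re)
  from continuous_map_compose[OF continuous_map_compose[OF c continuous] this]
  have r: "continuous_map T euclideanreal r" by (simp add: r_def[abs_def] o_def)
  \<comment> \<open>The square of the norm to be estimated is \<open>2 * (r y - r x)\<close>, where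
    \<open>r y\<close> is the real part of \<open>\<phi>\<close> at the unit. Hence the threshold
    \<open>\<epsilon>\<^sup>2 / 2\<close>.\<close>
  define U where "U = {x \<in> topspace T. r x \<in> {r y - \<epsilon>\<^sup>2 / 2<..}}"
  have "openin T U" unfolding U_def by (rule openin_continuous_map_preimage[OF r]) simp
  moreover have "y \<in> U" using y e by (simp add: U_def topspace_eq)
  moreover have "nrm (translate x (ksum [(1, z)]) - translate y (ksum [(1, z)])) < \<epsilon>" if "x \<in> U" for x
  proof -
    have x: "x \<in> carrier G" "r y - r x < \<epsilon>\<^sup>2 / 2" using that by (auto simp: U_def topspace_eq)
    have diff: "translate x (ksum [(1, z)]) - translate y (ksum [(1, z)])
        = ksum [(1, x \<otimes> z)] + cscale (- 1) (ksum [(1, y \<otimes> z)])"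
      using x y z by (simp add: translate_ksum cscale_simps)
    have "(nrm (translate x (ksum [(1, z)]) - translate y (ksum [(1, z)])))\<^sup>2 = 2 * (r y - r x)"
      unfolding diff using x y z
      by (subst nrm_ksum_combination) (auto simp: q_def form_singleton r_def)
    also have "\<dots> < \<epsilon>\<^sup>2" using x by simp
    finally show ?thesis using e by (simp add: power2_less_imp_less)
  qed
  ultimately show "\<exists>U. openin T U \<and> y \<in> U \<and>
      (\<forall>x\<in>U. nrm (translate x (ksum [(1, z)]) - translate y (ksum [(1, z)])) < \<epsilon>)" by blast
qed

lemma continuous_orbit_add:
  assumes g: "g \<in> rkhs" "continuous_orbit g" and h: "h \<in> rkhs" "continuous_orbit h"
  shows "continuous_orbit (g + h)"
  unfolding continuous_orbit_def
proof (intro ballI allI impI)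
  fix y and \<epsilon> :: real assume y: "y \<in> carrier G" and e: "0 < \<epsilon>"
  obtain U where U: "openin T U" "y \<in> U" "\<And>x. x \<in> U \<Longrightarrow> nrm (translate x g - translate y g) < \<epsilon> / 2"
    using g(2) y e unfolding continuous_orbit_def by (metis half_gt_zero)
  obtain W where W: "openin T W" "y \<in> W" "\<And>x. x \<in> W \<Longrightarrow> nrm (translate x h - translate y h) < \<epsilon> / 2"
    using h(2) y e unfolding continuous_orbit_def by (metis half_gt_zero)
  have "nrm (translate x (g + h) - translate y (g + h)) < \<epsilon>" if x: "x \<in> U \<inter> W" for x
  proof -
    have xG: "x \<in> carrier G" using x openin_subset[OF U(1)] by (auto simp: topspace_eq)
    have "nrm (translate x (g + h) - translate y (g + h))
        = nrm ((translate x g - translate y g) + (translate x h - translate y h))"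
      by (simp add: translate_simps algebra_simps)
    also have "\<dots> \<le> nrm (translate x g - translate y g) + nrm (translate x h - translate y h)"
      using g h xG y by (intro nrm_add rkhs_bdd rkhs_diff translate_rkhs)
    also have "\<dots> < \<epsilon>" using U(3)[of x] W(3)[of x] x by simp
    finally show ?thesis .
  qed
  then show "\<exists>U. openin T U \<and> y \<in> U \<and> (\<forall>x\<in>U. nrm (translate x (g + h) - translate y (g + h)) < \<epsilon>)"
    using U W by (intro exI[of _ "U \<inter> W"]) auto
qed

lemma continuous_orbit_cscale:
  assumes g: "g \<in> rkhs" "continuous_orbit g" shows "continuous_orbit (cscale a g)"
  unfolding continuous_orbit_def
proof (intro ballI allI impI)
  fix y and \<epsilon> :: real assume y: "y \<in> carrier G" and e: "0 < \<epsilon>"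
  have c: "0 < cmod a + 1" by (simp add: add_nonneg_pos)
  obtain U where U: "openin T U" "y \<in> U"
      "\<And>x. x \<in> U \<Longrightarrow> nrm (translate x g - translate y g) < \<epsilon> / (cmod a + 1)"
    using g(2) y divide_pos_pos[OF e c] unfolding continuous_orbit_def by metis
  have "nrm (translate x (cscale a g) - translate y (cscale a g)) < \<epsilon>" if x: "x \<in> U" for x
  proof -
    have xG: "x \<in> carrier G" using x openin_subset[OF U(1)] by (auto simp: topspace_eq)
    have b: "bdd (translate x g - translate y g)"
      using g xG y by (intro rkhs_bdd rkhs_diff translate_rkhs)
    have "nrm (translate x (cscale a g) - translate y (cscale a g)) \<le> cmod a * nrm (translate x g - translate y g)"
      using nrm_cscale_le[OF b, of a] by (simp add: translate_simps cscale_simps)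
    also have "\<dots> \<le> (cmod a + 1) * nrm (translate x g - translate y g)"
      using nrm_nonneg[OF b] by (intro mult_right_mono) auto
    also have "\<dots> < \<epsilon>" using U(3)[OF x] c by (simp add: pos_less_divide_eq mult.commute)
    finally show ?thesis .
  qed
  then show "\<exists>U. openin T U \<and> y \<in> U \<and>
      (\<forall>x\<in>U. nrm (translate x (cscale a g) - translate y (cscale a g)) < \<epsilon>)"
    using U by blast
qed

lemma continuous_orbit_ksum: "l \<in> coeffs \<Longrightarrow> continuous_orbit (ksum l)"
proof (induction l)
  case Nil
  have "nrm 0 = 0" using nrm_ksum[of "[]"] by (simp add: ksum_simps q_def form_def)
  moreover have "translate x 0 = 0" for x by (auto simp: translate_def)
  ultimately show ?case unfolding continuous_orbit_def ksum_simps
    by (auto simp: topspace_eq intro!: exI[of _ "topspace T"])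
next
  case (Cons p l)
  obtain c x where p: "p = (c, x)" by (cases p)
  have x: "x \<in> carrier G" "l \<in> coeffs" using Cons.prems by (auto simp: p)
  then show ?case unfolding p ksum_Cons[of c]
    using Cons.IH by (intro continuous_orbit_add continuous_orbit_cscale continuous_orbit_point rkhs_cscale)
      (auto intro!: ksum_rkhs)
qed

text \<open>An \<open>\<epsilon> / 3\<close> argument: translations are isometric, so one
  approximation of \<open>g\<close> from the span serves for all of them.\<close>

lemma continuous_orbit_rkhs:
  assumes g: "g \<in> rkhs" shows "continuous_orbit g"
  unfolding continuous_orbit_def
proof (intro ballI allI impI)
  fix y and \<epsilon> :: real assume y: "y \<in> carrier G" and e: "0 < \<epsilon>"
  obtain l where l: "l \<in> coeffs" "nrm (g - ksum l) < \<epsilon> / 3" using rkhs_approx[OF g, of "\<epsilon> / 3"] e by auto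
  have k: "ksum l \<in> rkhs" using l by (intro ksum_rkhs)
  obtain U where U: "openin T U" "y \<in> U"
      "\<And>x. x \<in> U \<Longrightarrow> nrm (translate x (ksum l) - translate y (ksum l)) < \<epsilon> / 3"
    using continuous_orbit_ksum[OF l(1)] y e unfolding continuous_orbit_def
    by (metis divide_pos_pos zero_less_numeral)
  have "nrm (translate x g - translate y g) < \<epsilon>" if x: "x \<in> U" for x
  proof -
    have xG: "x \<in> carrier G" using x openin_subset[OF U(1)] by (auto simp: topspace_eq)
    have tr: "nrm (translate s g - translate s (ksum l)) < \<epsilon> / 3" if "s \<in> carrier G" for s
      using that l g k nrm_translate[of s "g - ksum l"] by (simp add: translate_simps rkhs_diff)
    note b = rkhs_bdd[OF translate_rkhs[OF _ g]] rkhs_bdd[OF translate_rkhs[OF _ k]]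
    have "nrm (translate x g - translate y g)
        \<le> nrm (translate x g - translate x (ksum l)) + nrm (translate x (ksum l) - translate y g)"
      using xG y by (intro nrm_triangle b)
    also have "nrm (translate x (ksum l) - translate y g)
        \<le> nrm (translate x (ksum l) - translate y (ksum l)) + nrm (translate y (ksum l) - translate y g)"
      using xG y by (intro nrm_triangle b)
    also have "nrm (translate y (ksum l) - translate y g) = nrm (translate y g - translate y (ksum l))"
      using y by (intro nrm_commute b)
    finally show ?thesis using tr[OF xG] tr[OF y] U(3)[OF x] by linarith
  qed
  then show "\<exists>U. openin T U \<and> y \<in> U \<and> (\<forall>x\<in>U. nrm (translate x g - translate y g) < \<epsilon>)"
    using U by blast
qed

lemma unitary_representation_translate: "unitary_representation G T kernel_space translate"
  unfolding unitary_representation_def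
proof (intro conjI ballI)
  show "hilbert_space kernel_space" by (rule hilbert_space_kernel_space)
  fix x assume x: "x \<in> carrier G"
  show "translate x \<in> unitary_operators kernel_space"
    unfolding unitary_operators_def
  proof (intro CollectI conjI ballI allI)
    show "bij_betw (translate x) (carrier kernel_space) (carrier kernel_space)"
      by (rule bij_betw_byWitness[of _ "translate (inv x)"])
        (use x in \<open>auto simp: translate_inv translate_rkhs\<close>)
  qed (use x in \<open>auto simp: translate_simps ip_translate\<close>)
next
  fix x y g assume "x \<in> carrier G" "y \<in> carrier G" "g \<in> carrier kernel_space"
  then show "translate (x \<otimes> y) g = translate x (translate y g)" by (simp add: translate_translate)
next
  fix g assume "g \<in> carrier kernel_space"
  then have g: "g \<in> rkhs" by simp
  interpret M: Metric_space rkhs "vec_dist kernel_space" by (rule Metric_space_kernel_space)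
  show "continuous_map T (Metric_space.mtopology (carrier kernel_space) (vec_dist kernel_space)) (\<lambda>x. translate x g)"
    unfolding kernel_space_simps M.continuous_map_to_metric
  proof (intro ballI allI impI)
    fix y and \<epsilon> :: real assume "y \<in> topspace T" "0 < \<epsilon>"
    then have y: "y \<in> carrier G" by (simp add: topspace_eq)
    obtain U where U: "openin T U" "y \<in> U" "\<And>x. x \<in> U \<Longrightarrow> nrm (translate x g - translate y g) < \<epsilon>"
      using continuous_orbit_rkhs[OF g] y \<open>0 < \<epsilon>\<close> unfolding continuous_orbit_def by metis
    have "translate x g \<in> M.mball (translate y g) \<epsilon>" if x: "x \<in> U" for x
    proof -
      have xG: "x \<in> carrier G" using x openin_subset[OF U(1)] by (auto simp: topspace_eq)
      note r = translate_rkhs[OF xG g] translate_rkhs[OF y g]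
      show ?thesis
        using U(3)[OF x] r nrm_commute[OF rkhs_bdd[OF r(1)] rkhs_bdd[OF r(2)]]
        by (simp add: vec_dist_kernel_space)
    qed
    then show "\<exists>U. openin T U \<and> y \<in> U \<and> (\<forall>x\<in>U. translate x g \<in> M.mball (translate y g) \<epsilon>)"
      using U by blast
  qed
qed

text \<open>The two vectors are the kernel functions at the unit and at \<open>z\<close>. Translates
  are included because the spine needs a function that is nonzero at a prescribed point, whereas
  \<open>\<phi>\<close> is controlled at the unit.\<close>

lemma translate_fourier_stieltjes:
  assumes z: "z \<in> carrier G"
  shows "on_group G (\<lambda>x. \<phi> (inv z \<otimes> x)) \<in> fourier_stieltjes G T"
proof -
  have "ip (translate x (ksum [(1, \<one>)])) (ksum [(1, z)]) = \<phi> (inv z \<otimes> x)" if "x \<in> carrier G" for x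
    using that z by (simp add: translate_ksum ip_ksum form_singleton)
  then have "on_group G (\<lambda>x. \<phi> (inv z \<otimes> x))
      = on_group G (\<lambda>x. inner_prod kernel_space (translate x (ksum [(1, \<one>)])) (ksum [(1, z)]))"
    by (auto simp: on_group_def)
  then have "coefficient_of G T (on_group G (\<lambda>x. \<phi> (inv z \<otimes> x))) kernel_space translate
      (ksum [(1, \<one>)]) (ksum [(1, z)])"
    using z unfolding coefficient_of_def
    by (auto intro!: unitary_representation_translate ksum_rkhs)
  then show ?thesis unfolding fourier_stieltjes_def by blast
qed

end

section \<open>Functions in the reduced spine\<close>

context hilbert_space
begin

lemma inner_zero_left: "\<xi> \<in> carrier V \<Longrightarrow> inner_prod V \<zero>\<^bsub>V\<^esub> \<xi> = 0"
  using inner_smult_left[of \<xi> \<xi> 0] smult_l_null[of \<xi>] by (simp add: complex_ring_def)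

lemma smult_carrier: "\<xi> \<in> carrier V \<Longrightarrow> c \<odot>\<^bsub>V\<^esub> \<xi> \<in> carrier V"
  by (rule smult_closed) (simp_all add: complex_ring_def)

lemma inner_nonneg: "\<xi> \<in> carrier V \<Longrightarrow> 0 \<le> Re (inner_prod V \<xi> \<xi>)"
  using inner_positive[of \<xi>] inner_zero_left[of \<xi>] by (cases "\<xi> = \<zero>\<^bsub>V\<^esub>") auto

lemma cauchy_schwarz:
  assumes x: "\<xi> \<in> carrier V" and z: "\<zeta> \<in> carrier V"
  shows "cmod (inner_prod V \<xi> \<zeta>) \<le> vec_norm V \<xi> * vec_norm V \<zeta>"
proof -
  let ?i = "inner_prod V"
  have "(cmod (?i \<xi> \<zeta>))\<^sup>2 \<le> Re (?i \<xi> \<xi>) * Re (?i \<zeta> \<zeta>)"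
  proof (rule discriminant_bound[OF inner_nonneg[OF z]])
    fix t
    define \<omega> where "\<omega> = \<xi> \<oplus>\<^bsub>V\<^esub> t \<odot>\<^bsub>V\<^esub> \<zeta>"
    have tz: "t \<odot>\<^bsub>V\<^esub> \<zeta> \<in> carrier V" using z by (rule smult_carrier)
    then have w: "\<omega> \<in> carrier V" using x by (simp add: \<omega>_def)
    have left: "?i \<omega> \<theta> = ?i \<xi> \<theta> + t * ?i \<zeta> \<theta>" if "\<theta> \<in> carrier V" for \<theta>
      using x z tz that by (simp add: \<omega>_def inner_add_left inner_smult_left)
    have right: "?i \<theta> \<omega> = ?i \<theta> \<xi> + cnj t * ?i \<theta> \<zeta>" if "\<theta> \<in> carrier V" for \<theta>
      using inner_commute[OF that w] inner_commute[OF that x] inner_commute[OF that z] left[OF that] by simp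
    have "?i \<omega> \<omega> = ?i \<xi> \<xi> + (cnj t * ?i \<xi> \<zeta> + cnj (cnj t * ?i \<xi> \<zeta>)) + (t * cnj t) * ?i \<zeta> \<zeta>"
      using left[OF w] right[OF x] right[OF z] inner_commute[OF z x] by (simp add: algebra_simps)
    then have "Re (?i \<omega> \<omega>) = Re (?i \<xi> \<xi>) + 2 * Re (cnj t * ?i \<xi> \<zeta>) + (cmod t)\<^sup>2 * Re (?i \<zeta> \<zeta>)"
      by (simp only: complex_add_cnj) (simp flip: complex_norm_square)
    then show "0 \<le> Re (?i \<xi> \<xi>) + 2 * Re (cnj t * ?i \<xi> \<zeta>) + (cmod t)\<^sup>2 * Re (?i \<zeta> \<zeta>)"
      using inner_nonneg[OF w] by simp
  qed
  then show ?thesis unfolding vec_norm_def by (metis norm_ge_zero real_le_rsqrt real_sqrt_mult)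
qed

end

text \<open>An infimum strictly below \<open>r\<close> singles out one representation of
  \<open>u\<close> as a coefficient with product of norms below \<open>r\<close>; unitarity and
  Cauchy-Schwarz bound every value by that product.\<close>

lemma fs_norm_bound:
  assumes "fs_norm G T u < ennreal r" and x: "x \<in> carrier G"
  shows "cmod (u x) < r"
proof -
  obtain V \<pi> \<xi> \<zeta> where c: "coefficient_of G T u V \<pi> \<xi> \<zeta>"
      and less: "ennreal (vec_norm V \<xi> * vec_norm V \<zeta>) < ennreal r"
    using assms(1) unfolding fs_norm_def Inf_less_iff by blast
  have u: "unitary_representation G T V \<pi>" "\<xi> \<in> carrier V" "\<zeta> \<in> carrier V"
      "u x = inner_prod V (\<pi> x \<xi>) \<zeta>"
    using c x by (auto simp: coefficient_of_def on_group_def)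
  interpret hilbert_space V using u(1) by (simp add: unitary_representation_def)
  have "\<pi> x \<in> unitary_operators V" using u(1) x by (simp add: unitary_representation_def)
  then have p: "\<pi> x \<xi> \<in> carrier V" "vec_norm V (\<pi> x \<xi>) = vec_norm V \<xi>"
    using u(2) by (auto simp: unitary_operators_def bij_betw_def vec_norm_def)
  have "0 \<le> vec_norm V \<xi> * vec_norm V \<zeta>"
    using u by (simp add: vec_norm_def inner_nonneg)
  then have "vec_norm V \<xi> * vec_norm V \<zeta> < r" using less by (simp add: ennreal_less_iff)
  then show ?thesis using cauchy_schwarz[OF p(1) u(3)] u(4) p(2) by simp
qed

text \<open>The hypothesis supplies a unitary representation; pairing one of its vectors with the
  zero vector represents the zero function at cost \<open>0\<close>.\<close>

lemma fs_norm_zero: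
  assumes "u \<in> fourier_stieltjes G T"
  shows "fs_norm G T (\<lambda>x. 0) = 0"
proof -
  obtain V \<pi> \<xi> \<zeta> where c: "coefficient_of G T u V \<pi> \<xi> \<zeta>"
    using assms by (auto simp: fourier_stieltjes_def)
  then have u: "unitary_representation G T V \<pi>" "\<xi> \<in> carrier V" by (auto simp: coefficient_of_def)
  interpret hilbert_space V using u(1) by (simp add: unitary_representation_def)
  have "inner_prod V (\<pi> x \<xi>) \<zero>\<^bsub>V\<^esub> = 0" if "x \<in> carrier G" for x
  proof -
    have "\<pi> x \<xi> \<in> carrier V"
      using u that unfolding unitary_representation_def unitary_operators_def bij_betw_def by blast
    then show ?thesis using inner_commute[of "\<pi> x \<xi>" "\<zero>\<^bsub>V\<^esub>"] inner_zero_left by simp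
  qed
  then have "coefficient_of G T (\<lambda>x. 0) V \<pi> \<xi> \<zero>\<^bsub>V\<^esub>"
    using u by (auto simp: coefficient_of_def on_group_def)
  moreover have "vec_norm V \<zero>\<^bsub>V\<^esub> = 0" by (simp add: vec_norm_def inner_zero_left)
  ultimately have "fs_norm G T (\<lambda>x. 0) \<le> 0"
    unfolding fs_norm_def by (intro Inf_lower CollectI) (metis ennreal_0 mult_zero_right)
  then show ?thesis by simp
qed

lemma fs_closure_superset:
  assumes "u \<in> A" "u \<in> fourier_stieltjes G T"
  shows "u \<in> fs_closure G T A"
  using assms fs_norm_zero[OF assms(2)] by (auto simp: fs_closure_def intro!: bexI[of _ u])

section \<open>A spine element that is nonzero at a given point\<close>

lemma positive_definite_compose:
  fixes G :: "('a, 'b) monoid_scheme"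
  assumes "Group.group G" "Group.group H" and h: "\<eta> \<in> hom G H" and \<phi>: "positive_definite H \<phi>"
  shows "positive_definite G (\<phi> \<circ> \<eta>)"
proof -
  interpret group_hom G H \<eta>
    using assms by (intro group_hom.intro group_hom_axioms.intro)
  show ?thesis unfolding positive_definite_def
  proof (intro conjI ballI)
    show "(\<phi> \<circ> \<eta>) (inv\<^bsub>G\<^esub> x) = cnj ((\<phi> \<circ> \<eta>) x)" if "x \<in> carrier G" for x
      using \<phi> that by (simp add: positive_definite_def)
    fix l :: "(complex \<times> 'a) list" assume l: "l \<in> lists (UNIV \<times> carrier G)"
    then have mem: "x \<in> carrier G" if "(c, x) \<in> set l" for c x using that by auto
    let ?l = "map (\<lambda>(c, x). (c :: complex, \<eta> x)) l"
    have "?l \<in> lists (UNIV \<times> carrier H)" using l by (auto simp: lists_eq_set)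
    then have "0 \<le> Re (\<Sum>(d, y)\<leftarrow>?l. \<Sum>(c, x)\<leftarrow>?l. c * cnj d * \<phi> (inv\<^bsub>H\<^esub> y \<otimes>\<^bsub>H\<^esub> x))"
      using \<phi> by (simp only: positive_definite_def)
    also have "(\<Sum>(d, y)\<leftarrow>?l. \<Sum>(c, x)\<leftarrow>?l. c * cnj d * \<phi> (inv\<^bsub>H\<^esub> y \<otimes>\<^bsub>H\<^esub> x))
        = (\<Sum>(d, y)\<leftarrow>l. \<Sum>(c, x)\<leftarrow>l. c * cnj d * (\<phi> \<circ> \<eta>) (inv\<^bsub>G\<^esub> y \<otimes>\<^bsub>G\<^esub> x))"
      using mem by (auto simp: o_def case_prod_beta' intro!: arg_cong[where f = sum_list] map_cong)
    finally show "0 \<le> Re (\<Sum>(d, y)\<leftarrow>l. \<Sum>(c, x)\<leftarrow>l. c * cnj d * (\<phi> \<circ> \<eta>) (inv\<^bsub>G\<^esub> y \<otimes>\<^bsub>G\<^esub> x))" .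
  qed
qed

text \<open>The witness comes from the topology \<open>T\<close> itself, through a completion
  \<open>H\<close> of the type that \<open>reduced_topologies\<close> admits. A compactly supported
  positive definite function on \<open>H\<close> is translated by \<open>\<eta> x\<close>, so that
  its value at the unit is taken at \<open>\<eta> x\<close>.\<close>

lemma reduced_spine_nonvanishing:
  fixes G :: "('a, 'b) monoid_scheme"
  assumes G: "locally_compact_group G T" and x: "x \<in> carrier G"
  obtains u where "u \<in> reduced_spine G T" "u x \<noteq> 0"
proof -
  have tg: "topological_group G T" "Hausdorff_space T" using G by (auto simp: locally_compact_group_def)
  interpret G: topological_group G T by (fact tg(1))
  have id: "id \<in> continuous_hom G T G T" by (auto simp: continuous_hom_def hom_def)
  have "pullback_topology (carrier G) id T = T"
    using openin_subset[of T] by (auto simp: topology_eq openin_pullback_topology G.topspace_eq Int_absorb2)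
  then obtain H :: "'a set set monoid" and S \<eta> where H: "lc_completion G T T H S \<eta>"
    using lc_completion_exists[OF tg(1) G id] by auto
  have lcH: "locally_compact_group H S" and \<eta>: "\<eta> \<in> hom G H" "continuous_map T S \<eta>"
      and T: "T = pullback_topology (carrier G) \<eta> S"
    using H by (auto simp: lc_completion_def continuous_hom_def)
  have tgH: "topological_group H S" "Hausdorff_space S" using lcH by (auto simp: locally_compact_group_def)
  interpret H: topological_group H S by (fact tgH(1))
  interpret \<eta>: group_hom G H \<eta>
    by (intro group_hom.intro group_hom_axioms.intro \<eta> G.group_axioms H.group_axioms)
  obtain \<phi> K where \<phi>: "positive_definite H \<phi>" "continuous_map S euclidean \<phi>" "\<phi> \<one>\<^bsub>H\<^esub> \<noteq> 0"
      and K: "compactin S K" "\<And>y. y \<notin> K \<Longrightarrow> \<phi> y = 0"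
    by (rule locally_compact_group_positive_definite[OF lcH]) blast
  interpret PH: positive_definite_group H S \<phi> by unfold_locales (fact \<phi>)+
  \<comment> \<open>\<open>PH\<close> places the translated function in B(H). The spine is a closure
    within B(G), so its pullback needs a representation of \<open>G\<close> too, obtained from
    \<open>\<phi> \<circ> \<eta>\<close>.\<close>
  interpret PG: positive_definite_group G T "\<phi> \<circ> \<eta>"
    by unfold_locales
      (use positive_definite_compose[OF G.group_axioms H.group_axioms \<eta>(1) \<phi>(1)]
        continuous_map_compose[OF \<eta>(2) \<phi>(2)] in auto)
  define w where "w = on_group H (\<lambda>y. \<phi> (inv\<^bsub>H\<^esub> \<eta> x \<otimes>\<^bsub>H\<^esub> y))"
  have hx: "\<eta> x \<in> carrier H" using x by simp
  have w_fs: "w \<in> fourier_stieltjes H S"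
    unfolding w_def by (rule PH.translate_fourier_stieltjes[OF hx])
  have "compactin S (S closure_of {y \<in> carrier H. w y \<noteq> 0})"
  proof (rule closed_compactin)
    show L: "compactin S ((\<lambda>y. \<eta> x \<otimes>\<^bsub>H\<^esub> y) ` K)" (is "compactin S ?L")
      by (rule image_compactin[OF K(1) H.continuous_map_translation[OF hx]])
    have "{y \<in> carrier H. w y \<noteq> 0} \<subseteq> ?L"
    proof clarify
      fix y assume y: "y \<in> carrier H" "w y \<noteq> 0"
      then have "inv\<^bsub>H\<^esub> \<eta> x \<otimes>\<^bsub>H\<^esub> y \<in> K" using K(2) by (auto simp: w_def on_group_def)
      moreover have "\<eta> x \<otimes>\<^bsub>H\<^esub> (inv\<^bsub>H\<^esub> \<eta> x \<otimes>\<^bsub>H\<^esub> y) = y" using hx y(1) by (simp flip: H.m_assoc)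
      ultimately show "y \<in> ?L" by (metis image_eqI)
    qed
    then show "S closure_of {y \<in> carrier H. w y \<noteq> 0} \<subseteq> ?L"
      using compactin_imp_closedin[OF tgH(2) L] by (rule closure_of_minimal)
  qed simp
  then have "w \<in> fourier_algebra H S"
    unfolding fourier_algebra_def by (intro fs_closure_superset) (auto simp: w_fs)
  then have pull: "on_group G (w \<circ> \<eta>) \<in> fourier_pullback G T T"
    using H unfolding fourier_pullback_def by blast
  have "on_group G (w \<circ> \<eta>) = on_group G (\<lambda>y. (\<phi> \<circ> \<eta>) (inv\<^bsub>G\<^esub> x \<otimes>\<^bsub>G\<^esub> y))"
    using x by (auto simp: on_group_def w_def)
  then have fs: "on_group G (w \<circ> \<eta>) \<in> fourier_stieltjes G T"
    using PG.translate_fourier_stieltjes[OF x] by simp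
  have "T \<in> reduced_topologies G T"
    unfolding reduced_topologies_def using tg(2) lcH H T by (auto simp: lc_completion_def)
  then have "on_group G (w \<circ> \<eta>) \<in> reduced_spine G T"
    unfolding reduced_spine_def using pull fs
    by (intro fs_closure_superset CollectI exI[of _ "{T}"] exI[of _ "\<lambda>_. on_group G (w \<circ> \<eta>)"]) auto
  moreover have "on_group G (w \<circ> \<eta>) x \<noteq> 0" using x \<phi>(3) by (simp add: on_group_def w_def)
  ultimately show ?thesis by (rule that)
qed

text \<open>Elements of A(H) vanish at infinity: a compactly supported \<open>v\<close> that
  approximates \<open>w\<close> in norm also does so uniformly, and \<open>w\<close> is small where
  \<open>v\<close> vanishes. The completion is part of the conclusion so that one can be chosen for
  each topology in the sum.\<close>

lemma fourier_pullback_small: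
  fixes G :: "('a, 'b) monoid_scheme"
  assumes u: "u \<in> fourier_pullback G T \<tau>" and e: "0 < (\<epsilon> :: real)"
  shows "\<exists>H S \<eta> K. lc_completion G T \<tau> (H :: 'a set set monoid) S \<eta> \<and> compactin S K \<and>
    (\<forall>x\<in>carrier G. \<eta> x \<notin> K \<longrightarrow> cmod (u x) < \<epsilon>)"
proof -
  obtain H :: "'a set set monoid" and S \<eta> w where H: "lc_completion G T \<tau> H S \<eta>"
      and w: "w \<in> fourier_algebra H S" "u = on_group G (w \<circ> \<eta>)"
    using u unfolding fourier_pullback_def by blast
  obtain v where v: "compactin S (S closure_of {y \<in> carrier H. v y \<noteq> 0})"
      "fs_norm H S (\<lambda>y. w y - v y) < ennreal \<epsilon>"
    using w(1) e unfolding fourier_algebra_def fs_closure_def by blast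
  have top: "topspace S = carrier H" and \<eta>: "\<And>x. x \<in> carrier G \<Longrightarrow> \<eta> x \<in> carrier H"
    using H by (auto simp: lc_completion_def locally_compact_group_def topological_group.topspace_eq
        continuous_hom_def hom_def)
  have "cmod (u x) < \<epsilon>" if x: "x \<in> carrier G" "\<eta> x \<notin> S closure_of {y \<in> carrier H. v y \<noteq> 0}" for x
  proof -
    have "{y \<in> carrier H. v y \<noteq> 0} \<subseteq> S closure_of {y \<in> carrier H. v y \<noteq> 0}"
      by (rule closure_of_subset) (auto simp: top)
    then have "v (\<eta> x) = 0" using x \<eta> by auto
    then show ?thesis using fs_norm_bound[OF v(2) \<eta>[OF x(1)]] x w(2) by (simp add: on_group_def)
  qed
  then show ?thesis using H v(1) by blast
qed

section \<open>Coverings by preimages of compact sets\<close>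

text \<open>As in Neumann's lemma on coverings by cosets: if \<open>x\<close> is not in \<open>A A\<inverse>\<close>, then \<open>x A\<close> is disjoint
  from \<open>A\<close>, hence covered by the other sets, and so \<open>A\<close> is covered by their translates.\<close>

lemma (in Group.group) covering_by_small_sets:
  assumes "finite F"
    and un: "\<And>i A B. \<lbrakk>i \<in> F; small i A; small i B\<rbrakk> \<Longrightarrow> small i (A \<union> B)"
    and trans: "\<And>i A x. \<lbrakk>i \<in> F; small i A; x \<in> carrier G\<rbrakk> \<Longrightarrow> small i ((\<lambda>a. x \<otimes> a) ` A)"
    and quot: "\<And>i A. \<lbrakk>i \<in> F; small i A; A \<subseteq> carrier G\<rbrakk> \<Longrightarrow> small i ((\<lambda>(a, b). a \<otimes> inv b) ` (A \<times> A))"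
    and small: "\<And>i. i \<in> F \<Longrightarrow> small i (A i) \<and> A i \<subseteq> carrier G"
    and cover: "carrier G \<subseteq> (\<Union>i\<in>F. A i)"
  shows "\<exists>i\<in>F. \<exists>B. small i B \<and> carrier G \<subseteq> B"
  using assms
proof (induction F arbitrary: A)
  case empty
  then show ?case using one_closed by auto
next
  case (insert j F)
  define D where "D = (\<lambda>(a, b). a \<otimes> inv b) ` (A j \<times> A j)"
  have Aj: "small j (A j)" "A j \<subseteq> carrier G" using insert.prems(4) by auto
  show ?case
  proof (cases "carrier G \<subseteq> D")
    case True
    moreover have "small j D" unfolding D_def using insert.prems(3)[of j] Aj by auto
    ultimately show ?thesis by blast
  next
    case False
    then obtain x where x: "x \<in> carrier G" "x \<notin> D" by blast
    \<comment> \<open>\<open>A i\<close> still covers the points outside \<open>A j\<close>. A point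
      \<open>g\<close> of \<open>A j\<close> satisfies \<open>x \<otimes> g \<notin> A j\<close>, so
      \<open>x \<otimes> g\<close> lies in one of the other sets and \<open>g\<close> in its
      translate by \<open>inv x\<close>.\<close>
    define A' where "A' i = A i \<union> (\<lambda>a. inv x \<otimes> a) ` A i" for i
    have A': "small i (A' i) \<and> A' i \<subseteq> carrier G" if i: "i \<in> F" for i
    proof -
      have Ai: "small i (A i)" "A i \<subseteq> carrier G" using insert.prems(4)[of i] i by auto
      then have "small i ((\<lambda>a. inv x \<otimes> a) ` A i)" using insert.prems(2)[of i "A i" "inv x"] i x by simp
      then show ?thesis using insert.prems(1)[of i "A i"] Ai i x by (auto simp: A'_def)
    qed
    have "g \<in> (\<Union>i\<in>F. A' i)" if g: "g \<in> carrier G" for g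
    proof (cases "g \<in> A j")
      case True
      have "x \<otimes> g \<notin> A j"
      proof
        assume "x \<otimes> g \<in> A j"
        then have "x \<otimes> g \<otimes> inv g \<in> D" using True unfolding D_def by (intro image_eqI[of _ _ "(x \<otimes> g, g)"]) auto
        then show False using x g by (simp add: m_assoc)
      qed
      moreover have "x \<otimes> g \<in> carrier G" using x g by simp
      then have "x \<otimes> g \<in> (\<Union>i\<in>insert j F. A i)" using insert.prems(5) by blast
      ultimately obtain i where i: "i \<in> F" "x \<otimes> g \<in> A i" by blast
      have "g = inv x \<otimes> (x \<otimes> g)" using x g by (simp flip: m_assoc)
      then have "g \<in> A' i" using i(2) by (auto simp: A'_def)
      then show ?thesis using i(1) by blast
    next
      case False
      then show ?thesis using insert.prems(5) g by (auto simp: A'_def)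
    qed
    then have "\<exists>i\<in>F. \<exists>B. small i B \<and> carrier G \<subseteq> B"
      using insert.prems(1,2,3) A' by (intro insert.IH[of A']) auto
    then show ?thesis by blast
  qed
qed

text \<open>A compact set containing the dense image is closed, hence all of \<open>H\<close>. So
  \<open>H\<close> is compact and \<open>(H, S, \<eta>)\<close> is itself an index of the Bohr
  product, where the coordinate of \<open>bohr_map\<close> is \<open>\<eta>\<close>.\<close>

lemma compact_completion_imp_maximally_almost_periodic:
  fixes G :: "('a, 'b) monoid_scheme" and H :: "'a set set monoid"
  assumes H: "lc_completion G T \<tau> H S \<eta>" and \<tau>: "Hausdorff_space \<tau>"
    and K: "compactin S K" "\<eta> ` carrier G \<subseteq> K"
  shows "maximally_almost_periodic G T"
proof -
  have S: "topological_group H S" "Hausdorff_space S" and \<eta>: "\<eta> \<in> continuous_hom G T H S"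
    and dense: "S closure_of (\<eta> ` carrier G) = carrier H" and \<tau>_eq: "\<tau> = pullback_topology (carrier G) \<eta> S"
    using H by (auto simp: lc_completion_def locally_compact_group_def)
  interpret H: topological_group H S by (fact S(1))
  have "carrier H \<subseteq> K"
    using closure_of_minimal[OF K(2) compactin_imp_closedin[OF S(2) K(1)]] dense by simp
  then have "K = topspace S" using compactin_subset_topspace[OF K(1)] H.topspace_eq by simp
  then have "compact_group H S" using K(1) S by (simp add: compact_group_def compact_space_def)
  then have i: "(H, S, \<eta>) \<in> compact_images G T" using \<eta> by (simp add: compact_images_def)
  have \<eta>_carrier: "\<eta> x \<in> topspace S" if "x \<in> carrier G" for x
    using \<eta> that H.topspace_eq by (auto simp: continuous_hom_def hom_def)
  then have top: "topspace \<tau> = carrier G" by (auto simp: \<tau>_eq topspace_pullback_topology)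
  \<comment> \<open>Points with the same image under \<open>\<eta>\<close> belong to the same open
    sets of the pullback topology, which is Hausdorff.\<close>
  have inj: "inj_on \<eta> (carrier G)"
  proof (rule inj_onI, rule ccontr)
    fix x y assume xy: "x \<in> carrier G" "y \<in> carrier G" "\<eta> x = \<eta> y" "x \<noteq> y"
    then obtain U V where UV: "openin \<tau> U" "openin \<tau> V" "x \<in> U" "y \<in> V" "disjnt U V"
      using \<tau> top unfolding Hausdorff_space_def by metis
    then obtain W where "U = \<eta> -` W \<inter> carrier G" by (auto simp: \<tau>_eq openin_pullback_topology)
    then have "y \<in> U" using UV(3) xy by auto
    then show False using UV(4,5) by (auto simp: disjnt_def)
  qed
  show ?thesis unfolding maximally_almost_periodic_def
  proof (rule inj_onI)
    fix x y assume xy: "x \<in> carrier G" "y \<in> carrier G" "bohr_map G T x = bohr_map G T y"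
    have "bohr_map G T z (H, S, \<eta>) = \<eta> z" for z using i by (simp add: bohr_map_def)
    then have "\<eta> x = \<eta> y" using xy(3) by metis
    then show "x = y" using inj xy by (simp add: inj_on_def)
  qed
qed

lemma maximally_almost_periodic_covering:
  fixes G :: "('a, 'b) monoid_scheme" and H :: "'a topology \<Rightarrow> 'a set set monoid"
  assumes G: "topological_group G T" and F: "finite F"
    and H: "\<And>\<tau>. \<tau> \<in> F \<Longrightarrow> lc_completion G T \<tau> (H \<tau>) (S \<tau>) (\<eta> \<tau>)"
    and haus: "\<And>\<tau>. \<tau> \<in> F \<Longrightarrow> Hausdorff_space \<tau>"
    and K: "\<And>\<tau>. \<tau> \<in> F \<Longrightarrow> compactin (S \<tau>) (K \<tau>)"
    and cover: "\<And>x. x \<in> carrier G \<Longrightarrow> \<exists>\<tau>\<in>F. \<eta> \<tau> x \<in> K \<tau>"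
  shows "maximally_almost_periodic G T"
proof -
  interpret G: topological_group G T by fact
  \<comment> \<open>Relative compactness of the image. The notion of compactness varies with
    \<open>\<tau>\<close>, hence the indexed predicate in the covering lemma. Translation and
    formation of quotients are continuous in each group, so they send compact sets to compact
    sets.\<close>
  define small where "small \<tau> B \<longleftrightarrow> B \<subseteq> carrier G \<and> (\<exists>K. compactin (S \<tau>) K \<and> \<eta> \<tau> ` B \<subseteq> K)" for \<tau> B
  have tg: "topological_group (H \<tau>) (S \<tau>)" and hom: "group_hom G (H \<tau>) (\<eta> \<tau>)" if "\<tau> \<in> F" for \<tau>
  proof -
    show tg: "topological_group (H \<tau>) (S \<tau>)"
      using H[OF that] by (simp add: lc_completion_def locally_compact_group_def)
    interpret topological_group "H \<tau>" "S \<tau>" by (fact tg)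
    show "group_hom G (H \<tau>) (\<eta> \<tau>)"
      using H[OF that] by (intro group_hom.intro group_hom_axioms.intro G.group_axioms group_axioms)
        (simp add: lc_completion_def continuous_hom_def)
  qed
  have "\<exists>\<tau>\<in>F. \<exists>B. small \<tau> B \<and> carrier G \<subseteq> B"
  proof (rule G.covering_by_small_sets[where A = "\<lambda>\<tau>. {x \<in> carrier G. \<eta> \<tau> x \<in> K \<tau>}"])
    fix \<tau> A B assume "small \<tau> A" "small \<tau> B"
    then obtain K L where "compactin (S \<tau>) K" "\<eta> \<tau> ` A \<subseteq> K" "compactin (S \<tau>) L" "\<eta> \<tau> ` B \<subseteq> L"
      "A \<subseteq> carrier G" "B \<subseteq> carrier G" by (auto simp: small_def)
    then show "small \<tau> (A \<union> B)"
      unfolding small_def by (intro conjI exI[of _ "K \<union> L"] compactin_Un) auto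
  next
    fix \<tau> A x assume t: "\<tau> \<in> F" "small \<tau> A" "x \<in> carrier G"
    interpret H: topological_group "H \<tau>" "S \<tau>" by (rule tg[OF t(1)])
    interpret group_hom G "H \<tau>" "\<eta> \<tau>" by (rule hom[OF t(1)])
    obtain K where K: "compactin (S \<tau>) K" "\<eta> \<tau> ` A \<subseteq> K" "A \<subseteq> carrier G" using t(2) by (auto simp: small_def)
    have "compactin (S \<tau>) ((\<lambda>y. \<eta> \<tau> x \<otimes>\<^bsub>H \<tau>\<^esub> y) ` K)"
      using t(3) by (intro image_compactin[OF K(1)] H.continuous_map_translation) simp
    moreover have "\<eta> \<tau> ` (\<lambda>a. x \<otimes>\<^bsub>G\<^esub> a) ` A \<subseteq> (\<lambda>y. \<eta> \<tau> x \<otimes>\<^bsub>H \<tau>\<^esub> y) ` K"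
      using K t(3) by (auto simp: subset_eq)
    ultimately show "small \<tau> ((\<lambda>a. x \<otimes>\<^bsub>G\<^esub> a) ` A)"
      unfolding small_def using K(3) t(3) by (intro conjI exI) auto
  next
    fix \<tau> A assume t: "\<tau> \<in> F" "small \<tau> A" "A \<subseteq> carrier G"
    interpret H: topological_group "H \<tau>" "S \<tau>" by (rule tg[OF t(1)])
    interpret group_hom G "H \<tau>" "\<eta> \<tau>" by (rule hom[OF t(1)])
    obtain K where K: "compactin (S \<tau>) K" "\<eta> \<tau> ` A \<subseteq> K" using t(2) by (auto simp: small_def)
    have "continuous_map (prod_topology (S \<tau>) (S \<tau>)) (S \<tau>) (\<lambda>p. fst p \<otimes>\<^bsub>H \<tau>\<^esub> inv\<^bsub>H \<tau>\<^esub> snd p)"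
      by (intro H.continuous_map_group_mult H.continuous_map_group_inv continuous_map_fst continuous_map_snd)
    then have "compactin (S \<tau>) ((\<lambda>p. fst p \<otimes>\<^bsub>H \<tau>\<^esub> inv\<^bsub>H \<tau>\<^esub> snd p) ` (K \<times> K))"
      using K(1) by (intro image_compactin[of "prod_topology (S \<tau>) (S \<tau>)"]) (auto simp: compactin_Times)
    moreover have "\<eta> \<tau> ` (\<lambda>(a, b). a \<otimes>\<^bsub>G\<^esub> inv\<^bsub>G\<^esub> b) ` (A \<times> A)
        \<subseteq> (\<lambda>p. fst p \<otimes>\<^bsub>H \<tau>\<^esub> inv\<^bsub>H \<tau>\<^esub> snd p) ` (K \<times> K)"
    proof clarify
      fix a b assume ab: "a \<in> A" "b \<in> A"
      then have "\<eta> \<tau> (a \<otimes>\<^bsub>G\<^esub> inv\<^bsub>G\<^esub> b) = \<eta> \<tau> a \<otimes>\<^bsub>H \<tau>\<^esub> inv\<^bsub>H \<tau>\<^esub> \<eta> \<tau> b"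
        using t(3) by (simp add: subset_eq)
      then show "\<eta> \<tau> (a \<otimes>\<^bsub>G\<^esub> inv\<^bsub>G\<^esub> b) \<in> (\<lambda>p. fst p \<otimes>\<^bsub>H \<tau>\<^esub> inv\<^bsub>H \<tau>\<^esub> snd p) ` (K \<times> K)"
        using ab K(2) by (intro image_eqI[of _ _ "(\<eta> \<tau> a, \<eta> \<tau> b)"]) auto
    qed
    ultimately show "small \<tau> ((\<lambda>(a, b). a \<otimes>\<^bsub>G\<^esub> inv\<^bsub>G\<^esub> b) ` (A \<times> A))"
      unfolding small_def using t(3) by (intro conjI exI) (auto simp: subset_eq)
  next
    fix \<tau> assume "\<tau> \<in> F"
    then show "small \<tau> {x \<in> carrier G. \<eta> \<tau> x \<in> K \<tau>} \<and> {x \<in> carrier G. \<eta> \<tau> x \<in> K \<tau>} \<subseteq> carrier G"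
      unfolding small_def using K by (intro conjI exI[of _ "K \<tau>"]) auto
  qed (use F cover in auto)
  then obtain \<tau> B where \<tau>: "\<tau> \<in> F" and B: "small \<tau> B" "carrier G \<subseteq> B" by blast
  then obtain L where "compactin (S \<tau>) L" "\<eta> \<tau> ` carrier G \<subseteq> L" unfolding small_def by blast
  then show ?thesis
    by (rule compact_completion_imp_maximally_almost_periodic[OF H[OF \<tau>] haus[OF \<tau>]])
qed

theorem theorem4p7:
  fixes G :: "('a, 'b) monoid_scheme" and T :: "'a topology"
  assumes "locally_compact_group G T"
    and "unital_function_algebra (reduced_spine G T)"
  shows "maximally_almost_periodic G T"
proof -
  obtain e where e: "e \<in> reduced_spine G T" "\<And>u. u \<in> reduced_spine G T \<Longrightarrow> (\<lambda>x. e x * u x) = u"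
    using assms(2) by (auto simp: unital_function_algebra_def)
  have one: "e x = 1" if x: "x \<in> carrier G" for x
  proof -
    obtain u where "u \<in> reduced_spine G T" "u x \<noteq> 0"
      using reduced_spine_nonvanishing[OF assms(1) x] by blast
    then show ?thesis using fun_cong[OF e(2), of u x] by simp
  qed
  obtain F u where F: "finite F" "F \<subseteq> reduced_topologies G T" "\<And>\<tau>. \<tau> \<in> F \<Longrightarrow> u \<tau> \<in> fourier_pullback G T \<tau>"
      and near: "fs_norm G T (\<lambda>x. e x - (\<Sum>\<tau>\<in>F. u \<tau> x)) < ennreal (1 / 2)"
  proof -
    have "0 < (1 / 2 :: real)" by simp
    then have "\<exists>v\<in>{(\<lambda>x. \<Sum>\<tau>\<in>F. u \<tau> x) | F u. finite F \<and> F \<subseteq> reduced_topologies G T \<and>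
        (\<forall>\<tau>\<in>F. u \<tau> \<in> fourier_pullback G T \<tau>)}. fs_norm G T (\<lambda>x. e x - v x) < ennreal (1 / 2)"
      using e(1) unfolding reduced_spine_def fs_closure_def by blast
    then show ?thesis using that by blast
  qed
  \<comment> \<open>This gives \<open>card F * \<epsilon> < 1 / 2\<close>; the summand
    \<open>2\<close> makes the inequality strict and the denominator positive even for empty
    \<open>F\<close>.\<close>
  define \<epsilon> where "\<epsilon> = 1 / (2 * real (card F) + 2)"
  have eps: "0 < \<epsilon>" by (simp add: \<epsilon>_def)
  have "\<exists>H S \<eta> K. lc_completion G T \<tau> (H :: 'a set set monoid) S \<eta> \<and> compactin S K \<and>
    (\<forall>x\<in>carrier G. \<eta> x \<notin> K \<longrightarrow> cmod (u \<tau> x) < \<epsilon>)" if "\<tau> \<in> F" for \<tau>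
    by (rule fourier_pullback_small[OF F(3)[OF that] eps])
  then obtain H :: "'a topology \<Rightarrow> 'a set set monoid" and S \<eta> K where
    H: "\<And>\<tau>. \<tau> \<in> F \<Longrightarrow> lc_completion G T \<tau> (H \<tau>) (S \<tau>) (\<eta> \<tau>)"
    and K: "\<And>\<tau>. \<tau> \<in> F \<Longrightarrow> compactin (S \<tau>) (K \<tau>)"
    and small: "\<And>\<tau> x. \<lbrakk>\<tau> \<in> F; x \<in> carrier G; \<eta> \<tau> x \<notin> K \<tau>\<rbrakk> \<Longrightarrow> cmod (u \<tau> x) < \<epsilon>"
    by metis
  show ?thesis
  proof (rule maximally_almost_periodic_covering)
    show "topological_group G T" using assms(1) by (simp add: locally_compact_group_def)
    show "Hausdorff_space \<tau>" if "\<tau> \<in> F" for \<tau> using that F(2) by (auto simp: reduced_topologies_def)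
    fix x assume x: "x \<in> carrier G"
    \<comment> \<open>At a point outside all preimages every summand is below
      \<open>\<epsilon>\<close>, so the sum would be within \<open>1 / 2\<close> of both
      \<open>0\<close> and \<open>1\<close>.\<close>
    show "\<exists>\<tau>\<in>F. \<eta> \<tau> x \<in> K \<tau>"
    proof (rule ccontr)
      assume "\<not> ?thesis"
      then have "cmod (\<Sum>\<tau>\<in>F. u \<tau> x) \<le> (\<Sum>\<tau>\<in>F. \<epsilon>)"
        using small x by (intro sum_norm_le) (auto intro!: less_imp_le)
      also have "\<dots> < 1 / 2" by (simp add: \<epsilon>_def field_simps)
      finally have "cmod (\<Sum>\<tau>\<in>F. u \<tau> x) < 1 / 2" .
      moreover have "cmod (1 - (\<Sum>\<tau>\<in>F. u \<tau> x)) < 1 / 2"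
        using fs_norm_bound[OF near x] one[OF x] by simp
      moreover have "1 \<le> cmod (1 - (\<Sum>\<tau>\<in>F. u \<tau> x)) + cmod (\<Sum>\<tau>\<in>F. u \<tau> x)"
        using norm_triangle_ineq[of "1 - (\<Sum>\<tau>\<in>F. u \<tau> x)" "\<Sum>\<tau>\<in>F. u \<tau> x"] by simp
      ultimately show False by linarith
    qed
  qed (use F H K in auto)
qed

end
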